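(* Let $N$ be a positive integer, let $e,g,v>0$ be real constants, and let $n_1,\dots,n_N$ be nonnegative integers. Let the field configuration $(\phi_i,B^i_\ell)_{1\le i\le N,\ \ell=1,2}$, with $\phi_i$ complex-valued and $B^i_\ell$ real-valued, be a solution of $$4B^i_{12}=\frac{g^2}{N}\left(v^2-|\phi_i|^2\right)+\left(e^2-\frac{g^2}{N}\right)\left(v^2-\frac1N\sum_{j=1}^N|\phi_j|^2\right),$$ $$(\partial_1+\mathrm{i}\,\partial_2)\phi_i=\mathrm{i}\,(B^i_1+\mathrm{i}B^i_2)\phi_i,\qquad i=1,\dots,N,$$ in one of the following two situations: (1) over a doubly periodic domain $\Omega\subset\mathbb{R}^2$, the fields being doubly periodic in the sense of 't Hooft and each $\phi_i$ having exactly $n_i$ zeros in $\Omega$, counted with multiplicities; or (2) over the full plane $\mathbb{R}^2$, each $\phi_i$ having exactly $n_i$ zeros in $\mathbb{R}^2$, counted with multiplicities, and $\lim_{|x|\to\infty}|\phi_i|(x)=v$ for $i=1,\dots,N$. Then the fluxes are quantized and given by $$\int B^i_{12}\,\mathrm{d}x=2\pi n_i,\qquad i=1,\dots,N,$$ where the integral is evaluated over $\Omega$ in situation (1) and over $\mathbb{R}^2$ in situation (2).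
   Context: Notation: $x=(x^1,x^2)$ are coordinates on $\mathbb{R}^2$, $\partial_\ell=\partial/\partial x^\ell$, $\mathrm{i}=\sqrt{-1}$, and $B^i_{12}=\partial_1B^i_2-\partial_2B^i_1$. All fields are smooth. Doubly periodic domain and 't Hooft boundary condition: $\Omega$ is a fundamental cell (parallelogram) of a lattice in $\mathbb{R}^2$ generated by two linearly independent vectors $\tau_1,\tau_2$; opposite sides are identified, so points of $\Omega$ are points of the 2-torus $\mathbb{R}^2/(\mathbb{Z}\tau_1+\mathbb{Z}\tau_2)$. The fields are periodic up to gauge transformations: they are defined on $\mathbb{R}^2$ and for each $i$ and each $k=1,2$ there is a smooth real-valued function $\xi_{i,k}$ such that $\phi_i(x+\tau_k)=\mathrm{e}^{\mathrm{i}\xi_{i,k}(x)}\phi_i(x)$ and $B^i_\ell(x+\tau_k)=B^i_\ell(x)+\partial_\ell\xi_{i,k}(x)$, $\ell=1,2$. In particular $|\phi_i|^2$ and $B^i_{12}$ are genuinely periodic. Zeros: the second equation implies that the zeros of each (not identically vanishing) $\phi_i$ are isolated with positive integer multiplicities; near a zero $p$ of multiplicity $m$, $\phi_i(z)=(z-p)^m\psi(z)$ with $\psi$ smooth and nonvanishing, where $z=x^1+\mathrm{i}x^2$ and $p$ is viewed as a complex number. *)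

theory Defs
  imports "HOL-Analysis.Analysis"
begin

text \<open>The two coordinate directions are the elements \<open>1\<close> and \<open>2\<close> of the index type \<open>2\<close>
  (where \<open>2 = 0\<close>), so that \<open>x $ 1\<close> and \<open>x $ 2\<close> are the coordinates of \<open>x\<close>.\<close>

definition partial_deriv :: "2 \<Rightarrow> (real^2 \<Rightarrow> 'a::real_normed_vector) \<Rightarrow> real^2 \<Rightarrow> 'a"
  where "partial_deriv l f x = frechet_derivative f (at x) (axis l 1)"

text \<open>\<open>C\<^sup>\<infinity>\<close> on an open set: all iterated partial derivatives are totally differentiable
  (and hence continuous) at every point. The empty list covers \<open>f\<close> itself.\<close>

definition smooth_on :: "(real^2) set \<Rightarrow> (real^2 \<Rightarrow> 'a::real_normed_vector) \<Rightarrow> bool"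
  where "smooth_on S f \<longleftrightarrow> (\<forall>ls. \<forall>x\<in>S. foldr partial_deriv ls f differentiable (at x))"

abbreviation smooth :: "(real^2 \<Rightarrow> 'a::real_normed_vector) \<Rightarrow> bool"
  where "smooth \<equiv> smooth_on UNIV"

definition field_strength :: "(2 \<Rightarrow> real^2 \<Rightarrow> real) \<Rightarrow> real^2 \<Rightarrow> real"
  where "field_strength A x = partial_deriv 1 (A 2) x - partial_deriv 2 (A 1) x"

definition vortex_solution_on ::
    "(real^2) set \<Rightarrow> nat \<Rightarrow> real \<Rightarrow> real \<Rightarrow> real \<Rightarrow>
     (nat \<Rightarrow> real^2 \<Rightarrow> complex) \<Rightarrow> (nat \<Rightarrow> 2 \<Rightarrow> real^2 \<Rightarrow> real) \<Rightarrow> bool"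
  where "vortex_solution_on S N e g v \<phi> B \<longleftrightarrow>
    (\<forall>i\<in>{1..N}. \<forall>x\<in>S.
       4 * field_strength (B i) x =
         g^2 / real N * (v^2 - (cmod (\<phi> i x))^2)
         + (e^2 - g^2 / real N) * (v^2 - (1 / real N) * (\<Sum>j\<in>{1..N}. (cmod (\<phi> j x))^2))
     \<and> partial_deriv 1 (\<phi> i) x + \<i> * partial_deriv 2 (\<phi> i) x =
         \<i> * (of_real (B i 1 x) + \<i> * of_real (B i 2 x)) * \<phi> i x)"

definition complex_coord :: "real^2 \<Rightarrow> complex"
  where "complex_coord x = Complex (x $ 1) (x $ 2)"

definition zero_of_multiplicity :: "(real^2 \<Rightarrow> complex) \<Rightarrow> real^2 \<Rightarrow> nat \<Rightarrow> bool"
  where "zero_of_multiplicity f p m \<longleftrightarrow> m > 0 \<and>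
    (\<exists>r>0. \<exists>\<psi>. smooth_on (ball p r) \<psi> \<and> (\<forall>x\<in>ball p r. \<psi> x \<noteq> 0 \<and>
       f x = (complex_coord x - complex_coord p) ^ m * \<psi> x))"

definition has_zeros_counted :: "(real^2 \<Rightarrow> complex) \<Rightarrow> (real^2) set \<Rightarrow> nat \<Rightarrow> bool"
  where "has_zeros_counted f S n \<longleftrightarrow>
    finite {p\<in>S. f p = 0} \<and>
    (\<exists>m. (\<forall>p\<in>{p\<in>S. f p = 0}. zero_of_multiplicity f p (m p)) \<and>
         (\<Sum>p\<in>{p\<in>S. f p = 0}. m p) = n)"

text \<open>The half-open cell contains exactly one representative of each point of the torus;
  the base point \<open>a\<close> allows for an arbitrary translate.\<close>

definition period_cell :: "real^2 \<Rightarrow> real^2 \<Rightarrow> real^2 \<Rightarrow> (real^2) set"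
  where "period_cell a \<tau>1 \<tau>2 =
    {a + s *\<^sub>R \<tau>1 + t *\<^sub>R \<tau>2 | s t. 0 \<le> s \<and> s < 1 \<and> 0 \<le> t \<and> t < 1}"

definition gauge_periodic ::
    "real^2 \<Rightarrow> (real^2 \<Rightarrow> complex) \<Rightarrow> (2 \<Rightarrow> real^2 \<Rightarrow> real) \<Rightarrow> bool"
  where "gauge_periodic \<tau> f A \<longleftrightarrow>
    (\<exists>\<xi> :: real^2 \<Rightarrow> real. smooth \<xi> \<and>
       (\<forall>x. f (x + \<tau>) = exp (\<i> * of_real (\<xi> x)) * f x) \<and>
       (\<forall>l x. A l (x + \<tau>) = A l x + partial_deriv l \<xi> x))"

end

theory Submission
  imports Defs "HOL-Real_Asymp.Real_Asymp"
begin

text \<open>Away from the zeros of \<open>\<phi>\<^sub>i\<close> the second equation and the symmetry of mixed partial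
  derivatives give \<open>\<Delta> ln \<bar>\<phi>\<^sub>i\<bar>\<^sup>2 = - 2 B\<^sup>i\<^sub>1\<^sub>2\<close>. Around a zero \<open>q\<close> of multiplicity \<open>m\<close> one
  subtracts \<open>m\<close> times the \<open>C\<^sup>2\<close> truncation of \<open>ln \<bar>x - q\<bar>\<^sup>2\<close> to the unit disc, whose regular
  part has a Laplacian with integral \<open>- 4 \<pi>\<close>. This leaves a \<open>C\<^sup>2\<close> function \<open>h\<close> on the whole plane
  with \<open>\<Delta> h = - 2 B\<^sup>i\<^sub>1\<^sub>2 +\<close> bumps of total mass \<open>4 \<pi> n\<^sub>i\<close>, so it remains to see that \<open>\<Delta> h\<close>
  integrates to zero. On the torus \<open>h\<close> is periodic, and the integral of a derivative of a periodic
  function vanishes by translation invariance. On the plane the functions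
  \<open>w\<^sub>i = ln (\<bar>\<phi>\<^sub>i\<bar>\<^sup>2 / v\<^sup>2)\<close> satisfy an elliptic system whose linearization at infinity is
  \<open>\<Delta> w = M w\<close> with \<open>M\<close> positive definite (its eigenvalues are positive multiples of \<open>g\<^sup>2 / N\<close> and
  \<open>e\<^sup>2\<close>). By the maximum principle they decay like \<open>\<bar>x\<bar>\<^sup>-\<^sup>4\<close>, so that everything is integrable and
  Green's identity against cutoff functions shows that the integral of \<open>\<Delta> h\<close> is zero.\<close>

subsection \<open>Calculus of partial derivatives\<close>

text \<open>The zero set may be infinite: on the torus it is the full lattice orbit of the zeros in
  one cell. Subtracting untruncated logarithms would give a divergent sum; truncated to unit discs,
  only finitely many of them are felt near any point, and their sum is as periodic as the zero set.
  On the plane the same truncation leaves h equal to ln |phi_i|^2 far out, where it tends to ln v^2.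

  On the plane the system is coupled while the maximum principle is scalar. It is applied to the
  single function H = sum of the w_i^2, whose Laplacian near infinity is at least a positive
  multiple of H. A barrier of order |x|^-8 for H yields the order |x|^-4 for every w_i, and through
  the first equation for B_12 as well; in two dimensions this is integrable. No estimate for
  gradients is required, because Green's identity moves both derivatives onto the cutoff.

  The logarithm has no usable value at a zero. Identities there are obtained by continuity from the
  punctured neighbourhood.\<close>

lemma partial_deriv_eq:
  assumes "(f has_derivative D) (at x)"
  shows "partial_deriv l f x = D (axis l 1)"
  using frechet_derivative_at[OF assms] by (simp add: partial_deriv_def)

text \<open>No differentiability is assumed: \<open>frechet_derivative\<close> is a choice from the
  set of derivatives at the point, and functions that agree near the point have the same such
  set.\<close>

lemma partial_deriv_cong_open:
  assumes "open S" "x \<in> S" "\<And>y. y \<in> S \<Longrightarrow> f y = g y"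
  shows "partial_deriv l f x = partial_deriv l g x"
proof -
  have "(f has_derivative D) (at x) \<longleftrightarrow> (g has_derivative D) (at x)" for D
    using has_derivative_transform_within_open[of f D x UNIV S g]
      has_derivative_transform_within_open[of g D x UNIV S f] assms by auto
  then show ?thesis
    unfolding partial_deriv_def frechet_derivative_def by simp
qed

lemma differentiable_cong_open:
  assumes "open S" "x \<in> S" "\<And>y. y \<in> S \<Longrightarrow> f y = g y" "f differentiable at x"
  shows "g differentiable at x"
  using has_derivative_transform_within_open[of f _ x UNIV S g] assms unfolding differentiable_def by blast

lemma partial_deriv_const [simp]: "partial_deriv l (\<lambda>_. c) = (\<lambda>_. 0)"
  by (rule ext, subst partial_deriv_eq[OF has_derivative_const]) simp

lemma has_derivative_frechet:
  "f differentiable at x \<Longrightarrow> (f has_derivative frechet_derivative f (at x)) (at x)"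
  using frechet_derivative_works by blast

lemma partial_deriv_add:
  assumes "f differentiable at x" "g differentiable at x"
  shows "partial_deriv l (\<lambda>y. f y + g y) x = partial_deriv l f x + partial_deriv l g x"
  by (subst partial_deriv_eq[OF has_derivative_add[OF assms[THEN has_derivative_frechet]]])
    (simp add: partial_deriv_def)

lemma partial_deriv_diff:
  assumes "f differentiable at x" "g differentiable at x"
  shows "partial_deriv l (\<lambda>y. f y - g y) x = partial_deriv l f x - partial_deriv l g x"
  by (subst partial_deriv_eq[OF has_derivative_diff[OF assms[THEN has_derivative_frechet]]])
    (simp add: partial_deriv_def)

lemma partial_deriv_mult:
  fixes f g :: "real^2 \<Rightarrow> 'a::real_normed_algebra"
  assumes "f differentiable at x" "g differentiable at x"
  shows "partial_deriv l (\<lambda>y. f y * g y) x = f x * partial_deriv l g x + partial_deriv l f x * g x"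
  by (subst partial_deriv_eq[OF has_derivative_mult[OF assms[THEN has_derivative_frechet]]])
    (simp add: partial_deriv_def)

lemma partial_deriv_bounded_linear:
  assumes "bounded_linear L" "f differentiable at x"
  shows "partial_deriv l (\<lambda>y. L (f y)) x = L (partial_deriv l f x)"
  by (subst partial_deriv_eq[OF bounded_linear.has_derivative[OF assms(1) has_derivative_frechet[OF assms(2)]]])
    (simp add: partial_deriv_def)

lemma partial_deriv_compose:
  assumes "f differentiable at x" "(\<rho> has_real_derivative d) (at (f x))"
  shows "(\<lambda>y. \<rho> (f y)) differentiable at x"
    and "partial_deriv l (\<lambda>y. \<rho> (f y)) x = d * partial_deriv l f x"
proof -
  have D: "((\<lambda>y. \<rho> (f y)) has_derivative (\<lambda>v. d * frechet_derivative f (at x) v)) (at x)"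
    using has_derivative_compose[OF has_derivative_frechet[OF assms(1)], of \<rho> "(*) d"] assms(2)
    by (simp add: has_field_derivative_def)
  then show "(\<lambda>y. \<rho> (f y)) differentiable at x" by (auto simp: differentiable_def)
  show "partial_deriv l (\<lambda>y. \<rho> (f y)) x = d * partial_deriv l f x"
    by (subst partial_deriv_eq[OF D]) (simp add: partial_deriv_def)
qed

lemma has_derivative_shift_iff:
  "((\<lambda>y. f (y - p)) has_derivative D) (at x) \<longleftrightarrow> (f has_derivative D) (at (x - p))"
proof
  assume "((\<lambda>y. f (y - p)) has_derivative D) (at x)"
  moreover have "((\<lambda>y. y + p) has_derivative (\<lambda>v. v)) (at (x - p))"
    by (auto intro!: derivative_eq_intros)
  ultimately show "(f has_derivative D) (at (x - p))"
    using has_derivative_compose[of "\<lambda>y. y + p" "\<lambda>v. v" "x - p" UNIV "\<lambda>y. f (y - p)" D] by simp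
next
  assume "(f has_derivative D) (at (x - p))"
  moreover have "((\<lambda>y. y - p) has_derivative (\<lambda>v. v)) (at x)"
    by (auto intro!: derivative_eq_intros)
  ultimately show "((\<lambda>y. f (y - p)) has_derivative D) (at x)"
    using has_derivative_compose[of "\<lambda>y. y - p" "\<lambda>v. v" x UNIV f D] by simp
qed

text \<open>An equation between functions, true also where \<open>f\<close> is not differentiable,
  so that it rewrites iterated partials directly.\<close>

lemma partial_deriv_shift: "partial_deriv l (\<lambda>y. f (y - p)) = (\<lambda>x. partial_deriv l f (x - p))"
  unfolding partial_deriv_def frechet_derivative_def by (simp add: has_derivative_shift_iff)

lemma differentiable_shift: "(\<lambda>y. f (y - p)) differentiable at x \<longleftrightarrow> f differentiable at (x - p)"
  unfolding differentiable_def by (simp add: has_derivative_shift_iff)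

lemma differentiable_Re_Im:
  assumes "f differentiable at x"
  shows "(\<lambda>y. Re (f y)) differentiable at x" "(\<lambda>y. Im (f y)) differentiable at x"
  using assms bounded_linear.has_derivative[OF bounded_linear_Re]
    bounded_linear.has_derivative[OF bounded_linear_Im] unfolding differentiable_def by blast+

lemma differentiable_scaled:
  fixes f :: "real^2 \<Rightarrow> real"
  shows "f differentiable at x \<Longrightarrow> (\<lambda>y. c * f y) differentiable at x"
  by (intro differentiable_mult differentiable_const)

lemma partial_deriv_along_line:
  assumes "f differentiable at (x + t *\<^sub>R axis l 1)"
  shows "((\<lambda>t. f (x + t *\<^sub>R axis l 1)) has_vector_derivative partial_deriv l f (x + t *\<^sub>R axis l 1)) (at t)"
proof -
  have "((\<lambda>t. x + t *\<^sub>R axis l (1::real)) has_vector_derivative axis l 1) (at t)"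
    by (auto intro!: derivative_eq_intros)
  then show ?thesis
    using vector_derivative_diff_chain_within[of "\<lambda>t. x + t *\<^sub>R axis l (1::real)" "axis l 1" t UNIV f
       "frechet_derivative f (at (x + t *\<^sub>R axis l 1))"]
      has_derivative_at_withinI[OF has_derivative_frechet[OF assms]]
    by (simp add: o_def partial_deriv_def)
qed

lemma partial_deriv_along_line_real:
  fixes f :: "real^2 \<Rightarrow> real"
  assumes "f differentiable at (x + t *\<^sub>R axis l 1)"
  shows "((\<lambda>t. f (x + t *\<^sub>R axis l 1)) has_real_derivative partial_deriv l f (x + t *\<^sub>R axis l 1)) (at t)"
  using partial_deriv_along_line[OF assms] by (simp add: has_real_derivative_iff_has_vector_derivative)

lemma smooth_on_partial: "smooth_on S f \<Longrightarrow> smooth_on S (partial_deriv l f)"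
  unfolding smooth_on_def
proof (intro allI)
  fix ls assume "\<forall>ls. \<forall>x\<in>S. foldr partial_deriv ls f differentiable at x"
  from this[rule_format, of _ "ls @ [l]"]
  show "\<forall>x\<in>S. foldr partial_deriv ls (partial_deriv l f) differentiable at x" by simp
qed

lemma smooth_on_differentiable: "smooth_on S f \<Longrightarrow> x \<in> S \<Longrightarrow> f differentiable at x"
  unfolding smooth_on_def by (drule spec[of _ "[]"]) simp

lemma smooth_on_continuous: "smooth_on S f \<Longrightarrow> continuous_on S f"
  by (simp add: smooth_on_differentiable continuous_at_imp_continuous_on differentiable_imp_continuous_within)

subsection \<open>Twice differentiable functions and the Laplacian\<close>

text \<open>Only the pure second partials have to be continuous. They are the ones that enter
  \<open>laplacian\<close>, so mixed partials need not be followed through sums, compositions and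
  gluing.\<close>

definition C2_on :: "(real^2) set \<Rightarrow> (real^2 \<Rightarrow> real) \<Rightarrow> bool"
  where "C2_on S f \<longleftrightarrow> (\<forall>x\<in>S. f differentiable at x) \<and>
    (\<forall>l. (\<forall>x\<in>S. partial_deriv l f differentiable at x) \<and>
         continuous_on S (partial_deriv l (partial_deriv l f)))"

definition laplacian :: "(real^2 \<Rightarrow> real) \<Rightarrow> real^2 \<Rightarrow> real"
  where "laplacian f x = (\<Sum>l\<in>UNIV. partial_deriv l (partial_deriv l f) x)"

lemma C2_onD:
  assumes "C2_on S f" "x \<in> S"
  shows "f differentiable at x" "partial_deriv l f differentiable at x"
  using assms by (auto simp: C2_on_def)

lemma C2_on_continuous:
  assumes "C2_on S f"
  shows "continuous_on S f" "continuous_on S (partial_deriv l f)"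
    "continuous_on S (partial_deriv l (partial_deriv l f))" "continuous_on S (laplacian f)"
proof -
  show f: "continuous_on S f" "continuous_on S (partial_deriv l f)"
    using assms by (auto simp: C2_on_def intro!: continuous_at_imp_continuous_on differentiable_imp_continuous_within)
  show "continuous_on S (partial_deriv l (partial_deriv l f))" using assms by (simp add: C2_on_def)
  show "continuous_on S (laplacian f)"
    using assms unfolding laplacian_def[abs_def] C2_on_def by (intro continuous_on_sum) blast
qed

lemma C2_on_subset: "C2_on S f \<Longrightarrow> T \<subseteq> S \<Longrightarrow> C2_on T f"
  unfolding C2_on_def by (meson continuous_on_subset subsetD)

lemma partial_deriv2_cong_open:
  assumes "open S" "x \<in> S" "\<And>y. y \<in> S \<Longrightarrow> f y = g y"
  shows "partial_deriv k (partial_deriv l f) x = partial_deriv k (partial_deriv l g) x"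
  using assms by (intro partial_deriv_cong_open[of S]) (auto intro: partial_deriv_cong_open[of S])

lemma laplacian_cong_open:
  assumes "open S" "x \<in> S" "\<And>y. y \<in> S \<Longrightarrow> f y = g y"
  shows "laplacian f x = laplacian g x"
  using partial_deriv2_cong_open[OF assms] by (simp add: laplacian_def)

lemma C2_on_cong_open:
  assumes "open S" "\<And>y. y \<in> S \<Longrightarrow> f y = g y" "C2_on S f"
  shows "C2_on S g"
  unfolding C2_on_def
proof (intro conjI ballI allI)
  fix x l assume x: "x \<in> S"
  show "g differentiable at x"
    using differentiable_cong_open[OF assms(1) x assms(2)] assms(3) x by (auto simp: C2_on_def)
  show "partial_deriv l g differentiable at x"
    using differentiable_cong_open[OF assms(1) x partial_deriv_cong_open[OF assms(1) _ assms(2)]] assms(3) x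
    by (auto simp: C2_on_def)
next
  fix l
  have "continuous_on S (partial_deriv l (partial_deriv l f))"
    using assms(3) by (simp add: C2_on_def)
  then show "continuous_on S (partial_deriv l (partial_deriv l g))"
    by (rule continuous_on_eq) (rule partial_deriv2_cong_open[OF assms(1) _ assms(2)])
qed

text \<open>Makes it possible to treat globally a function that has different formulas near
  different points, as the regularized logarithm does.\<close>

lemma C2_on_local:
  assumes "\<And>x. x \<in> S \<Longrightarrow> \<exists>U. open U \<and> x \<in> U \<and> C2_on U f"
  shows "C2_on S f"
  unfolding C2_on_def
proof (intro conjI ballI allI)
  fix x l assume x: "x \<in> S"
  show "f differentiable at x" "partial_deriv l f differentiable at x"
    using assms[OF x] by (auto simp: C2_on_def)
next
  fix l
  have "isCont (partial_deriv l (partial_deriv l f)) x" if "x \<in> S" for x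
    using assms[OF that] C2_on_continuous(3) continuous_on_eq_continuous_at by blast
  then show "continuous_on S (partial_deriv l (partial_deriv l f))"
    by (intro continuous_at_imp_continuous_on ballI)
qed

lemma C2_on_const: "C2_on S (\<lambda>_. c)" and laplacian_const: "laplacian (\<lambda>_. c) x = 0"
  by (simp_all add: C2_on_def laplacian_def)

text \<open>\<open>g\<close> and \<open>h\<close> are explicit formulas for the first and second
  partials. They need to be right on \<open>S\<close> only: since \<open>S\<close> is open, a
  formula valid there may be differentiated again.\<close>

lemma C2_on_intro:
  assumes S: "open S"
    and f: "\<And>x. x \<in> S \<Longrightarrow> f differentiable at x"
    and g: "\<And>x l. x \<in> S \<Longrightarrow> partial_deriv l f x = g l x" "\<And>x l. x \<in> S \<Longrightarrow> g l differentiable at x"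
    and h: "\<And>x l. x \<in> S \<Longrightarrow> partial_deriv l (g l) x = h l x" "\<And>l. continuous_on S (h l)"
  shows "C2_on S f" "\<And>x. x \<in> S \<Longrightarrow> laplacian f x = (\<Sum>l\<in>UNIV. h l x)"
proof -
  have pd2: "partial_deriv l (partial_deriv l f) x = h l x" if "x \<in> S" for x l
    by (rule trans[OF partial_deriv_cong_open[OF S that g(1)] h(1)[OF that]])
  then show "laplacian f x = (\<Sum>l\<in>UNIV. h l x)" if "x \<in> S" for x
    unfolding laplacian_def using that by (intro sum.cong refl)
  show "C2_on S f"
    unfolding C2_on_def
  proof (intro conjI ballI allI)
    fix x l assume x: "x \<in> S"
    show "f differentiable at x" by (rule f[OF x])
    show "partial_deriv l f differentiable at x"
      by (rule differentiable_cong_open[OF S x g(1)[symmetric] g(2)[OF x]])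
  next
    fix l show "continuous_on S (partial_deriv l (partial_deriv l f))"
      by (rule continuous_on_eq[OF h(2)[of l]]) (simp only: pd2)
  qed
qed

lemma
  assumes "open S" "C2_on S f" "C2_on S g"
  shows C2_on_add: "C2_on S (\<lambda>x. f x + g x)"
    and laplacian_add: "x \<in> S \<Longrightarrow> laplacian (\<lambda>x. f x + g x) x = laplacian f x + laplacian g x"
proof -
  have d: "(\<lambda>x. f x + g x) differentiable at x"
    "partial_deriv l (\<lambda>x. f x + g x) x = partial_deriv l f x + partial_deriv l g x"
    "(\<lambda>x. partial_deriv l f x + partial_deriv l g x) differentiable at x"
    "partial_deriv l (\<lambda>x. partial_deriv l f x + partial_deriv l g x) x =
      partial_deriv l (partial_deriv l f) x + partial_deriv l (partial_deriv l g) x" if "x \<in> S" for l x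
    using C2_onD[OF assms(2) that] C2_onD[OF assms(3) that] by (simp_all add: partial_deriv_add)
  have "continuous_on S (\<lambda>x. partial_deriv l (partial_deriv l f) x + partial_deriv l (partial_deriv l g) x)" for l
    by (intro continuous_on_add C2_on_continuous(3) assms)
  note * = C2_on_intro[OF assms(1) d this]
  show "C2_on S (\<lambda>x. f x + g x)" by (rule *(1))
  show "laplacian (\<lambda>x. f x + g x) x = laplacian f x + laplacian g x" if "x \<in> S"
  proof -
    have "laplacian (\<lambda>x. f x + g x) x =
      (\<Sum>l\<in>UNIV. partial_deriv l (partial_deriv l f) x + partial_deriv l (partial_deriv l g) x)"
      using that by - (rule *(2))
    then show ?thesis by (simp only: laplacian_def[of f] laplacian_def[of g] sum.distrib)
  qed
qed

lemma
  assumes "open S" "C2_on S f"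
  shows C2_on_cmult: "C2_on S (\<lambda>x. c * f x)"
    and laplacian_cmult: "x \<in> S \<Longrightarrow> laplacian (\<lambda>x. c * f x) x = c * laplacian f x"
proof -
  have pd: "partial_deriv l (\<lambda>x. c * f x) x = c * partial_deriv l f x" if "f differentiable at x" for f x l
    using partial_deriv_mult[of "\<lambda>_. c" x f l] that by simp
  have d: "(\<lambda>x. c * f x) differentiable at x"
    "partial_deriv l (\<lambda>x. c * f x) x = c * partial_deriv l f x"
    "(\<lambda>x. c * partial_deriv l f x) differentiable at x"
    "partial_deriv l (\<lambda>x. c * partial_deriv l f x) x = c * partial_deriv l (partial_deriv l f) x" if "x \<in> S" for l x
    using C2_onD[OF assms(2) that] by (simp_all add: pd differentiable_scaled)
  have "continuous_on S (\<lambda>x. c * partial_deriv l (partial_deriv l f) x)" for l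
    by (intro continuous_on_mult continuous_on_const C2_on_continuous(3) assms)
  note * = C2_on_intro[OF assms(1) d this]
  show "C2_on S (\<lambda>x. c * f x)" by (rule *(1))
  show "laplacian (\<lambda>x. c * f x) x = c * laplacian f x" if "x \<in> S"
  proof -
    have "laplacian (\<lambda>x. c * f x) x = (\<Sum>l\<in>UNIV. c * partial_deriv l (partial_deriv l f) x)"
      using that by - (rule *(2))
    then show ?thesis by (simp only: laplacian_def[of f] sum_distrib_left)
  qed
qed

lemma
  assumes "open S" "C2_on S f" "C2_on S g"
  shows C2_on_diff: "C2_on S (\<lambda>x. f x - g x)"
    and laplacian_diff: "x \<in> S \<Longrightarrow> laplacian (\<lambda>x. f x - g x) x = laplacian f x - laplacian g x"
proof -
  note * = C2_on_add[OF assms(1,2) C2_on_cmult[OF assms(1,3), of "-1"]]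
    laplacian_add[OF assms(1,2) C2_on_cmult[OF assms(1,3), of "-1"]]
  show "C2_on S (\<lambda>x. f x - g x)" using *(1) by simp
  show "laplacian (\<lambda>x. f x - g x) x = laplacian f x - laplacian g x" if "x \<in> S"
    using *(2)[OF that] laplacian_cmult[OF assms(1,3) that, of "-1"] by simp
qed

lemma
  assumes "open S" "\<And>i. i \<in> I \<Longrightarrow> C2_on S (f i)"
  shows C2_on_sum: "C2_on S (\<lambda>x. \<Sum>i\<in>I. f i x)"
    and laplacian_sum: "x \<in> S \<Longrightarrow> laplacian (\<lambda>x. \<Sum>i\<in>I. f i x) x = (\<Sum>i\<in>I. laplacian (f i) x)"
proof -
  have "C2_on S (\<lambda>x. \<Sum>i\<in>I. f i x) \<and> (\<forall>x\<in>S. laplacian (\<lambda>x. \<Sum>i\<in>I. f i x) x = (\<Sum>i\<in>I. laplacian (f i) x))"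
    using assms(2)
  proof (induction I rule: infinite_finite_induct)
    case (insert j I)
    then show ?case
      using C2_on_add[OF assms(1), of "f j" "\<lambda>x. \<Sum>i\<in>I. f i x"]
        laplacian_add[OF assms(1), of "f j" "\<lambda>x. \<Sum>i\<in>I. f i x"] by simp
  qed (auto simp: C2_on_const laplacian_const)
  then show "C2_on S (\<lambda>x. \<Sum>i\<in>I. f i x)"
    "x \<in> S \<Longrightarrow> laplacian (\<lambda>x. \<Sum>i\<in>I. f i x) x = (\<Sum>i\<in>I. laplacian (f i) x)" by auto
qed

lemma
  assumes "open S" "C2_on S f"
    and \<rho>: "\<And>x. x \<in> S \<Longrightarrow> (\<rho> has_real_derivative \<rho>' (f x)) (at (f x))"
      "\<And>x. x \<in> S \<Longrightarrow> (\<rho>' has_real_derivative \<rho>'' (f x)) (at (f x))"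
      "continuous_on (f ` S) \<rho>''"
  shows C2_on_compose: "C2_on S (\<lambda>x. \<rho> (f x))"
    and laplacian_compose: "x \<in> S \<Longrightarrow> laplacian (\<lambda>x. \<rho> (f x)) x =
      \<rho>'' (f x) * (\<Sum>l\<in>UNIV. (partial_deriv l f x)^2) + \<rho>' (f x) * laplacian f x"
proof -
  define g where "g l x = \<rho>' (f x) * partial_deriv l f x" for l x
  define h where "h l x = \<rho>'' (f x) * (partial_deriv l f x)^2 + \<rho>' (f x) * partial_deriv l (partial_deriv l f) x" for l x
  have d': "(\<lambda>x. \<rho>' (f x)) differentiable at x" "partial_deriv l (\<lambda>x. \<rho>' (f x)) x = \<rho>'' (f x) * partial_deriv l f x" if "x \<in> S" for l x
    using partial_deriv_compose[OF C2_onD(1)[OF assms(2) that] \<rho>(2)[OF that]] by auto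
  have a1: "(\<lambda>x. \<rho> (f x)) differentiable at x" if "x \<in> S" for x
    using partial_deriv_compose[OF C2_onD(1)[OF assms(2) that] \<rho>(1)[OF that]] by auto
  have a2: "partial_deriv l (\<lambda>x. \<rho> (f x)) x = g l x" if "x \<in> S" for l x
    using partial_deriv_compose[OF C2_onD(1)[OF assms(2) that] \<rho>(1)[OF that]] by (auto simp: g_def)
  have a3: "g l differentiable at x" if "x \<in> S" for l x
    unfolding g_def using d'[OF that] C2_onD(2)[OF assms(2) that] by (intro differentiable_mult)
  have a4: "partial_deriv l (g l) x = h l x" if "x \<in> S" for l x
    unfolding g_def using partial_deriv_mult[OF d'(1)[OF that] C2_onD(2)[OF assms(2) that]] d'(2)[OF that]
    by (simp add: h_def power2_eq_square algebra_simps)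
  have "continuous_on S (\<lambda>x. \<rho>'' (f x))"
    using continuous_on_compose2[OF \<rho>(3) C2_on_continuous(1)[OF assms(2)]] by auto
  moreover have "continuous_on S (\<lambda>x. \<rho>' (f x))"
    using d' by (intro continuous_at_imp_continuous_on ballI differentiable_imp_continuous_within) auto
  ultimately have a5: "continuous_on S (h l)" for l
    unfolding h_def by (intro continuous_intros C2_on_continuous[OF assms(2)])
  note * = C2_on_intro[OF assms(1) a1 a2 a3 a4 a5]
  show "C2_on S (\<lambda>x. \<rho> (f x))" by (rule *)
  show "x \<in> S \<Longrightarrow> laplacian (\<lambda>x. \<rho> (f x)) x =
      \<rho>'' (f x) * (\<Sum>l\<in>UNIV. (partial_deriv l f x)^2) + \<rho>' (f x) * laplacian f x"
    by (subst *) (auto simp: h_def laplacian_def sum.distrib sum_distrib_left)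
qed

lemma C2_on_shift: "C2_on ((\<lambda>y. y - p) ` S) f \<longleftrightarrow> C2_on S (\<lambda>y. f (y - p))"
proof -
  have c: "continuous_on ((\<lambda>y. y - p) ` S) F \<longleftrightarrow> continuous_on S (\<lambda>y. F (y - p))" for F :: "real^2 \<Rightarrow> real"
  proof
    assume "continuous_on ((\<lambda>y. y - p) ` S) F"
    then show "continuous_on S (\<lambda>y. F (y - p))"
      by (rule continuous_on_compose2) (auto intro!: continuous_intros)
  next
    assume "continuous_on S (\<lambda>y. F (y - p))"
    then have "continuous_on ((\<lambda>y. y - p) ` S) (\<lambda>z. (\<lambda>y. F (y - p)) (z + p))"
      by (rule continuous_on_compose2) (auto intro!: continuous_intros)
    then show "continuous_on ((\<lambda>y. y - p) ` S) F" by simp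
  qed
  show ?thesis
    unfolding C2_on_def c partial_deriv_shift differentiable_shift by simp
qed

lemma C2_on_UNIV_shift: "C2_on UNIV f \<Longrightarrow> C2_on UNIV (\<lambda>y. f (y - p))"
  using C2_on_shift[of p UNIV f] C2_on_subset[of UNIV f] by blast

lemma laplacian_shift: "laplacian (\<lambda>y. f (y - p)) x = laplacian f (x - p)"
  by (simp only: laplacian_def partial_deriv_shift)

lemma smooth_on_Re_Im_C2:
  assumes "open S" "smooth_on S f"
  shows "C2_on S (\<lambda>x. Re (f x))" "C2_on S (\<lambda>x. Im (f x))"
proof -
  have d: "f differentiable at x" "partial_deriv l f differentiable at x"
      "partial_deriv l (partial_deriv l f) differentiable at x" if "x \<in> S" for x l
    using assms(2) that by (meson smooth_on_differentiable smooth_on_partial)+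
  show "C2_on S (\<lambda>x. Re (f x))"
    by (rule C2_on_intro[OF assms(1), of _ "\<lambda>l x. Re (partial_deriv l f x)" "\<lambda>l x. Re (partial_deriv l (partial_deriv l f) x)"])
      (auto simp: d partial_deriv_bounded_linear[OF bounded_linear_Re] intro!: differentiable_Re_Im continuous_at_imp_continuous_on differentiable_imp_continuous_within)
  show "C2_on S (\<lambda>x. Im (f x))"
    by (rule C2_on_intro[OF assms(1), of _ "\<lambda>l x. Im (partial_deriv l f x)" "\<lambda>l x. Im (partial_deriv l (partial_deriv l f) x)"])
      (auto simp: d partial_deriv_bounded_linear[OF bounded_linear_Im] intro!: differentiable_Re_Im continuous_at_imp_continuous_on differentiable_imp_continuous_within)
qed

lemma C2_on_square: "open S \<Longrightarrow> C2_on S f \<Longrightarrow> C2_on S (\<lambda>x. (f x)^2)"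
  by (rule C2_on_compose[of S f "\<lambda>t. t^2" "\<lambda>t. 2 * t" "\<lambda>_. 2"]) (auto intro!: derivative_eq_intros)

lemma C2_on_ln:
  assumes "open S" "C2_on S f" "\<And>x. x \<in> S \<Longrightarrow> f x > 0"
  shows "C2_on S (\<lambda>x. ln (f x))"
proof (rule C2_on_compose[OF assms(1,2), of ln "\<lambda>t. inverse t" "\<lambda>t. - ((inverse t)^2)"])
  fix x assume "x \<in> S"
  then have "f x > 0" by (rule assms)
  then show "(ln has_real_derivative inverse (f x)) (at (f x))"
    "(inverse has_real_derivative - ((inverse (f x))\<^sup>2)) (at (f x))"
    by (auto intro!: derivative_eq_intros simp: power2_eq_square divide_inverse)
next
  show "continuous_on (f ` S) (\<lambda>t. - ((inverse t)^2))"
    using assms(3) by (force intro!: continuous_intros)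
qed

lemma C2_on_ln_cmod_sq:
  assumes "open S" "smooth_on S f" "\<And>x. x \<in> S \<Longrightarrow> f x \<noteq> 0"
  shows "C2_on S (\<lambda>x. ln ((cmod (f x))^2))"
proof (rule C2_on_ln[OF assms(1)])
  show "C2_on S (\<lambda>x. (cmod (f x))^2)"
    unfolding cmod_power2 by (intro C2_on_add C2_on_square assms smooth_on_Re_Im_C2)
qed (use assms in auto)

section \<open>Functions of the squared norm\<close>

lemma
  shows partial_deriv_norm_sq: "partial_deriv l (\<lambda>x::real^2. x \<bullet> x) x = 2 * (x $ l)"
    and C2_on_norm_sq: "C2_on UNIV (\<lambda>x::real^2. x \<bullet> x)"
    and laplacian_norm_sq: "laplacian (\<lambda>x::real^2. x \<bullet> x) x = 4"
proof -
  have D: "((\<lambda>x::real^2. x \<bullet> x) has_derivative (\<lambda>v. x \<bullet> v + v \<bullet> x)) (at x)" for x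
    by (auto intro!: derivative_eq_intros)
  have d: "(\<lambda>x::real^2. x \<bullet> x) differentiable at x" for x using D by (auto simp: differentiable_def)
  show p: "partial_deriv l (\<lambda>x::real^2. x \<bullet> x) x = 2 * (x $ l)" for x l
    by (subst partial_deriv_eq[OF D]) (simp add: inner_axis inner_axis' )
  have D2: "((\<lambda>x::real^2. 2 * (x $ l)) has_derivative (\<lambda>v. 2 * (v $ l))) (at x)" for x l
    by (intro has_derivative_mult_right bounded_linear_imp_has_derivative bounded_linear_vec_nth)
  have d2: "(\<lambda>x::real^2. 2 * (x $ l)) differentiable at x" for x l
    using D2 by (auto simp: differentiable_def)
  have p2: "partial_deriv l (\<lambda>x::real^2. 2 * (x $ l)) x = 2" for x l
    by (subst partial_deriv_eq[OF D2]) simp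
  note * = C2_on_intro[of UNIV "\<lambda>x::real^2. x \<bullet> x" "\<lambda>l x. 2 * (x $ l)" "\<lambda>_ _. 2", OF _ d p d2 p2]
  show "C2_on UNIV (\<lambda>x::real^2. x \<bullet> x)" by (rule *) auto
  show "laplacian (\<lambda>x::real^2. x \<bullet> x) x = 4" by (subst *) auto
qed

text \<open>Radial functions are written in t = \<open>x \<bullet> x\<close>, which unlike the norm
  is smooth at the origin. The formula combines the chain rule with |grad t|^2 = 4 t and the value 4
  of the Laplacian of t.\<close>

lemma
  fixes \<rho> :: "real \<Rightarrow> real"
  assumes "open S" "\<And>x. x \<in> S \<Longrightarrow> (\<rho> has_real_derivative \<rho>' (x \<bullet> x)) (at (x \<bullet> x))"
      "\<And>x. x \<in> S \<Longrightarrow> (\<rho>' has_real_derivative \<rho>'' (x \<bullet> x)) (at (x \<bullet> x))"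
      "continuous_on ((\<lambda>x. x \<bullet> x) ` S) \<rho>''"
  shows C2_on_radial: "C2_on S (\<lambda>x::real^2. \<rho> (x \<bullet> x))"
    and laplacian_radial: "x \<in> S \<Longrightarrow> laplacian (\<lambda>x::real^2. \<rho> (x \<bullet> x)) x =
      4 * ((x \<bullet> x) * \<rho>'' (x \<bullet> x) + \<rho>' (x \<bullet> x))"
proof -
  have C: "C2_on S (\<lambda>x::real^2. x \<bullet> x)" using C2_on_norm_sq by (rule C2_on_subset) auto
  show "C2_on S (\<lambda>x::real^2. \<rho> (x \<bullet> x))" by (rule C2_on_compose[OF assms(1) C assms(2-)])
  have "(\<Sum>l\<in>UNIV. (2 * (x $ l))^2) = 4 * (x \<bullet> x)"
    by (simp add: inner_vec_def sum_2 power2_eq_square)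
  then show "x \<in> S \<Longrightarrow> laplacian (\<lambda>x::real^2. \<rho> (x \<bullet> x)) x =
      4 * ((x \<bullet> x) * \<rho>'' (x \<bullet> x) + \<rho>' (x \<bullet> x))"
    using laplacian_compose[OF assms(1) C assms(2-), of x]
    by (simp add: partial_deriv_norm_sq laplacian_norm_sq algebra_simps)
qed

section \<open>Symmetry of mixed second partial derivatives\<close>

lemma mixed_second_difference:
  fixes f :: "real^2 \<Rightarrow> real"
  assumes f: "\<And>x. f differentiable at x" "\<And>x. partial_deriv k f differentiable at x" and h: "0 < h"
  shows "\<exists>y. dist y x \<le> 2 * h \<and>
    f (x + h *\<^sub>R axis k 1 + h *\<^sub>R axis l 1) - f (x + h *\<^sub>R axis k 1) - f (x + h *\<^sub>R axis l 1) + f x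
      = h^2 * partial_deriv l (partial_deriv k f) y"
proof -
  define G where "G t = f ((x + h *\<^sub>R axis l 1) + t *\<^sub>R axis k 1) - f (x + t *\<^sub>R axis k 1)" for t
  have "(G has_real_derivative (partial_deriv k f ((x + h *\<^sub>R axis l 1) + t *\<^sub>R axis k 1)
      - partial_deriv k f (x + t *\<^sub>R axis k 1))) (at t)" for t
    unfolding G_def by (intro DERIV_diff partial_deriv_along_line_real f)
  from MVT2[OF h this] obtain t where t: "0 < t" "t < h"
    "G h - G 0 = h * (partial_deriv k f ((x + h *\<^sub>R axis l 1) + t *\<^sub>R axis k 1)
      - partial_deriv k f (x + t *\<^sub>R axis k 1))" by auto
  have "((\<lambda>s. partial_deriv k f ((x + t *\<^sub>R axis k 1) + s *\<^sub>R axis l 1)) has_real_derivative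
      partial_deriv l (partial_deriv k f) ((x + t *\<^sub>R axis k 1) + s *\<^sub>R axis l 1)) (at s)" for s
    by (intro partial_deriv_along_line_real f)
  from MVT2[OF h this] obtain s where s: "0 < s" "s < h"
    "partial_deriv k f ((x + t *\<^sub>R axis k 1) + h *\<^sub>R axis l 1) - partial_deriv k f ((x + t *\<^sub>R axis k 1) + 0 *\<^sub>R axis l 1)
      = h * partial_deriv l (partial_deriv k f) ((x + t *\<^sub>R axis k 1) + s *\<^sub>R axis l 1)" by auto
  let ?y = "(x + t *\<^sub>R axis k 1) + s *\<^sub>R axis l 1"
  have "dist ?y x \<le> norm (t *\<^sub>R axis k (1::real)) + norm (s *\<^sub>R axis l (1::real))"
    unfolding dist_norm using norm_triangle_ineq[of "t *\<^sub>R axis k (1::real)" "s *\<^sub>R axis l (1::real)"]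
    by (simp only: add.assoc add_diff_cancel_left')
  then have "dist ?y x \<le> 2 * h" using t s by simp
  moreover have "G h - G 0 = h^2 * partial_deriv l (partial_deriv k f) ?y"
    using t(3) s(3) by (simp add: algebra_simps power2_eq_square)
  ultimately show ?thesis
    by (intro exI[of _ ?y]) (simp add: G_def algebra_simps)
qed

text \<open>The second difference is symmetric in \<open>k\<close> and \<open>l\<close>. The mean
  value theorem, used twice in either order, turns it into \<open>h^2\<close> times one or the other
  mixed partial at a point within \<open>2 * h\<close> of \<open>x\<close>; continuity at
  \<open>x\<close> then identifies the two limits.\<close>

lemma mixed_partial_derivs_commute:
  fixes f :: "real^2 \<Rightarrow> real"
  assumes f: "\<And>x. f differentiable at x" "\<And>x l. partial_deriv l f differentiable at x"
    and c: "\<And>k l. isCont (partial_deriv k (partial_deriv l f)) x"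
  shows "partial_deriv k (partial_deriv l f) x = partial_deriv l (partial_deriv k f) x"
proof -
  define h :: "nat \<Rightarrow> real" where "h n = inverse (Suc n)" for n
  have h: "h n > 0" for n by (simp add: h_def)
  have h0: "(\<lambda>n. 2 * h n) \<longlonglongrightarrow> 0"
    using tendsto_mult_right[OF LIMSEQ_inverse_real_of_nat, of 2] by (simp add: h_def)
  have "\<forall>n. \<exists>y. dist y x \<le> 2 * h n \<and>
    f (x + h n *\<^sub>R axis k 1 + h n *\<^sub>R axis l 1) - f (x + h n *\<^sub>R axis k 1) - f (x + h n *\<^sub>R axis l 1) + f x
      = (h n)^2 * partial_deriv l (partial_deriv k f) y" for k l
    by (intro allI mixed_second_difference[OF f h])
  note Y = choice[OF this]
  obtain y where y: "\<forall>n. dist (y n) x \<le> 2 * h n \<and> f (x + h n *\<^sub>R axis k 1 + h n *\<^sub>R axis l 1) - f (x + h n *\<^sub>R axis k 1) - f (x + h n *\<^sub>R axis l 1) + f x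
      = (h n)^2 * partial_deriv l (partial_deriv k f) (y n)" using Y[of k l] by (elim exE)
  obtain z where z: "\<forall>n. dist (z n) x \<le> 2 * h n \<and> f (x + h n *\<^sub>R axis l 1 + h n *\<^sub>R axis k 1) - f (x + h n *\<^sub>R axis l 1) - f (x + h n *\<^sub>R axis k 1) + f x
      = (h n)^2 * partial_deriv k (partial_deriv l f) (z n)" using Y[of l k] by (elim exE)
  have lim: "w \<longlonglongrightarrow> x" if "\<And>n. dist (w n) x \<le> 2 * h n" for w
    by (rule tendsto_dist_iff[THEN iffD2], rule tendsto_sandwich[OF _ _ tendsto_const h0])
      (simp_all add: that)
  have "y \<longlonglongrightarrow> x" "z \<longlonglongrightarrow> x"
    by (rule lim, use y z in blast)+
  then have "(\<lambda>n. partial_deriv l (partial_deriv k f) (y n)) \<longlonglongrightarrow> partial_deriv l (partial_deriv k f) x"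
    "(\<lambda>n. partial_deriv k (partial_deriv l f) (z n)) \<longlonglongrightarrow> partial_deriv k (partial_deriv l f) x"
    using c by (auto intro: isCont_tendsto_compose)
  moreover have "partial_deriv l (partial_deriv k f) (y n) = partial_deriv k (partial_deriv l f) (z n)" for n
  proof -
    have "(h n)^2 * partial_deriv l (partial_deriv k f) (y n) = (h n)^2 * partial_deriv k (partial_deriv l f) (z n)"
      using conjunct2[OF y[rule_format, of n]] conjunct2[OF z[rule_format, of n]]
      unfolding add.assoc add.commute[of "h n *\<^sub>R axis l 1" "h n *\<^sub>R axis k 1"] by linarith
    then show ?thesis using h[of n] by simp
  qed
  ultimately show ?thesis using LIMSEQ_unique by fastforce
qed

section \<open>The second field equation away from the zeros\<close>

lemma partial_deriv_divide:
  fixes f g :: "real^2 \<Rightarrow> real"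
  assumes "f differentiable at x" "g differentiable at x" "g x \<noteq> 0"
  shows "(\<lambda>y. f y / g y) differentiable at x"
    "partial_deriv l (\<lambda>y. f y / g y) x = (partial_deriv l f x * g x - f x * partial_deriv l g x) / (g x)^2"
proof -
  have "(inverse has_real_derivative - (inverse (g x) * inverse (g x))) (at (g x))"
    using DERIV_inverse[OF assms(3)] by (simp add: power2_eq_square)
  note i = partial_deriv_compose[OF assms(2) this]
  show "(\<lambda>y. f y / g y) differentiable at x"
    unfolding divide_inverse by (intro differentiable_mult assms i)
  show "partial_deriv l (\<lambda>y. f y / g y) x = (partial_deriv l f x * g x - f x * partial_deriv l g x) / (g x)^2"
    unfolding divide_inverse partial_deriv_mult[OF assms(1) i(1)] i(2)
    using assms(3) by (simp add: field_simps power2_eq_square)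
qed

lemma smooth_Re_Im:
  assumes "smooth f"
  shows "(\<lambda>x. Re (f x)) differentiable at x" "(\<lambda>x. Im (f x)) differentiable at x"
    "partial_deriv l (\<lambda>x. Re (f x)) = (\<lambda>x. Re (partial_deriv l f x))"
    "partial_deriv l (\<lambda>x. Im (f x)) = (\<lambda>x. Im (partial_deriv l f x))"
proof -
  have d: "f differentiable at x" for x using assms smooth_on_differentiable by blast
  show "(\<lambda>x. Re (f x)) differentiable at x" "(\<lambda>x. Im (f x)) differentiable at x"
    by (rule differentiable_Re_Im[OF d])+
  show "partial_deriv l (\<lambda>x. Re (f x)) = (\<lambda>x. Re (partial_deriv l f x))"
    "partial_deriv l (\<lambda>x. Im (f x)) = (\<lambda>x. Im (partial_deriv l f x))"
    by (rule ext, rule partial_deriv_bounded_linear[OF bounded_linear_Re d],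
        rule ext, rule partial_deriv_bounded_linear[OF bounded_linear_Im d])
qed

text \<open>With phi = exp (u / 2 + i theta) the equation reads d_1 u = 2 d_2 theta - 2 B_2 and d_2
  u = 2 B_1 - 2 d_1 theta. In d_1 d_1 u + d_2 d_2 u the angle drops out because its mixed partials
  commute.\<close>

lemma laplacian_ln_cmod_sq:
  assumes phi: "smooth \<phi>" and B: "\<And>l. smooth (B l)"
    and eq: "\<And>x. partial_deriv 1 \<phi> x + \<i> * partial_deriv 2 \<phi> x = \<i> * (of_real (B 1 x) + \<i> * of_real (B 2 x)) * \<phi> x"
    and x: "\<phi> x \<noteq> 0"
  shows "laplacian (\<lambda>x. ln ((cmod (\<phi> x))^2)) x = - 2 * field_strength B x"
proof -
  define a where "a = (\<lambda>x. Re (\<phi> x))"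
  define b where "b = (\<lambda>x. Im (\<phi> x))"
  define s where "s = (\<lambda>x. (a x)^2 + (b x)^2)"
  \<comment> \<open>\<open>r l\<close> is the partial derivative of the argument of
    \<open>\<phi>\<close>, written as a quotient so that no branch has to be chosen.\<close>
  define r where "r l = (\<lambda>x. (a x * partial_deriv l b x - b x * partial_deriv l a x) / s x)" for l
  define S where "S = {x. \<phi> x \<noteq> 0}"
  have S: "open S"
    unfolding S_def by (rule open_Collect_neq) (use smooth_on_continuous[OF phi] in auto)
  have s: "s y > 0" if "y \<in> S" for y
    using that by (auto simp: S_def s_def a_def b_def complex_eq_iff sum_power2_gt_zero_iff)
  have ab: "a differentiable at y" "b differentiable at y"
     "partial_deriv l a = (\<lambda>x. Re (partial_deriv l \<phi> x))" "partial_deriv l b = (\<lambda>x. Im (partial_deriv l \<phi> x))" for l y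
    unfolding a_def b_def by (rule smooth_Re_Im[OF phi])+
  have ab1: "partial_deriv l a differentiable at y" "partial_deriv l b differentiable at y"
    "partial_deriv k (partial_deriv l a) = (\<lambda>x. Re (partial_deriv k (partial_deriv l \<phi>) x))"
    "partial_deriv k (partial_deriv l b) = (\<lambda>x. Im (partial_deriv k (partial_deriv l \<phi>) x))" for k l y
    unfolding ab by (rule smooth_Re_Im[OF smooth_on_partial[OF phi]])+
  have c: "isCont (partial_deriv k (partial_deriv l \<phi>)) y" for k l y
    using smooth_on_continuous[OF smooth_on_partial[OF smooth_on_partial[OF phi]]] continuous_on_eq_continuous_at by blast
  have sym: "partial_deriv 1 (partial_deriv 2 a) y = partial_deriv 2 (partial_deriv 1 a) y"
    "partial_deriv 1 (partial_deriv 2 b) y = partial_deriv 2 (partial_deriv 1 b) y" for y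
    by (intro mixed_partial_derivs_commute ab ab1; simp add: ab1 c continuous_intros)+
  have s1: "s differentiable at y" "partial_deriv l s y = 2 * (a y * partial_deriv l a y + b y * partial_deriv l b y)" for l y
    unfolding s_def power2_eq_square
    by (simp_all add: partial_deriv_add partial_deriv_mult ab(1,2) differentiable_mult algebra_simps)
  have u1: "partial_deriv l (\<lambda>x. ln ((cmod (\<phi> x))^2)) y = 2 * (a y * partial_deriv l a y + b y * partial_deriv l b y) / s y"
    if "y \<in> S" for l y
  proof -
    have "(ln has_real_derivative (1 / s y)) (at (s y))"
      using s[OF that] by (auto intro!: derivative_eq_intros)
    from partial_deriv_compose(2)[OF s1(1) this, of l]
    have "partial_deriv l (\<lambda>x. ln (s x)) y = 2 * (a y * partial_deriv l a y + b y * partial_deriv l b y) / s y"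
      unfolding s1(2) by simp
    moreover have "(\<lambda>x. ln ((cmod (\<phi> x))^2)) = (\<lambda>x. ln (s x))"
      by (simp only: cmod_power2 s_def a_def b_def)
    ultimately show ?thesis by (simp only:)
  qed
  have e1: "partial_deriv 1 a y - partial_deriv 2 b y = - B 2 y * a y - B 1 y * b y"
    and e2: "partial_deriv 1 b y + partial_deriv 2 a y = B 1 y * a y - B 2 y * b y" for y
    using eq[of y] unfolding ab by (auto simp: complex_eq_iff a_def b_def algebra_simps)
  have p1: "partial_deriv 1 (\<lambda>x. ln ((cmod (\<phi> x))^2)) y = 2 * r 2 y - 2 * B 2 y" if "y \<in> S" for y
  proof -
    have *: "partial_deriv 1 a y = partial_deriv 2 b y - B 2 y * a y - B 1 y * b y"
      "partial_deriv 1 b y = B 1 y * a y - B 2 y * b y - partial_deriv 2 a y"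
      using e1[of y] e2[of y] by linarith+
    have "a y * partial_deriv 1 a y + b y * partial_deriv 1 b y
      = (a y * partial_deriv 2 b y - b y * partial_deriv 2 a y) - B 2 y * s y"
      unfolding * s_def by (simp add: algebra_simps power2_eq_square)
    then show ?thesis unfolding u1[OF that] r_def using s[OF that] by (simp add: field_simps)
  qed
  have p2: "partial_deriv 2 (\<lambda>x. ln ((cmod (\<phi> x))^2)) y = 2 * B 1 y - 2 * r 1 y" if "y \<in> S" for y
  proof -
    have *: "partial_deriv 2 b y = partial_deriv 1 a y + B 2 y * a y + B 1 y * b y"
      "partial_deriv 2 a y = B 1 y * a y - B 2 y * b y - partial_deriv 1 b y"
      using e1[of y] e2[of y] by linarith+
    have "a y * partial_deriv 2 a y + b y * partial_deriv 2 b y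
      = B 1 y * s y - (a y * partial_deriv 1 b y - b y * partial_deriv 1 a y)"
      unfolding * s_def by (simp add: algebra_simps power2_eq_square)
    then show ?thesis unfolding u1[OF that] r_def using s[OF that] by (simp add: field_simps)
  qed
  have xS: "x \<in> S" using x by (simp add: S_def)
  let ?n = "\<lambda>l x. a x * partial_deriv l b x - b x * partial_deriv l a x"
  have n: "?n l differentiable at x" "partial_deriv k (?n l) x = partial_deriv k a x * partial_deriv l b x
      + a x * partial_deriv k (partial_deriv l b) x - partial_deriv k b x * partial_deriv l a x
      - b x * partial_deriv k (partial_deriv l a) x" for k l
    by (simp_all add: partial_deriv_diff partial_deriv_mult ab(1,2) ab1(1,2) differentiable_mult)
  have r: "r l differentiable at x"
    "partial_deriv k (r l) x = (partial_deriv k (?n l) x * s x - ?n l x * partial_deriv k s x) / (s x)^2" for k l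
    unfolding r_def using partial_deriv_divide[OF n(1) s1(1)] s[OF xS] by auto
  \<comment> \<open>The gradient of the argument is curl free: by \<open>sym\<close> the second
    derivatives agree on both sides, and the products of first derivatives agree after
    expansion.\<close>
  have closed: "partial_deriv 1 (r 2) x = partial_deriv 2 (r 1) x"
  proof -
    have "partial_deriv 1 (?n 2) x * s x - ?n 2 x * partial_deriv 1 s x
       = partial_deriv 2 (?n 1) x * s x - ?n 1 x * partial_deriv 2 s x"
      unfolding n s1 sym unfolding s_def by (simp only: power2_eq_square algebra_simps)
    then show ?thesis unfolding r by simp
  qed
  have Bd: "B l differentiable at x" for l using B smooth_on_differentiable by blast
  have pm: "partial_deriv k (\<lambda>x. 2 * f x) x = 2 * partial_deriv k f x" if "f differentiable at x" for k and f :: "real^2 \<Rightarrow> real"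
    using partial_deriv_mult[of "\<lambda>_. 2" x f k] that by simp
  have "partial_deriv 1 (partial_deriv 1 (\<lambda>x. ln ((cmod (\<phi> x))^2))) x = 2 * partial_deriv 1 (r 2) x - 2 * partial_deriv 1 (B 2) x"
    by (subst partial_deriv_cong_open[OF S xS p1])
      (simp_all add: partial_deriv_diff pm r(1) Bd differentiable_scaled)
  moreover have "partial_deriv 2 (partial_deriv 2 (\<lambda>x. ln ((cmod (\<phi> x))^2))) x = 2 * partial_deriv 2 (B 1) x - 2 * partial_deriv 2 (r 1) x"
    by (subst partial_deriv_cong_open[OF S xS p2])
      (simp_all add: partial_deriv_diff pm r(1) Bd differentiable_scaled)
  ultimately show ?thesis
    by (simp add: laplacian_def sum_2 field_strength_def closed)
qed

text \<open>The first partial vanishes at the maximum. If the second were positive, the first would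
  be positive just beyond \<open>x\<close> along the axis, and the mean value theorem would give a
  larger value of \<open>f\<close> there.\<close>

lemma partial_deriv2_nonpos_at_local_max:
  assumes C: "C2_on S f" and S: "open S" "x \<in> S" and max: "\<And>y. y \<in> S \<Longrightarrow> f y \<le> f x"
  shows "partial_deriv l (partial_deriv l f) x \<le> 0"
proof (rule ccontr)
  assume "\<not> ?thesis"
  then have pos: "partial_deriv l (partial_deriv l f) x > 0" by simp
  obtain e where e: "e > 0" "ball x e \<subseteq> S" using S openE by blast
  have inS: "x + t *\<^sub>R axis l 1 \<in> S" if "\<bar>t\<bar> < e" for t
    using that e(2) by (auto simp: dist_norm subset_iff)
  have d1: "((\<lambda>t. f (x + t *\<^sub>R axis l 1)) has_real_derivative partial_deriv l f (x + t *\<^sub>R axis l 1)) (at t)"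
    if "\<bar>t\<bar> < e" for t
    by (rule partial_deriv_along_line_real[OF C2_onD(1)[OF C inS[OF that]]])
  have d2: "((\<lambda>t. partial_deriv l f (x + t *\<^sub>R axis l 1)) has_real_derivative partial_deriv l (partial_deriv l f) (x + 0 *\<^sub>R axis l 1)) (at 0)"
    by (rule partial_deriv_along_line_real[OF C2_onD(2)[OF C inS]]) (use e in simp)
  have z: "partial_deriv l f x = 0"
    using DERIV_local_max[OF d1[of 0] e(1)] max inS e(1) by simp
  obtain d where d: "d > 0" "\<And>h. 0 < h \<Longrightarrow> h < d \<Longrightarrow> partial_deriv l f (x + h *\<^sub>R axis l 1) > 0"
    using DERIV_pos_inc_right[OF d2] pos z by auto
  define h where "h = min d e / 2"
  have h: "0 < h" "h < d" "h < e" using d e by (auto simp: h_def)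
  obtain t where t: "0 < t" "t < h" "f (x + h *\<^sub>R axis l 1) - f (x + 0 *\<^sub>R axis l 1) = (h - 0) * partial_deriv l f (x + t *\<^sub>R axis l 1)"
    using MVT2[OF h(1), of "\<lambda>t. f (x + t *\<^sub>R axis l 1)" "\<lambda>t. partial_deriv l f (x + t *\<^sub>R axis l 1)"] d1 h by auto
  have "f (x + h *\<^sub>R axis l 1) > f x"
    using t(3) mult_pos_pos[OF h(1) d(2)[of t]] t(1,2) h(2) by simp
  then show False using max[OF inS[of h]] h by simp
qed

lemma laplacian_nonpos_at_local_max:
  assumes "C2_on S f" "open S" "x \<in> S" "\<And>y. y \<in> S \<Longrightarrow> f y \<le> f x"
  shows "laplacian f x \<le> 0"
  unfolding laplacian_def by (intro sum_nonpos partial_deriv2_nonpos_at_local_max[OF assms])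

subsection \<open>Integrals of derivatives over the plane\<close>

lemma
  fixes f :: "real^2 \<Rightarrow> real"
  assumes [measurable]: "f \<in> borel_measurable borel"
  shows lborel_integral_shift: "(LINT x|lborel. f (x + c)) = (LINT x|lborel. f x)"
    and lborel_integrable_shift: "integrable lborel (\<lambda>x. f (x + c)) \<longleftrightarrow> integrable lborel f"
proof -
  have "(LINT x|lborel. f x) = (LINT x|distr lborel borel ((+) c). f x)"
    by (simp only: lborel_distr_plus)
  also have "\<dots> = (LINT x|lborel. f (c + x))" by (rule integral_distr) auto
  finally show "(LINT x|lborel. f (x + c)) = (LINT x|lborel. f x)" by (simp add: add.commute)
  have "integrable lborel f \<longleftrightarrow> integrable (distr lborel borel ((+) c)) f"
    by (simp only: lborel_distr_plus)
  also have "\<dots> \<longleftrightarrow> integrable lborel (\<lambda>x. f (c + x))" by (rule integrable_distr_eq) auto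
  finally show "integrable lborel (\<lambda>x. f (x + c)) \<longleftrightarrow> integrable lborel f" by (simp add: add.commute)
qed

lemma continuous_bounded_support_bounded:
  fixes f :: "real^2 \<Rightarrow> real"
  assumes "continuous_on UNIV f" "\<And>x. norm x \<ge> R \<Longrightarrow> f x = 0"
  obtains C where "C \<ge> 0" "\<And>x. \<bar>f x\<bar> \<le> C"
proof -
  have "compact (f ` cball 0 R)"
    by (intro compact_continuous_image continuous_on_subset[OF assms(1)]) auto
  then obtain C where C: "\<And>x. x \<in> cball 0 R \<Longrightarrow> \<bar>f x\<bar> \<le> C"
    using compact_imp_bounded bounded_iff by (metis imageI real_norm_def)
  show thesis
  proof (rule that[of "\<bar>C\<bar>"])
    show "\<bar>f x\<bar> \<le> \<bar>C\<bar>" for x using C[of x] assms(2)[of x] by (cases "norm x \<le> R") auto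
  qed simp
qed

lemma integrable_continuous_bounded_support:
  fixes f :: "real^2 \<Rightarrow> real"
  assumes "continuous_on UNIV f" "\<And>x. norm x \<ge> R \<Longrightarrow> f x = 0"
  shows "integrable lborel f"
proof -
  have "integrable lborel (\<lambda>x. indicator (cball 0 R) x *\<^sub>R f x)"
    by (intro borel_integrable_compact continuous_on_subset[OF assms(1)]) auto
  moreover have "(\<lambda>x. indicator (cball 0 R) x *\<^sub>R f x) = f"
    using assms(2) by (auto simp: indicator_def fun_eq_iff)
  ultimately show ?thesis by simp
qed

lemma set_integrable_bounded_continuous:
  fixes f :: "real^2 \<Rightarrow> real"
  assumes "A \<in> sets lborel" "emeasure lborel A < \<infinity>" "continuous_on UNIV f" "\<And>x. \<bar>f x\<bar> \<le> C"
  shows "set_integrable lborel A f"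
  unfolding set_integrable_def
proof (rule Bochner_Integration.integrable_bound)
  show "integrable lborel (\<lambda>x. C * indicator A x)"
    using assms(1,2) by (intro integrable_mult_right integrable_real_indicator)
  show "(\<lambda>x. indicator A x *\<^sub>R f x) \<in> borel_measurable lborel"
    using assms(1) borel_measurable_continuous_onI[OF assms(3)] by measurable
  show "AE x in lborel. norm (indicator A x *\<^sub>R f x) \<le> norm (C * indicator A x)"
    using order_trans[OF assms(4) abs_ge_self] by (auto simp: indicator_def)
qed

text \<open>Differentiating the hypothesis at \<open>t = 0\<close> under the integral sign.\<close>
lemma integral_partial_deriv_translation_invariant:
  fixes F :: "real^2 \<Rightarrow> real"
  assumes A: "A \<in> sets lborel" "emeasure lborel A < \<infinity>"
    and F: "\<And>x. F differentiable at x" "continuous_on UNIV (partial_deriv l F)"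
    and bd: "\<And>x. \<bar>F x\<bar> \<le> C" "\<And>x. \<bar>partial_deriv l F x\<bar> \<le> C"
    and inv: "\<And>t. 0 < t \<Longrightarrow> t \<le> 1 \<Longrightarrow> (LINT x:A|lborel. F (x + t *\<^sub>R axis l 1)) = (LINT x:A|lborel. F x)"
  shows "(LINT x:A|lborel. partial_deriv l F x) = 0"
proof -
  define h :: "nat \<Rightarrow> real" where "h n = inverse (Suc n)" for n
  have h: "0 < h n" "h n \<le> 1" for n by (auto simp: h_def inverse_le_1_iff)
  have cF: "continuous_on UNIV F"
    using F(1) by (simp add: continuous_at_imp_continuous_on differentiable_imp_continuous_within)
  have cFt: "continuous_on UNIV (\<lambda>x. F (x + t *\<^sub>R axis l 1))" for t
    by (rule continuous_on_compose2[OF cF]) (auto intro!: continuous_intros)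
  define s where "s n x = indicator A x *\<^sub>R ((F (x + h n *\<^sub>R axis l 1) - F x) / h n)" for n x
  have D: "((\<lambda>t. F (x + t *\<^sub>R axis l 1)) has_real_derivative partial_deriv l F (x + t *\<^sub>R axis l 1)) (at t)" for x t
    by (rule partial_deriv_along_line_real[OF F(1)])
  have int_s: "integral\<^sup>L lborel (s n) = 0" for n
  proof -
    have "set_integrable lborel A (\<lambda>x. F (x + h n *\<^sub>R axis l 1))" "set_integrable lborel A F"
      by (rule set_integrable_bounded_continuous[OF A cFt bd(1)], rule set_integrable_bounded_continuous[OF A cF bd(1)])
    then have "(LINT x:A|lborel. F (x + h n *\<^sub>R axis l 1) - F x) = 0"
      using inv[OF h] by (simp add: set_integral_diff)
    then have "(LINT x:A|lborel. (F (x + h n *\<^sub>R axis l 1) - F x) / h n) = 0" by simp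
    then show ?thesis by (simp add: s_def[abs_def] set_lebesgue_integral_def)
  qed
  have "(\<lambda>n. integral\<^sup>L lborel (s n)) \<longlonglongrightarrow> integral\<^sup>L lborel (\<lambda>x. indicator A x *\<^sub>R partial_deriv l F x)"
  proof (rule integral_dominated_convergence)
    show "(\<lambda>x. indicator A x *\<^sub>R partial_deriv l F x) \<in> borel_measurable lborel"
      using A(1) borel_measurable_continuous_onI[OF F(2)] by measurable
    show "s n \<in> borel_measurable lborel" for n
      unfolding s_def using A(1) borel_measurable_continuous_onI[OF cF] borel_measurable_continuous_onI[OF cFt[of "h n"]]
      by measurable
    show "integrable lborel (\<lambda>x. C * indicator A x)"
      using A by (intro integrable_mult_right integrable_real_indicator)
    have "h \<longlonglongrightarrow> 0" using LIMSEQ_inverse_real_of_nat by (simp add: h_def[abs_def])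
    then have fl: "filterlim h (at 0) sequentially"
      unfolding filterlim_at using h(1) by (auto simp: less_imp_neq[THEN not_sym] intro!: always_eventually)
    have "(\<lambda>n. (F (x + h n *\<^sub>R axis l 1) - F x) / h n) \<longlonglongrightarrow> partial_deriv l F x" for x
    proof -
      have "((\<lambda>t. (F (x + t *\<^sub>R axis l 1) - F x) / t) \<longlongrightarrow> partial_deriv l F x) (at 0)"
        using D[of x 0] by (simp add: DERIV_def)
      from filterlim_compose[OF this fl] show ?thesis .
    qed
    then show "AE x in lborel. (\<lambda>n. s n x) \<longlonglongrightarrow> indicator A x *\<^sub>R partial_deriv l F x"
      unfolding s_def by (intro AE_I2 tendsto_scaleR tendsto_const)
    \<comment> \<open>By the mean value theorem every difference quotient is a value of the
      derivative, so the bound on the latter dominates the whole sequence.\<close>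
    have "\<bar>(F (x + h n *\<^sub>R axis l 1) - F x) / h n\<bar> \<le> C" for x n
    proof -
      obtain z where "F (x + h n *\<^sub>R axis l 1) - F (x + 0 *\<^sub>R axis l 1) = (h n - 0) * partial_deriv l F (x + z *\<^sub>R axis l 1)"
        using MVT2[OF h(1), OF D] by blast
      then have "(F (x + h n *\<^sub>R axis l 1) - F x) / h n = partial_deriv l F (x + z *\<^sub>R axis l 1)"
        using h(1)[of n] by (simp add: field_simps)
      then show ?thesis using bd(2) by simp
    qed
    then show "AE x in lborel. norm (s n x) \<le> C * indicator A x" for n
      by (intro AE_I2) (simp add: s_def indicator_def)
  qed
  then show ?thesis
    unfolding int_s set_lebesgue_integral_def using LIMSEQ_unique tendsto_const by blast
qed

lemma norm_add_ge: "norm x - norm y \<le> norm (x + y)" for x y :: "'a::real_normed_vector"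
  using norm_triangle_ineq4[of "x + y" y] by simp

text \<open>The strict inequality makes the region open. The uses below therefore enlarge the radius
  by 1 with each derivative.\<close>

lemma partial_deriv_zero_outside:
  assumes "\<And>x. norm x \<ge> R \<Longrightarrow> f x = 0" "norm x > R"
  shows "partial_deriv l f x = 0"
proof -
  have "partial_deriv l f x = partial_deriv l (\<lambda>_. 0) x"
  proof (rule partial_deriv_cong_open)
    show "open {x :: real^2. norm x > R}" by (intro open_Collect_less continuous_intros)
  qed (use assms in auto)
  then show ?thesis by simp
qed

lemma integral_partial_deriv_bounded_support:
  fixes F :: "real^2 \<Rightarrow> real"
  assumes F: "\<And>x. F differentiable at x" "continuous_on UNIV (partial_deriv l F)"
    and R: "\<And>x. norm x \<ge> R \<Longrightarrow> F x = 0"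
  shows "(LINT x|lborel. partial_deriv l F x) = 0"
proof -
  have cF: "continuous_on UNIV F"
    using F(1) by (simp add: continuous_at_imp_continuous_on differentiable_imp_continuous_within)
  have zd: "partial_deriv l F x = 0" if "norm x \<ge> R + 1" for x
    using that by (intro partial_deriv_zero_outside[OF R]) auto
  obtain C1 where C1: "C1 \<ge> 0" "\<And>x. \<bar>F x\<bar> \<le> C1"
    using continuous_bounded_support_bounded[OF cF R] by blast
  obtain C2 where C2: "C2 \<ge> 0" "\<And>x. \<bar>partial_deriv l F x\<bar> \<le> C2"
    using continuous_bounded_support_bounded[OF F(2) zd] by blast
  \<comment> \<open>The extra 1 leaves room for translations by \<open>t \<le> 1\<close>: off this
    ball both \<open>F\<close> and its translates vanish, so integrals over it are integrals over
    the plane.\<close>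
  let ?A = "cball (0::real^2) (R + 1)"
  have "(LINT x:?A|lborel. partial_deriv l F x) = 0"
  proof (rule integral_partial_deriv_translation_invariant[where C = "C1 + C2"])
    fix t :: real assume t: "0 < t" "t \<le> 1"
    have 1: "F (x + t *\<^sub>R axis l 1) = 0" if "x \<notin> ?A" for x
      using norm_add_ge[of x "t *\<^sub>R axis l 1"] that t by (intro R) auto
    have 2: "F x = 0" if "x \<notin> ?A" for x using that by (intro R) auto
    have "(LINT x:?A|lborel. F (x + t *\<^sub>R axis l 1)) = (LINT x|lborel. F (x + t *\<^sub>R axis l 1))"
      unfolding set_lebesgue_integral_def by (rule Bochner_Integration.integral_cong) (auto simp: indicator_def 1)
    also have "\<dots> = (LINT x|lborel. F x)"
      by (rule lborel_integral_shift) (use borel_measurable_continuous_onI[OF cF] in simp)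
    also have "\<dots> = (LINT x:?A|lborel. F x)"
      unfolding set_lebesgue_integral_def by (rule Bochner_Integration.integral_cong) (auto simp: indicator_def 2)
    finally show "(LINT x:?A|lborel. F (x + t *\<^sub>R axis l 1)) = (LINT x:?A|lborel. F x)" .
  next
    show "\<bar>F x\<bar> \<le> C1 + C2" "\<bar>partial_deriv l F x\<bar> \<le> C1 + C2" for x
      using C1(1) C2(1) C1(2)[of x] C2(2)[of x] by linarith+
    show "emeasure lborel ?A < \<infinity>" by (rule emeasure_lborel_cball_finite)
  qed (use F in auto)
  moreover have "(LINT x:?A|lborel. partial_deriv l F x) = (LINT x|lborel. partial_deriv l F x)"
    unfolding set_lebesgue_integral_def by (rule Bochner_Integration.integral_cong) (auto simp: indicator_def zd)
  ultimately show ?thesis by simp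
qed

text \<open>Integrates the divergence of \<open>\<eta>\<close> grad \<open>h\<close> -
  \<open>h\<close> grad \<open>\<eta>\<close>, in which the products of first derivatives cancel.
  This field has bounded support because \<open>\<eta>\<close> does, whatever \<open>h\<close> is at
  infinity.\<close>

lemma Green_second_identity:
  assumes h: "C2_on UNIV h" and \<eta>: "C2_on UNIV \<eta>" and R: "\<And>x. norm x \<ge> R \<Longrightarrow> \<eta> x = 0"
  shows "(LINT x|lborel. \<eta> x * laplacian h x) = (LINT x|lborel. h x * laplacian \<eta> x)"
proof -
  define F where "F l x = \<eta> x * partial_deriv l h x - h x * partial_deriv l \<eta> x" for l x
  have d: "h differentiable at x" "\<eta> differentiable at x" "partial_deriv l h differentiable at x"
    "partial_deriv l \<eta> differentiable at x" for l x
    using C2_onD h \<eta> by blast+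
  note c = C2_on_continuous[OF h] C2_on_continuous[OF \<eta>]
  have F1: "F l differentiable at x" for l x
    unfolding F_def by (intro differentiable_diff differentiable_mult d)
  have F2: "partial_deriv l (F l) x = \<eta> x * partial_deriv l (partial_deriv l h) x - h x * partial_deriv l (partial_deriv l \<eta>) x" for l x
    unfolding F_def by (subst partial_deriv_diff) (auto simp: partial_deriv_mult d intro!: differentiable_mult)
  have R1: "partial_deriv l \<eta> x = 0" if "norm x \<ge> R + 1" for l x
    using that by (intro partial_deriv_zero_outside[OF R]) auto
  have R2: "partial_deriv l (partial_deriv l \<eta>) x = 0" if "norm x \<ge> R + 2" for l x
    using that by (intro partial_deriv_zero_outside[OF R1]) auto
  have F3: "continuous_on UNIV (partial_deriv l (F l))" for l
    unfolding F2[abs_def] by (intro continuous_intros c)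
  have "(LINT x|lborel. partial_deriv l (F l) x) = 0" for l
    by (rule integral_partial_deriv_bounded_support[OF F1 F3, of "R + 1"]) (use R R1 in \<open>auto simp: F_def\<close>)
  moreover have "integrable lborel (partial_deriv l (F l))" for l
    by (rule integrable_continuous_bounded_support[OF F3, of "R + 2"]) (use R R2 in \<open>auto simp: F2\<close>)
  ultimately have "(LINT x|lborel. (\<Sum>l\<in>UNIV. partial_deriv l (F l) x)) = 0"
    by (simp add: Bochner_Integration.integral_sum)
  moreover have "(\<Sum>l\<in>UNIV. partial_deriv l (F l) x) = \<eta> x * laplacian h x - h x * laplacian \<eta> x" for x
    by (simp add: F2 laplacian_def sum_subtractf sum_distrib_left)
  moreover have "integrable lborel (\<lambda>x. \<eta> x * laplacian h x)"
    by (rule integrable_continuous_bounded_support[of _ R]) (auto intro!: continuous_intros c simp: R)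
  moreover have "integrable lborel (\<lambda>x. h x * laplacian \<eta> x)"
    by (rule integrable_continuous_bounded_support[of _ "R + 2"]) (auto intro!: continuous_intros c simp: R2 laplacian_def)
  ultimately show ?thesis by (simp add: Bochner_Integration.integral_diff)
qed

subsection \<open>Radial functions\<close>

text \<open>At the seam both pieces have the same value and the same derivative, so the one-sided
  difference quotients of the glued function have a common limit.\<close>

lemma has_real_derivative_glue:
  fixes a b :: "real \<Rightarrow> real"
  assumes "t \<le> c \<Longrightarrow> (a has_real_derivative d) (at t)" "t \<ge> c \<Longrightarrow> (b has_real_derivative d) (at t)"
    and "a c = b c"
  shows "((\<lambda>t. if t < c then a t else b t) has_real_derivative d) (at t)"
proof -
  consider "t < c" | "t = c" | "t > c" by linarith
  then show ?thesis
  proof cases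
    case 1
    show ?thesis
      by (rule has_field_derivative_transform_within_open[OF assms(1), of "{..<c}"]) (use 1 in auto)
  next
    case 3
    show ?thesis
      by (rule has_field_derivative_transform_within_open[OF assms(2), of "{c<..}"]) (use 3 in auto)
  next
    case 2
    let ?f = "\<lambda>t. if t < c then a t else b t"
    have A: "((\<lambda>y. (a y - a t) / (y - t)) \<longlongrightarrow> d) (at_left t)"
      and B: "((\<lambda>y. (b y - b t) / (y - t)) \<longlongrightarrow> d) (at_right t)"
      using assms(1,2) 2 by (auto simp: has_field_derivative_iff intro: filterlim_mono[OF _ order_refl at_le])
    have "((\<lambda>y. (?f y - ?f t) / (y - t)) \<longlongrightarrow> d) (at_left t)"
      by (rule Lim_transform_eventually[OF A]) (use 2 assms(3) in \<open>auto simp: eventually_at_filter\<close>)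
    moreover have "((\<lambda>y. (?f y - ?f t) / (y - t)) \<longlongrightarrow> d) (at_right t)"
      by (rule Lim_transform_eventually[OF B]) (use 2 assms(3) in \<open>auto simp: eventually_at_filter\<close>)
    ultimately show ?thesis
      unfolding has_field_derivative_iff by (rule filterlim_split_at)
  qed
qed

lemma DERIV_max_0_power:
  "((\<lambda>y::real. max 0 y ^ Suc (Suc n)) has_real_derivative real (Suc (Suc n)) * max 0 y ^ Suc n) (at y)"
proof -
  have "((\<lambda>y::real. if y < 0 then 0 else y ^ Suc (Suc n)) has_real_derivative real (Suc (Suc n)) * max 0 y ^ Suc n) (at y)"
    by (rule has_real_derivative_glue) (auto intro!: derivative_eq_intros simp del: power_Suc simp: max_def)
  moreover have "(\<lambda>y::real. if y < 0 then 0 else y ^ Suc (Suc n)) = (\<lambda>y. max 0 y ^ Suc (Suc n))"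
    by (auto simp: max_def fun_eq_iff)
  ultimately show ?thesis by (simp only:)
qed

text \<open>The cube makes the positive part twice continuously differentiable, and dependence on
  |x|^2 / R^2 alone makes the Laplacian of order R^-2.\<close>

definition cutoff :: "real \<Rightarrow> real^2 \<Rightarrow> real"
  where "cutoff R x = max 0 (1 - (x \<bullet> x) / R^2) ^ 3"

lemma
  assumes R: "R > 0"
  shows C2_on_cutoff: "C2_on UNIV (cutoff R)"
    and laplacian_cutoff_le: "\<bar>laplacian (cutoff R) x\<bar> \<le> 24 / R^2"
    and cutoff_eq_0: "norm x \<ge> R \<Longrightarrow> cutoff R x = 0"
    and cutoff_bounds: "0 \<le> cutoff R x" "cutoff R x \<le> 1"
proof -
  define \<rho> where "\<rho> t = max 0 (1 - t / R^2) ^ 3" for t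
  define \<rho>' where "\<rho>' t = - (3 / R^2) * max 0 (1 - t / R^2) ^ 2" for t
  define \<rho>'' where "\<rho>'' t = 6 / (R^2 * R^2) * max 0 (1 - t / R^2)" for t
  have i: "((\<lambda>t. 1 - t / R^2) has_real_derivative - (1 / R^2)) (at t)" for t
    using DERIV_diff[OF DERIV_const DERIV_cdivide[OF DERIV_ident]] by simp
  have D1: "(\<rho> has_real_derivative \<rho>' t) (at t)" for t
    using DERIV_chain2[OF DERIV_max_0_power[of 1] i[of t]] unfolding \<rho>_def \<rho>'_def
    by (simp add: numeral_3_eq_3 numeral_2_eq_2)
  have D2: "(\<rho>' has_real_derivative \<rho>'' t) (at t)" for t
    using DERIV_cmult[OF DERIV_chain2[OF DERIV_max_0_power[of 0] i[of t]], of "-(3/R^2)"]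
    unfolding \<rho>'_def \<rho>''_def using R by (simp add: numeral_2_eq_2)
  have c: "continuous_on X \<rho>''" for X
    unfolding \<rho>''_def by (intro continuous_intros) (use R in auto)
  have eq: "cutoff R = (\<lambda>x. \<rho> (x \<bullet> x))" by (auto simp: cutoff_def \<rho>_def)
  show "C2_on UNIV (cutoff R)" unfolding eq by (rule C2_on_radial[OF open_UNIV D1 D2 c])
  have L: "laplacian (cutoff R) x = 4 * ((x \<bullet> x) * \<rho>'' (x \<bullet> x) + \<rho>' (x \<bullet> x))"
    unfolding eq by (rule laplacian_radial[OF open_UNIV D1 D2 c UNIV_I])
  \<comment> \<open>With t = |x|^2 / R^2 the Laplacian is (24 t T - 12 T^2) / R^2. Both t T and T^2
    lie in [0, 1], whence the constant 24; t itself is unbounded, but T = 0 for t > 1.\<close>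
  define T where "T = max 0 (1 - (x \<bullet> x) / R^2)"
  have T: "0 \<le> T" "T \<le> 1" using R by (auto simp: T_def)
  have t: "0 \<le> (x \<bullet> x) / R^2 * T" "(x \<bullet> x) / R^2 * T \<le> 1"
  proof -
    show "0 \<le> (x \<bullet> x) / R^2 * T" using T by simp
    show "(x \<bullet> x) / R^2 * T \<le> 1"
    proof (cases "(x \<bullet> x) / R^2 \<le> 1")
      case True then show ?thesis using T by (intro mult_le_one) auto
    next
      case False then show ?thesis by (simp add: T_def)
    qed
  qed
  have "laplacian (cutoff R) x = (24 * ((x \<bullet> x) / R^2 * T) - 12 * T^2) / R^2"
    unfolding L \<rho>''_def \<rho>'_def T_def[symmetric] by (simp add: diff_divide_distrib algebra_simps)
  moreover have "T^2 \<le> 1" "0 \<le> T^2" using T by (simp_all add: power_le_one)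
  then have "\<bar>24 * ((x \<bullet> x) / R^2 * T) - 12 * T^2\<bar> \<le> 24" using t by linarith
  ultimately show "\<bar>laplacian (cutoff R) x\<bar> \<le> 24 / R^2"
    by (simp add: divide_right_mono)
  show "0 \<le> cutoff R x" "cutoff R x \<le> 1"
    using T by (simp_all add: cutoff_def T_def[symmetric] power_le_one)
  show "cutoff R x = 0" if "norm x \<ge> R"
  proof -
    have "R^2 \<le> x \<bullet> x" using power_mono[OF that, of 2] R by (simp add: power2_norm_eq_inner)
    then have "(x \<bullet> x) / R^2 \<ge> 1" using R by simp
    then show ?thesis by (simp add: cutoff_def max_def)
  qed
qed

lemma emeasure_disc: "emeasure lborel {x::real^2. x \<bullet> x \<le> \<tau>} = ennreal (pi * max 0 \<tau>)"
proof (cases "\<tau> \<ge> 0")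
  case True
  have "{x::real^2. x \<bullet> x \<le> \<tau>} = cball 0 (sqrt \<tau>)"
    using True by (auto simp: norm_eq_sqrt_inner)
  then show ?thesis using True by (simp add: emeasure_cball eval_unit_ball_vol)
next
  case False
  have "\<not> x \<bullet> x \<le> \<tau>" for x :: "real^2" using False inner_ge_zero[of x] by linarith
  then have "{x::real^2. x \<bullet> x \<le> \<tau>} = {}" by auto
  then show ?thesis using False by simp
qed

text \<open>Layer-cake replacement for polar coordinates: a radial function that is the tail
  integral of \<open>\<kappa>\<close> is integrated by exchanging the integrals, after which only
  the area of a disc of squared radius \<open>\<tau>\<close> is needed.\<close>

lemma nn_integral_radial_layers:
  assumes [measurable]: "\<kappa> \<in> borel_measurable borel"
  shows "(\<integral>\<^sup>+x. (\<integral>\<^sup>+\<tau>. \<kappa> \<tau> * indicator {x \<bullet> (x::real^2)..} \<tau> \<partial>lborel) \<partial>lborel)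
    = (\<integral>\<^sup>+\<tau>. \<kappa> \<tau> * ennreal (pi * max 0 \<tau>) \<partial>lborel)"
proof -
  have "(\<integral>\<^sup>+x. (\<integral>\<^sup>+\<tau>. \<kappa> \<tau> * indicator {x \<bullet> (x::real^2)..} \<tau> \<partial>lborel) \<partial>lborel)
    = (\<integral>\<^sup>+\<tau>. (\<integral>\<^sup>+x. \<kappa> \<tau> * indicator {x \<bullet> (x::real^2)..} \<tau> \<partial>lborel) \<partial>lborel)"
    by (rule lborel_pair.Fubini'[symmetric]) (simp add: indicator_def)
  also have "\<dots> = (\<integral>\<^sup>+\<tau>. \<kappa> \<tau> * ennreal (pi * max 0 \<tau>) \<partial>lborel)"
  proof (rule nn_integral_cong)
    fix \<tau>
    have "(\<integral>\<^sup>+x. \<kappa> \<tau> * indicator {x \<bullet> (x::real^2)..} \<tau> \<partial>lborel)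
      = (\<integral>\<^sup>+x. \<kappa> \<tau> * indicator {x. x \<bullet> (x::real^2) \<le> \<tau>} x \<partial>lborel)"
      by (intro nn_integral_cong) (simp add: indicator_def)
    also have "\<dots> = \<kappa> \<tau> * emeasure lborel {x::real^2. x \<bullet> x \<le> \<tau>}"
      by (rule nn_integral_cmult_indicator) simp
    finally show "(\<integral>\<^sup>+x. \<kappa> \<tau> * indicator {x \<bullet> (x::real^2)..} \<tau> \<partial>lborel) = \<kappa> \<tau> * ennreal (pi * max 0 \<tau>)"
      by (simp only: emeasure_disc)
  qed
  finally show ?thesis .
qed

lemma has_bochner_integral_quadratic_bump:
  "has_bochner_integral lborel (\<lambda>x::real^2. 12 * max 0 (1 - x \<bullet> x) ^ 2) (4 * pi)"
proof (rule has_bochner_integral_nn_integral)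
  \<comment> \<open>Minus the derivative of 12 (1 - s)^2 on s < 1. The mass is then pi times the
    integral of 24 (1 - \<tau>) \<tau> over [0, 1], which is 4 pi.\<close>
  define \<kappa> :: "real \<Rightarrow> ennreal" where "\<kappa> \<tau> = ennreal (24 * (1 - \<tau>)) * indicator {..1} \<tau>" for \<tau>
  have [measurable]: "\<kappa> \<in> borel_measurable borel" unfolding \<kappa>_def by measurable
  have 1: "(\<integral>\<^sup>+\<tau>. \<kappa> \<tau> * indicator {s..} \<tau> \<partial>lborel) = ennreal (12 * max 0 (1 - s) ^ 2)" for s
  proof (cases "s \<le> 1")
    case True
    have "(\<integral>\<^sup>+\<tau>. \<kappa> \<tau> * indicator {s..} \<tau> \<partial>lborel) = (\<integral>\<^sup>+\<tau>. ennreal (24 * (1 - \<tau>)) * indicator {s..1} \<tau> \<partial>lborel)"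
      by (intro nn_integral_cong) (auto simp: \<kappa>_def indicator_def)
    also have "\<dots> = ennreal ((\<lambda>\<tau>. - 12 * (1 - \<tau>)^2) 1 - (\<lambda>\<tau>. - 12 * (1 - \<tau>)^2) s)"
      by (rule nn_integral_FTC_Icc[OF _ _ _ True]) (auto intro!: derivative_eq_intros)
    finally show ?thesis using True by (simp add: max_def)
  next
    case False
    then have "(\<integral>\<^sup>+\<tau>. \<kappa> \<tau> * indicator {s..} \<tau> \<partial>lborel) = (integral\<^sup>N lborel (\<lambda>\<tau>::real. 0))"
      by (intro nn_integral_cong) (auto simp: \<kappa>_def indicator_def)
    then show ?thesis using False by (simp add: max_def)
  qed
  have "(\<integral>\<^sup>+x. ennreal (12 * max 0 (1 - x \<bullet> (x::real^2)) ^ 2) \<partial>lborel)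
     = (\<integral>\<^sup>+\<tau>. \<kappa> \<tau> * ennreal (pi * max 0 \<tau>) \<partial>lborel)"
    unfolding 1[symmetric] by (rule nn_integral_radial_layers) measurable
  also have "\<dots> = (\<integral>\<^sup>+\<tau>. ennreal (24 * (1 - \<tau>) * (pi * \<tau>)) * indicator {0..1} \<tau> \<partial>lborel)"
    by (intro nn_integral_cong) (auto simp: \<kappa>_def indicator_def ennreal_mult[symmetric] max_def)
  also have "\<dots> = ennreal ((\<lambda>\<tau>. pi * (12 * \<tau>^2 - 8 * \<tau>^3)) 1 - (\<lambda>\<tau>. pi * (12 * \<tau>^2 - 8 * \<tau>^3)) 0)"
  proof -
    have "0 \<le> 24 * (1 - \<tau>) * (pi * \<tau>)" if "\<tau> \<in> {0..1}" for \<tau> :: real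
      using that by (intro mult_nonneg_nonneg) auto
    then show ?thesis
      by (intro nn_integral_FTC_Icc) (auto intro!: derivative_eq_intros simp: algebra_simps power2_eq_square)
  qed
  finally show "(\<integral>\<^sup>+x. ennreal (12 * max 0 (1 - x \<bullet> (x::real^2)) ^ 2) \<partial>lborel) = ennreal (4 * pi)" by simp
qed auto

lemma integrable_inverse_quartic:
  "integrable lborel (\<lambda>x::real^2. 1 / (1 + x \<bullet> x)^2)"
proof (rule integrableI_nonneg)
  \<comment> \<open>Minus the derivative of (1 + s)^-2, so that its tail integral from s is the
    integrand.\<close>
  define \<kappa> :: "real \<Rightarrow> ennreal" where "\<kappa> \<tau> = ennreal (2 * inverse (1 + \<tau>)^3) * indicator {0..} \<tau>" for \<tau>
  have [measurable]: "\<kappa> \<in> borel_measurable borel" unfolding \<kappa>_def by measurable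
  have l1: "((\<lambda>\<tau>::real. - (inverse (1 + \<tau>)^2)) \<longlongrightarrow> 0) at_top" by real_asymp
  have l2: "((\<lambda>\<tau>::real. pi * (inverse (1 + \<tau>)^2 - 2 * inverse (1 + \<tau>))) \<longlongrightarrow> 0) at_top" by real_asymp
  have d1: "((\<lambda>\<tau>. - (inverse (1 + \<tau>)^2)) has_real_derivative 2 * inverse (1 + \<tau>)^3) (at \<tau>)"
    if "\<tau> \<ge> 0" for \<tau> :: real
    using that by (auto intro!: derivative_eq_intros simp: eval_nat_numeral)
  \<comment> \<open>With i = 1 / (1 + \<tau>), writing \<tau> = (1 + \<tau>) - 1 gives 2 i^3 \<tau>
    = 2 i^2 - 2 i^3, the derivative of i^2 - 2 i.\<close>
  have d2: "((\<lambda>\<tau>. pi * (inverse (1 + \<tau>)^2 - 2 * inverse (1 + \<tau>))) has_real_derivative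
      2 * inverse (1 + \<tau>)^3 * (pi * \<tau>)) (at \<tau>)"
    if "\<tau> \<ge> 0" for \<tau> :: real
  proof -
    have "2 * inverse (1 + \<tau>)^3 * (pi * \<tau>) = pi * (2 * inverse (1 + \<tau>)^2 * (inverse (1 + \<tau>) * (1 + \<tau>)) - 2 * inverse (1 + \<tau>)^3)"
      by (simp add: eval_nat_numeral algebra_simps)
    also have "inverse (1 + \<tau>) * (1 + \<tau>) = 1" using that by simp
    finally show ?thesis
      using that by (auto intro!: derivative_eq_intros simp: eval_nat_numeral algebra_simps)
  qed
  have 1: "(\<integral>\<^sup>+\<tau>. \<kappa> \<tau> * indicator {s..} \<tau> \<partial>lborel) = ennreal (1 / (1 + s) ^ 2)" if "s \<ge> 0" for s
  proof -
    have "(\<integral>\<^sup>+\<tau>. \<kappa> \<tau> * indicator {s..} \<tau> \<partial>lborel) = (\<integral>\<^sup>+\<tau>. ennreal (2 * inverse (1 + \<tau>)^3) * indicator {s..} \<tau> \<partial>lborel)"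
      using that by (intro nn_integral_cong) (auto simp: \<kappa>_def indicator_def)
    also have "\<dots> = 0 - (- (inverse (1 + s)^2))"
      by (rule nn_integral_FTC_atLeast[OF _ _ _ l1])
        (use that d1 in auto)
    finally show ?thesis by (simp add: divide_inverse power_inverse)
  qed
  have "(\<integral>\<^sup>+x. ennreal (1 / (1 + x \<bullet> (x::real^2)) ^ 2) \<partial>lborel)
     = (\<integral>\<^sup>+x. (\<integral>\<^sup>+\<tau>. \<kappa> \<tau> * indicator {x \<bullet> (x::real^2)..} \<tau> \<partial>lborel) \<partial>lborel)"
    by (intro nn_integral_cong) (simp add: 1)
  also have "\<dots> = (\<integral>\<^sup>+\<tau>. \<kappa> \<tau> * ennreal (pi * max 0 \<tau>) \<partial>lborel)"
    by (rule nn_integral_radial_layers) measurable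
  also have "\<dots> = (\<integral>\<^sup>+\<tau>. ennreal (2 * inverse (1 + \<tau>)^3 * (pi * \<tau>)) * indicator {0..} \<tau> \<partial>lborel)"
    by (intro nn_integral_cong) (auto simp: \<kappa>_def indicator_def ennreal_mult[symmetric] max_def)
  also have "\<dots> = 0 - (pi * (inverse (1 + 0)^2 - 2 * inverse (1 + 0)))"
    by (rule nn_integral_FTC_atLeast[OF _ _ _ l2])
      (use d2 in auto)
  finally show "(\<integral>\<^sup>+x. ennreal (1 / (1 + x \<bullet> (x::real^2)) ^ 2) \<partial>lborel) < \<infinity>" by simp
qed auto

lemma integrable_of_quartic_decay:
  fixes f :: "real^2 \<Rightarrow> real"
  assumes f: "continuous_on UNIV f" and bd: "\<And>x. \<bar>f x\<bar> \<le> C / (1 + x \<bullet> x)^2"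
  shows "integrable lborel f"
proof (rule Bochner_Integration.integrable_bound[OF integrable_mult_right[OF integrable_inverse_quartic]])
  show "f \<in> borel_measurable lborel" using borel_measurable_continuous_onI[OF f] by simp
  show "AE x in lborel. norm (f x) \<le> norm (C * (1 / (1 + x \<bullet> x)^2))"
    using order_trans[OF bd abs_ge_self] by simp
qed

text \<open>The integral of \<open>laplacian h\<close> is the limit of its integrals against
  \<open>cutoff R\<close>. By Green these equal the integrals of \<open>h\<close> against the
  Laplacian of the cutoff, which are at most 24 / R^2 times the L^1 norm of
  \<open>h\<close>.\<close>

lemma integral_laplacian_decay:
  assumes h: "C2_on UNIV h" and bd: "\<And>x. \<bar>h x\<bar> \<le> C / (1 + x \<bullet> x)^2"
    and int: "integrable lborel (laplacian h)"
  shows "(LINT x|lborel. laplacian h x) = 0"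
proof -
  note c = C2_on_continuous[OF h]
  have hint: "integrable lborel h" by (rule integrable_of_quartic_decay[OF c(1) bd])
  define R where "R n = real (Suc n)" for n
  have R: "R n > 0" for n by (simp add: R_def)
  have "(\<lambda>n. LINT x|lborel. cutoff (R n) x * laplacian h x) \<longlonglongrightarrow> (LINT x|lborel. laplacian h x)"
  proof (rule integral_dominated_convergence)
    show "laplacian h \<in> borel_measurable lborel" using borel_measurable_continuous_onI[OF c(4)] by simp
    show "(\<lambda>x. cutoff (R n) x * laplacian h x) \<in> borel_measurable lborel" for n
      using borel_measurable_continuous_onI[OF c(4)]
        borel_measurable_continuous_onI[OF C2_on_continuous(1)[OF C2_on_cutoff[OF R[of n]]]] by simp
    show "integrable lborel (\<lambda>x. \<bar>laplacian h x\<bar>)" by (rule integrable_abs[OF int])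
    show "AE x in lborel. norm (cutoff (R n) x * laplacian h x) \<le> \<bar>laplacian h x\<bar>" for n
      using cutoff_bounds[OF R[of n]] by (intro AE_I2) (simp add: abs_mult mult_left_le_one_le)
    have "(\<lambda>n. cutoff (R n) x) \<longlonglongrightarrow> max 0 (1 - 0) ^ 3" for x
    proof -
      have "(\<lambda>n. (x \<bullet> x) / (R n)^2) \<longlonglongrightarrow> 0" unfolding R_def by real_asymp
      then show ?thesis unfolding cutoff_def by (intro tendsto_intros)
    qed
    then have "(\<lambda>n. cutoff (R n) x * laplacian h x) \<longlonglongrightarrow> 1 * laplacian h x" for x
      by (intro tendsto_mult tendsto_const) simp
    then show "AE x in lborel. (\<lambda>n. cutoff (R n) x * laplacian h x) \<longlonglongrightarrow> laplacian h x" by simp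
  qed
  moreover have "(\<lambda>n. LINT x|lborel. cutoff (R n) x * laplacian h x) \<longlonglongrightarrow> 0"
  proof (rule Lim_null_comparison)
    have "(\<lambda>n. 24 / (R n)^2) \<longlonglongrightarrow> 0" unfolding R_def by real_asymp
    then show "(\<lambda>n. 24 / (R n)^2 * (LINT x|lborel. \<bar>h x\<bar>)) \<longlonglongrightarrow> 0" by (rule tendsto_mult_left_zero)
    have "norm (LINT x|lborel. cutoff (R n) x * laplacian h x) \<le> 24 / (R n)^2 * (LINT x|lborel. \<bar>h x\<bar>)" for n
    proof -
      have "(LINT x|lborel. cutoff (R n) x * laplacian h x) = (LINT x|lborel. h x * laplacian (cutoff (R n)) x)"
        by (rule Green_second_identity[OF h C2_on_cutoff[OF R] cutoff_eq_0[OF R]])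
      also have "norm \<dots> \<le> (LINT x|lborel. 24 / (R n)^2 * \<bar>h x\<bar>)"
      proof (rule Bochner_Integration.integral_norm_bound_integral)
        show "integrable lborel (\<lambda>x. 24 / (R n)^2 * \<bar>h x\<bar>)" by (intro integrable_mult_right integrable_abs hint)
        have b: "norm (h x * laplacian (cutoff (R n)) x) \<le> 24 / (R n)^2 * \<bar>h x\<bar>" for x
          using mult_left_mono[OF laplacian_cutoff_le[OF R[of n], of x] abs_ge_zero[of "h x"]]
          by (simp add: abs_mult mult.commute)
        then show "norm (h x * laplacian (cutoff (R n)) x) \<le> 24 / (R n)^2 * \<bar>h x\<bar>" for x .
        show "integrable lborel (\<lambda>x. h x * laplacian (cutoff (R n)) x)"
        proof (rule Bochner_Integration.integrable_bound[OF \<open>integrable lborel (\<lambda>x. 24 / (R n)^2 * \<bar>h x\<bar>)\<close>])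
          show "(\<lambda>x. h x * laplacian (cutoff (R n)) x) \<in> borel_measurable lborel"
            using borel_measurable_continuous_onI[OF c(1)]
              borel_measurable_continuous_onI[OF C2_on_continuous(4)[OF C2_on_cutoff[OF R[of n]]]] by simp
          show "AE x in lborel. norm (h x * laplacian (cutoff (R n)) x) \<le> norm (24 / (R n)^2 * \<bar>h x\<bar>)"
            using order_trans[OF b abs_ge_self] by simp
        qed
      qed
      finally show ?thesis by simp
    qed
    then show "\<forall>\<^sub>F n in sequentially. norm (LINT x|lborel. cutoff (R n) x * laplacian h x) \<le> 24 / (R n)^2 * (LINT x|lborel. \<bar>h x\<bar>)"
      by simp
  qed
  ultimately show ?thesis using LIMSEQ_unique by blast
qed

subsection \<open>Removing the logarithmic singularities\<close>

text \<open>The polynomial is the third Taylor polynomial of \<open>ln\<close> at \<open>1\<close>, so that the two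
  pieces fit together three times differentiably.\<close>

definition log_corr :: "real \<Rightarrow> real"
  where "log_corr t = (if t < 1 then - ((t - 1) - (t - 1)^2 / 2 + (t - 1)^3 / 3) else - ln t)"

text \<open>Has the singularity of ln |x|^2 at the origin, up to a C^2 term, and vanishes outside
  the unit disc. At the origin itself it has a default value, which later statements avoid by
  staying off the zeros.\<close>

definition trunc_log :: "real^2 \<Rightarrow> real"
  where "trunc_log x = ln (x \<bullet> x) + log_corr (x \<bullet> x)"

text \<open>Minus the Laplacian of the correction. With t = |x|^2 and u = t - 1, the inner branch
  has rho' = -1 + u - u^2 and rho'' = 1 - 2 u, so 4 (t rho'' + rho') = -12 u^2; outside the disc the
  logarithm is harmonic.\<close>

definition bump :: "real^2 \<Rightarrow> real"
  where "bump x = 12 * max 0 (1 - x \<bullet> x) ^ 2"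

lemma inner_self_ge_1: "norm x \<ge> 1 \<Longrightarrow> x \<bullet> x \<ge> 1" for x :: "'a::real_inner"
  using one_le_power[of "norm x" 2] by (simp add: power2_norm_eq_inner)

lemma trunc_log_eq_0: "norm x \<ge> 1 \<Longrightarrow> trunc_log x = 0"
  using inner_self_ge_1[of x] by (simp add: trunc_log_def log_corr_def)

lemma bump_eq_0: "norm x \<ge> 1 \<Longrightarrow> bump x = 0"
  using inner_self_ge_1[of x] by (simp add: bump_def)

lemma continuous_on_bump [continuous_intros]:
  "continuous_on S f \<Longrightarrow> continuous_on S (\<lambda>x. bump (f x))"
  unfolding bump_def by (intro continuous_intros)

lemma
  shows C2_on_log_corr: "C2_on UNIV (\<lambda>x. log_corr (x \<bullet> x))"
    and laplacian_log_corr: "laplacian (\<lambda>x. log_corr (x \<bullet> x)) x = - bump x"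
proof -
  define \<rho>' :: "real \<Rightarrow> real" where "\<rho>' t = (if t < 1 then - (1 - (t - 1) + (t - 1)^2) else - inverse t)" for t
  define \<rho>'' :: "real \<Rightarrow> real" where "\<rho>'' t = (if t < 1 then 1 - 2 * (t - 1) else inverse t ^ 2)" for t
  \<comment> \<open>Differentiability of \<open>\<rho>''\<close> is the quick route to its
    continuity across the seam, and \<open>has_real_derivative_glue\<close> supplies it; the cubic
    Taylor term is what makes these one-sided values match.\<close>
  define \<rho>3 :: "real \<Rightarrow> real" where "\<rho>3 t = (if t < 1 then -2 else - 2 * inverse t ^ 3)" for t
  have r1: "\<rho>' t = - (1 - (t - 1) + (t - 1)^2)" "\<rho>'' t = 1 - 2 * (t - 1)" "\<rho>3 t = -2" if "t \<le> 1" for t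
    using that by (cases "t = 1"; simp add: \<rho>'_def \<rho>''_def \<rho>3_def)+
  have r2: "\<rho>' t = - inverse t" "\<rho>'' t = inverse t ^ 2" "\<rho>3 t = - 2 * inverse t ^ 3" if "1 \<le> t" for t
    using that by (simp_all add: \<rho>'_def \<rho>''_def \<rho>3_def)
  have D1: "(log_corr has_real_derivative \<rho>' t) (at t)" for t
    unfolding log_corr_def[abs_def]
  proof (rule has_real_derivative_glue)
    show "((\<lambda>t. - ((t - 1) - (t - 1)^2 / 2 + (t - 1)^3 / 3)) has_real_derivative \<rho>' t) (at t)" if "t \<le> 1"
      unfolding r1[OF that] by (auto intro!: derivative_eq_intros simp: field_simps)
    show "((\<lambda>t. - ln t) has_real_derivative \<rho>' t) (at t)" if "1 \<le> t"
      unfolding r2[OF that] using that by (auto intro!: derivative_eq_intros simp: divide_inverse)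
  qed simp
  have D2: "(\<rho>' has_real_derivative \<rho>'' t) (at t)" for t
    unfolding \<rho>'_def[abs_def]
  proof (rule has_real_derivative_glue)
    show "((\<lambda>t. - (1 - (t - 1) + (t - 1)^2)) has_real_derivative \<rho>'' t) (at t)" if "t \<le> 1"
      unfolding r1[OF that] by (auto intro!: derivative_eq_intros)
    show "((\<lambda>t. - inverse t) has_real_derivative \<rho>'' t) (at t)" if "1 \<le> t"
      unfolding r2[OF that] using that by (auto intro!: derivative_eq_intros simp: power2_eq_square)
  qed simp
  have D3: "(\<rho>'' has_real_derivative \<rho>3 t) (at t)" for t
    unfolding \<rho>''_def[abs_def]
  proof (rule has_real_derivative_glue)
    show "((\<lambda>t. 1 - 2 * (t - 1)) has_real_derivative \<rho>3 t) (at t)" if "t \<le> 1"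
      unfolding r1[OF that] by (auto intro!: derivative_eq_intros)
    show "((\<lambda>t. inverse t ^ 2) has_real_derivative \<rho>3 t) (at t)" if "1 \<le> t"
      unfolding r2[OF that] using that by (auto intro!: derivative_eq_intros simp: eval_nat_numeral)
  qed simp
  have c: "continuous_on X \<rho>''" for X
    using D3 by (intro continuous_at_imp_continuous_on ballI DERIV_isCont)
  show "C2_on UNIV (\<lambda>x. log_corr (x \<bullet> x))" by (rule C2_on_radial[OF open_UNIV D1 D2 c])
  have "laplacian (\<lambda>x. log_corr (x \<bullet> x)) x = 4 * ((x \<bullet> x) * \<rho>'' (x \<bullet> x) + \<rho>' (x \<bullet> x))"
    by (rule laplacian_radial[OF open_UNIV D1 D2 c UNIV_I])
  also have "\<dots> = - bump x"
  proof (cases "x \<bullet> x < 1")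
    case True
    then show ?thesis by (simp add: \<rho>'_def \<rho>''_def bump_def max_def power2_eq_square algebra_simps)
  next
    case False
    have "t * inverse t ^ 2 = inverse t" for t :: real by (cases "t = 0") (simp_all add: power2_eq_square)
    with False show ?thesis by (simp add: \<rho>'_def \<rho>''_def bump_def max_def)
  qed
  finally show "laplacian (\<lambda>x. log_corr (x \<bullet> x)) x = - bump x" .
qed

lemma
  shows C2_on_ln_norm: "C2_on (-{0}) (\<lambda>x::real^2. ln (x \<bullet> x))"
    and laplacian_ln_norm: "x \<noteq> 0 \<Longrightarrow> laplacian (\<lambda>x::real^2. ln (x \<bullet> x)) x = 0"
proof -
  have D1: "(ln has_real_derivative inverse (x \<bullet> x)) (at (x \<bullet> x))" if "x \<in> -{0}" for x :: "real^2"
    using that by (auto intro!: derivative_eq_intros simp: divide_inverse)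
  have D2: "(inverse has_real_derivative - (inverse (x \<bullet> x) ^ 2)) (at (x \<bullet> x))" if "x \<in> -{0}" for x :: "real^2"
    using that by (auto intro!: derivative_eq_intros simp: power2_eq_square)
  have c: "continuous_on ((\<lambda>x::real^2. x \<bullet> x) ` (-{0})) (\<lambda>t. - (inverse t ^ 2))"
    by (intro continuous_intros) auto
  have o: "open (- {0::real^2})" by auto
  show "C2_on (-{0}) (\<lambda>x::real^2. ln (x \<bullet> x))" by (rule C2_on_radial[OF o D1 D2 c])
  show "laplacian (\<lambda>x::real^2. ln (x \<bullet> x)) x = 0" if "x \<noteq> 0"
    by (subst laplacian_radial[OF o D1 D2 c]) (use that in \<open>auto simp: power2_eq_square field_simps\<close>)
qed

lemma
  assumes "open S" "q \<notin> S"
  shows C2_on_ln_norm_shift: "C2_on S (\<lambda>x. ln ((x - q) \<bullet> (x - q)))"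
    and laplacian_ln_norm_shift: "x \<in> S \<Longrightarrow> laplacian (\<lambda>x. ln ((x - q) \<bullet> (x - q))) x = 0"
    and C2_on_trunc_log_shift: "C2_on S (\<lambda>x. trunc_log (x - q))"
    and laplacian_trunc_log_shift: "x \<in> S \<Longrightarrow> laplacian (\<lambda>x. trunc_log (x - q)) x = - bump (x - q)"
proof -
  have 1: "C2_on S (\<lambda>x. ln ((x - q) \<bullet> (x - q)))"
    unfolding C2_on_shift[of q S "\<lambda>x. ln (x \<bullet> x)", symmetric]
    by (rule C2_on_subset[OF C2_on_ln_norm]) (use assms in auto)
  have 2: "laplacian (\<lambda>x. ln ((x - q) \<bullet> (x - q))) x = 0" if "x \<in> S" for x
    unfolding laplacian_shift[of "\<lambda>x. ln (x \<bullet> x)"] by (rule laplacian_ln_norm) (use that assms in auto)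
  have 3: "C2_on S (\<lambda>x. log_corr ((x - q) \<bullet> (x - q)))"
    by (rule C2_on_subset[OF C2_on_UNIV_shift[OF C2_on_log_corr]]) auto
  have 4: "laplacian (\<lambda>x. log_corr ((x - q) \<bullet> (x - q))) x = - bump (x - q)" for x
    unfolding laplacian_shift[of "\<lambda>x. log_corr (x \<bullet> x)"] by (rule laplacian_log_corr)
  show "C2_on S (\<lambda>x. ln ((x - q) \<bullet> (x - q)))" by (rule 1)
  show "x \<in> S \<Longrightarrow> laplacian (\<lambda>x. ln ((x - q) \<bullet> (x - q))) x = 0" by (rule 2)
  show "C2_on S (\<lambda>x. trunc_log (x - q))"
    unfolding trunc_log_def by (rule C2_on_add[OF assms(1) 1 3])
  show "laplacian (\<lambda>x. trunc_log (x - q)) x = - bump (x - q)" if "x \<in> S"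
    unfolding trunc_log_def by (subst laplacian_add[OF assms(1) 1 3 that]) (simp add: 2[OF that] 4)
qed

text \<open>What a zero of multiplicity \<open>m\<close> leaves behind for the modulus alone. Unlike
  \<open>zero_of_multiplicity\<close> it refers only to \<open>cmod\<close>, which is invariant
  under gauge transformations, so it passes directly to lattice translates.\<close>

definition log_singularity :: "(real^2 \<Rightarrow> complex) \<Rightarrow> real^2 \<Rightarrow> nat \<Rightarrow> bool"
  where "log_singularity f q m \<longleftrightarrow> (\<exists>r>0. \<exists>k. C2_on (ball q r) k \<and>
    (\<forall>x\<in>ball q r - {q}. f x \<noteq> 0 \<and> ln ((cmod (f x))^2) = real m * ln ((x - q) \<bullet> (x - q)) + k x))"

lemma cmod_complex_coord_diff: "(cmod (complex_coord x - complex_coord q))^2 = (x - q) \<bullet> (x - q)"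
  unfolding cmod_power2 by (simp add: complex_coord_def inner_vec_def sum_2 power2_eq_square)

lemma zero_of_multiplicity_log_singularity:
  assumes "zero_of_multiplicity f q m"
  shows "log_singularity f q m"
proof -
  obtain r \<psi> where r: "r > 0" "smooth_on (ball q r) \<psi>"
    and \<psi>: "\<And>x. x \<in> ball q r \<Longrightarrow> \<psi> x \<noteq> 0 \<and> f x = (complex_coord x - complex_coord q) ^ m * \<psi> x"
    using assms unfolding zero_of_multiplicity_def by blast
  have "f x \<noteq> 0 \<and> ln ((cmod (f x))^2) = real m * ln ((x - q) \<bullet> (x - q)) + ln ((cmod (\<psi> x))^2)"
    if x: "x \<in> ball q r - {q}" for x
  proof -
    have p: "(x - q) \<bullet> (x - q) > 0" using x by auto
    have "(cmod (f x))^2 = ((x - q) \<bullet> (x - q)) ^ m * (cmod (\<psi> x))^2"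
      using \<psi>[of x] x unfolding cmod_complex_coord_diff[symmetric]
      by (simp add: norm_mult norm_power power_mult_distrib power_mult[symmetric] mult.commute)
    moreover have "\<psi> x \<noteq> 0" using \<psi>[of x] x by auto
    ultimately show ?thesis
      using p by (auto simp: ln_mult ln_realpow)
  qed
  moreover have "C2_on (ball q r) (\<lambda>x. ln ((cmod (\<psi> x))^2))"
    by (rule C2_on_ln_cmod_sq[OF open_ball r(2)]) (use \<psi> in auto)
  ultimately show ?thesis unfolding log_singularity_def using r(1) by blast
qed

text \<open>Infinitely many zeros in a compact ball would accumulate at a point that is itself a
  zero, against isolation.\<close>

lemma finite_isolated_zeros:
  assumes f: "continuous_on UNIV f" and iso: "\<And>q. f q = 0 \<Longrightarrow> \<exists>r>0. \<forall>x\<in>ball q r - {q}. f x \<noteq> 0"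
  shows "finite ({x::real^2. f x = (0::complex)} \<inter> cball c R)"
proof (rule ccontr)
  let ?Z = "{x. f x = 0}"
  assume inf: "infinite (?Z \<inter> cball c R)"
  have "closed ?Z" by (rule closed_Collect_eq) (use f in auto)
  then have "compact (?Z \<inter> cball c R)" by (intro closed_Int_compact) auto
  then obtain q where q: "q \<in> ?Z \<inter> cball c R" "q islimpt (?Z \<inter> cball c R)"
    using inf by (meson compact_eq_Bolzano_Weierstrass subset_refl)
  obtain r where "r > 0" "\<forall>x\<in>ball q r - {q}. f x \<noteq> 0" using iso q(1) by blast
  moreover obtain x where "x \<in> ?Z \<inter> cball c R" "x \<in> ball q r" "x \<noteq> q"
    using q(2) \<open>r > 0\<close> unfolding islimpt_def by (metis centre_in_ball open_ball)
  ultimately show False by auto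
qed

text \<open>Carries identities derived from logarithms across the zeros, where the logarithms say
  nothing.\<close>

lemma continuous_eq_at_puncture:
  fixes f g :: "real^2 \<Rightarrow> real"
  assumes "open U" "x \<in> U" "continuous_on U f" "continuous_on U g" "\<And>y. y \<in> U - {x} \<Longrightarrow> f y = g y"
  shows "f x = g x"
proof -
  have "(f \<longlongrightarrow> f x) (at x)" "(g \<longlongrightarrow> g x) (at x)"
    using assms by (simp_all add: continuous_on_eq_continuous_at isCont_def)
  moreover have "eventually (\<lambda>y. f y = g y) (at x)"
    using assms by (auto simp: eventually_at_topological)
  ultimately show ?thesis
    using tendsto_cong[of f g] tendsto_unique[OF at_neq_bot] by metis
qed

text \<open>Summing over zeros in \<open>ball x 1\<close> loses nothing, as \<open>trunc_log\<close>
  and \<open>bump\<close> vanish outside the unit disc, and keeps the sum finite when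
  \<open>Z\<close> is infinite. Near each point the singular logarithm cancels explicitly; the local
  functions obtained in this way agree on overlaps and are glued to \<open>h\<close>.\<close>

lemma regularized_log:
  fixes f :: "real^2 \<Rightarrow> complex" and m :: "real^2 \<Rightarrow> nat"
  defines "Z \<equiv> {x. f x = 0}"
  assumes f: "smooth f" and F: "continuous_on UNIV F"
    and lap: "\<And>x. f x \<noteq> 0 \<Longrightarrow> laplacian (\<lambda>x. ln ((cmod (f x))^2)) x = - 2 * F x"
    and sing: "\<And>q. q \<in> Z \<Longrightarrow> log_singularity f q (m q)"
  obtains h where "C2_on UNIV h"
    and "\<And>x. f x \<noteq> 0 \<Longrightarrow> h x = ln ((cmod (f x))^2) - (\<Sum>q\<in>Z \<inter> ball x 1. m q * trunc_log (x - q))"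
    and "\<And>x. laplacian h x = - 2 * F x + (\<Sum>q\<in>Z \<inter> ball x 1. m q * bump (x - q))"
proof -
  define L where "L x = ln ((cmod (f x))^2)" for x
  define G where "G x = (\<Sum>q\<in>Z \<inter> ball x 1. m q * trunc_log (x - q))" for x
  define Bu where "Bu x = (\<Sum>q\<in>Z \<inter> ball x 1. m q * bump (x - q))" for x
  have iso: "\<exists>r>0. \<forall>x\<in>ball q r - {q}. f x \<noteq> 0" for q
  proof (cases "f q = 0")
    case True then show ?thesis using sing[of q] unfolding log_singularity_def Z_def by blast
  next
    case False
    have "open {x. f x \<noteq> 0}" by (rule open_Collect_neq) (use smooth_on_continuous[OF f] in auto)
    then obtain r where "r > 0" "ball q r \<subseteq> {x. f x \<noteq> 0}" using False by (auto elim: openE)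
    then show ?thesis by (intro exI[of _ r]) auto
  qed
  have fin: "finite (Z \<inter> ball c R)" for c R
    unfolding Z_def using finite_isolated_zeros[OF smooth_on_continuous[OF f] iso, of c R]
    by (rule finite_subset[rotated]) auto
  have local: "\<exists>U k. open U \<and> x0 \<in> U \<and> C2_on U k \<and>
    (\<forall>y\<in>U - {x0}. f y \<noteq> 0) \<and> (\<forall>y\<in>U. f y \<noteq> 0 \<longrightarrow> k y = L y - G y) \<and> (\<forall>y\<in>U. laplacian k y = - 2 * F y + Bu y)" for x0
  proof -
    \<comment> \<open>Multiplicity 0 at a point where \<open>f\<close> does not vanish lets both
      cases share one argument.\<close>
    define M where "M = (if x0 \<in> Z then m x0 else 0)"
    have "\<exists>r>0. \<exists>\<kappa>. C2_on (ball x0 r) \<kappa> \<and> (\<forall>y\<in>ball x0 r. (y \<noteq> x0 \<longrightarrow> f y \<noteq> 0) \<and>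
        (f y \<noteq> 0 \<longrightarrow> L y = M * ln ((y - x0) \<bullet> (y - x0)) + \<kappa> y))"
    proof (cases "x0 \<in> Z")
      case True
      then have "f x0 = 0" by (simp add: Z_def)
      moreover obtain r k where "r > 0" "C2_on (ball x0 r) k"
        "\<forall>x\<in>ball x0 r - {x0}. f x \<noteq> 0 \<and> ln ((cmod (f x))^2) = real (m x0) * ln ((x - x0) \<bullet> (x - x0)) + k x"
        using sing[OF True] unfolding log_singularity_def by blast
      ultimately show ?thesis using True unfolding M_def L_def by (intro exI[of _ r] conjI exI[of _ k]) auto
    next
      case False
      then have x0: "f x0 \<noteq> 0" by (simp add: Z_def)
      obtain r where r: "r > 0" "\<forall>x\<in>ball x0 r - {x0}. f x \<noteq> 0" using iso by blast
      have "C2_on (ball x0 r) L"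
        unfolding L_def by (rule C2_on_ln_cmod_sq[OF open_ball])
          (use f r x0 in \<open>auto simp: smooth_on_def\<close>)
      then show ?thesis using r x0 False unfolding M_def by (intro exI[of _ r] conjI exI[of _ L]) auto
    qed
    then obtain r0 \<kappa> where r0: "r0 > 0" "C2_on (ball x0 r0) \<kappa>"
      and r0nz: "\<And>y. y \<in> ball x0 r0 \<Longrightarrow> y \<noteq> x0 \<Longrightarrow> f y \<noteq> 0"
      and r0L: "\<And>y. y \<in> ball x0 r0 \<Longrightarrow> f y \<noteq> 0 \<Longrightarrow> L y = M * ln ((y - x0) \<bullet> (y - x0)) + \<kappa> y" by blast
    define U where "U = ball x0 (min r0 1)"
    have U: "open U" "x0 \<in> U" "U \<subseteq> ball x0 r0" "U \<subseteq> ball x0 1" using r0 by (auto simp: U_def)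
    have \<kappa>: "C2_on U \<kappa>" by (rule C2_on_subset[OF r0(2) U(3)])
    \<comment> \<open>Radius 2 because \<open>U\<close> lies within distance 1 of \<open>x0\<close>
      and the truncated terms reach distance 1. This finite set no longer depends on the point of
      \<open>U\<close>.\<close>
    define Zf where "Zf = Z \<inter> ball x0 2 - {x0}"
    have Zf: "finite Zf" unfolding Zf_def using fin by blast
    have ZfU: "q \<notin> U" if "q \<in> Zf" for q using that r0nz U(3) by (auto simp: Zf_def Z_def)
    have sums: "(\<Sum>q\<in>Z \<inter> ball y 1. m q * w (y - q)) = M * w (y - x0) + (\<Sum>q\<in>Zf. m q * w (y - q))"
      if y: "y \<in> U" and w: "\<And>x. norm x \<ge> 1 \<Longrightarrow> w x = 0" for y and w :: "real^2 \<Rightarrow> real"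
    proof -
      have sub: "Z \<inter> ball y 1 \<subseteq> Z \<inter> ball x0 2"
        using y U(4) dist_triangle_less_add[of x0 y 1 _ 1] by (auto simp: dist_commute)
      have "(\<Sum>q\<in>Z \<inter> ball y 1. m q * w (y - q)) = (\<Sum>q\<in>Z \<inter> ball x0 2. m q * w (y - q))"
        by (rule sum.mono_neutral_left[OF fin sub]) (auto simp: w dist_norm not_less)
      also have "\<dots> = M * w (y - x0) + (\<Sum>q\<in>Zf. m q * w (y - q))"
      proof (cases "x0 \<in> Z")
        case True
        then have "x0 \<in> Z \<inter> ball x0 2" by simp
        from sum.remove[OF fin this] show ?thesis using True by (simp add: M_def Zf_def)
      next
        case False
        then have "Z \<inter> ball x0 2 = Zf" by (auto simp: Zf_def)
        then show ?thesis using False by (simp add: M_def)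
      qed
      finally show ?thesis .
    qed
    define S where "S y = (\<Sum>q\<in>Zf. m q * trunc_log (y - q))" for y
    define c where "c y = M * log_corr ((y - x0) \<bullet> (y - x0))" for y
    \<comment> \<open>This is \<open>L - G\<close> with the term \<open>M * ln\<close> at
      \<open>x0\<close> cancelled: \<open>\<kappa>\<close> is what remains of \<open>L\<close>, and
      \<open>c\<close> and \<open>S\<close> are what remains of \<open>G\<close>. Each summand is
      regular on all of \<open>U\<close>.\<close>
    define k where "k y = \<kappa> y - c y - S y" for y
    have C_S: "C2_on U S" unfolding S_def
      by (intro C2_on_sum C2_on_cmult C2_on_trunc_log_shift U ZfU)
    have L_S: "laplacian S y = - (\<Sum>q\<in>Zf. m q * bump (y - q))" if "y \<in> U" for y
      unfolding S_def
      by (subst laplacian_sum[OF U(1) _ that])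
        (auto intro!: C2_on_cmult C2_on_trunc_log_shift U ZfU sum.cong
          simp: laplacian_cmult[OF U(1) C2_on_trunc_log_shift[OF U(1) ZfU] that] laplacian_trunc_log_shift[OF U(1) ZfU that] sum_negf[symmetric])
    have cc: "C2_on U (\<lambda>y. log_corr ((y - x0) \<bullet> (y - x0)))"
      by (rule C2_on_subset[OF C2_on_UNIV_shift[OF C2_on_log_corr]]) auto
    have C_c: "C2_on U c" unfolding c_def by (rule C2_on_cmult[OF U(1) cc])
    have L_c: "laplacian c y = - (M * bump (y - x0))" if "y \<in> U" for y
      unfolding c_def laplacian_cmult[OF U(1) cc that] laplacian_shift[of "\<lambda>x. log_corr (x \<bullet> x)"]
      by (simp add: laplacian_log_corr)
    have C_k: "C2_on U k" unfolding k_def by (intro C2_on_diff U \<kappa> C_c C_S)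
    have eq: "k y = L y - G y" if "y \<in> U" "f y \<noteq> 0" for y
    proof -
      have "L y = M * ln ((y - x0) \<bullet> (y - x0)) + \<kappa> y"
        by (rule r0L[OF subsetD[OF U(3) that(1)] that(2)])
      moreover have "G y = M * trunc_log (y - x0) + S y"
        unfolding G_def S_def by (rule sums[OF that(1) trunc_log_eq_0])
      ultimately show ?thesis
        unfolding k_def c_def trunc_log_def[of "y - x0"] distrib_left by linarith
    qed
    have L_\<kappa>': "laplacian \<kappa> y = - 2 * F y" if "y \<in> U - {x0}" for y
    proof -
      let ?V = "U - {x0}"
      have V: "open ?V" "x0 \<notin> ?V" using U(1) by auto
      have nz: "f z \<noteq> 0" if "z \<in> ?V" for z using that r0nz U(3) by auto
      have CL: "C2_on ?V L"
        unfolding L_def by (rule C2_on_ln_cmod_sq[OF V(1)]) (use f nz in \<open>auto simp: smooth_on_def\<close>)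
      have Cl: "C2_on ?V (\<lambda>z. M * ln ((z - x0) \<bullet> (z - x0)))"
        by (intro C2_on_cmult C2_on_ln_norm_shift V)
      have "laplacian \<kappa> y = laplacian (\<lambda>z. L z - M * ln ((z - x0) \<bullet> (z - x0))) y"
        by (rule laplacian_cong_open[OF V(1) that]) (use r0L U(3) nz in auto)
      also have "\<dots> = laplacian L y - laplacian (\<lambda>z. M * ln ((z - x0) \<bullet> (z - x0))) y"
        by (rule laplacian_diff[OF V(1) CL Cl that])
      also have "laplacian (\<lambda>z. M * ln ((z - x0) \<bullet> (z - x0))) y = 0"
        by (subst laplacian_cmult[OF V(1) C2_on_ln_norm_shift[OF V] that]) (simp add: laplacian_ln_norm_shift[OF V that])
      also have "laplacian L y = - 2 * F y" unfolding L_def by (rule lap[OF nz[OF that]])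
      finally show ?thesis by simp
    qed
    \<comment> \<open>At the centre the equation follows by continuity of both sides, since the
      vortex equation yields it only off the zeros.\<close>
    have L_\<kappa>: "laplacian \<kappa> y = - 2 * F y" if "y \<in> U" for y
    proof (cases "y = x0")
      case True
      show ?thesis unfolding True
        by (rule continuous_eq_at_puncture[OF U(1,2) C2_on_continuous(4)[OF \<kappa>] _ L_\<kappa>'])
          (auto intro!: continuous_intros continuous_on_subset[OF F])
    qed (use L_\<kappa>' that in auto)
    have L_k: "laplacian k y = - 2 * F y + Bu y" if y: "y \<in> U" for y
    proof -
      have "laplacian k y = laplacian (\<lambda>z. \<kappa> z - c z) y - laplacian S y"
        unfolding k_def by (rule laplacian_diff[OF U(1) C2_on_diff[OF U(1) \<kappa> C_c] C_S y])
      also have "laplacian (\<lambda>z. \<kappa> z - c z) y = laplacian \<kappa> y - laplacian c y"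
        by (rule laplacian_diff[OF U(1) \<kappa> C_c y])
      finally show ?thesis
        using L_\<kappa>[OF y] L_c[OF y] L_S[OF y] sums[of y bump, OF y bump_eq_0] unfolding Bu_def by linarith
    qed
    show ?thesis
      using U C_k eq L_k r0nz by (intro exI[of _ U] exI[of _ k]) auto
  qed
  define P where "P x0 Uk \<longleftrightarrow> open (fst Uk) \<and> x0 \<in> fst Uk \<and> C2_on (fst Uk) (snd Uk) \<and>
    (\<forall>y\<in>fst Uk - {x0}. f y \<noteq> 0) \<and> (\<forall>y\<in>fst Uk. f y \<noteq> 0 \<longrightarrow> snd Uk y = L y - G y) \<and>
    (\<forall>y\<in>fst Uk. laplacian (snd Uk) y = - 2 * F y + Bu y)" for x0 Uk
  have "\<forall>x0. \<exists>Uk. P x0 Uk" using local unfolding P_def by simp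
  from choice[OF this] obtain UK where UK: "\<forall>x0. P x0 (UK x0)" by (elim exE)
  define U where "U x0 = fst (UK x0)" for x0
  define K where "K x0 = snd (UK x0)" for x0
  have P: "open (U x0)" "x0 \<in> U x0" "C2_on (U x0) (K x0)" "\<And>y. y \<in> U x0 \<Longrightarrow> y \<noteq> x0 \<Longrightarrow> f y \<noteq> 0"
    "\<And>y. y \<in> U x0 \<Longrightarrow> f y \<noteq> 0 \<Longrightarrow> K x0 y = L y - G y"
    "\<And>y. y \<in> U x0 \<Longrightarrow> laplacian (K x0) y = - 2 * F y + Bu y" for x0
    using UK[rule_format, of x0] unfolding P_def U_def K_def by auto
  \<comment> \<open>Each point takes the value of its own local function. Off its centre a
    neighbourhood contains no zero, so there every local function equals \<open>L - G\<close> and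
    the choices agree.\<close>
  define h where "h x = K x x" for x
  have h1: "h x = L x - G x" if "f x \<noteq> 0" for x unfolding h_def by (rule P(5)[OF P(2) that])
  have hK: "K x0 y = h y" if "y \<in> U x0" for x0 y
  proof (cases "y = x0")
    case False
    have "f y \<noteq> 0" by (rule P(4)[OF that False])
    then show ?thesis using P(5)[OF that] h1 by simp
  qed (simp add: h_def)
  show thesis
  proof (rule that)
    have "C2_on (U x) h" for x by (rule C2_on_cong_open[OF P(1) hK P(3)])
    then show "C2_on UNIV h" using P(1,2) by (intro C2_on_local) blast
    show "h x = ln ((cmod (f x))^2) - (\<Sum>q\<in>Z \<inter> ball x 1. m q * trunc_log (x - q))" if "f x \<noteq> 0" for x
      using h1[OF that] by (simp only: L_def G_def)
    show "laplacian h x = - 2 * F x + (\<Sum>q\<in>Z \<inter> ball x 1. m q * bump (x - q))" for x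
      using laplacian_cong_open[OF P(1)[of x] P(2) hK[symmetric]] P(6)[OF P(2), of x] by (simp only: Bu_def)
  qed
qed

subsection \<open>Exponential nonlinearity and decay at infinity\<close>

lemma abs_exp_minus_id_le:
  fixes x :: real
  assumes "\<bar>x\<bar> \<le> 1"
  shows "\<bar>exp x - 1 - x\<bar> \<le> x^2"
proof -
  have "exp x \<le> 1 + x + x^2"
  proof (cases "x \<ge> 0")
    case True then show ?thesis using exp_bound[of x] assms by simp
  next
    case False
    \<comment> \<open>For x < 0 both sides are compared after multiplication by 1 - x > 0: exp x (1
      - x) is at most 1, and (1 + x + x^2) (1 - x) = 1 - x^3 is at least 1.\<close>
    have "exp x * (1 - x) \<le> exp x * exp (- x)"
      using exp_ge_add_one_self[of "- x"] by (intro mult_left_mono) auto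
    also have "\<dots> = 1" by (simp add: exp_minus)
    also have "1 \<le> (1 + x + x^2) * (1 - x)"
    proof -
      have "(1 + x + x^2) * (1 - x) = 1 + (- x) * x^2" by (simp add: algebra_simps power2_eq_square)
      moreover have "(- x) * x^2 \<ge> 0" using False by (intro mult_nonneg_nonneg) auto
      ultimately show ?thesis by linarith
    qed
    finally show ?thesis using False by simp
  qed
  then show ?thesis using exp_ge_add_one_self[of x] zero_le_power2[of x] unfolding abs_le_iff by linarith
qed

text \<open>The quadratic part is a Q + b S^2 with Q the sum of squares and S the sum. It is at
  least min(a, a + b N) Q: trivially for b \<ge> 0, and by S^2 \<le> N Q for b < 0. The remainder of
  exp beyond first order is quadratic in w, so for small w half of this bound survives.\<close>

lemma coupling_coercive:
  fixes a b :: real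
  assumes a: "a > 0" and ab: "a + b * real N > 0"
  obtains \<eta> l where "0 < \<eta>" "\<eta> \<le> 1" "0 < l"
    "\<And>w :: nat \<Rightarrow> real. (\<And>i. i \<in> {1..N} \<Longrightarrow> \<bar>w i\<bar> \<le> \<eta>) \<Longrightarrow>
      l * (\<Sum>i\<in>{1..N}. (w i)^2) \<le> (\<Sum>i\<in>{1..N}. w i * (a * (exp (w i) - 1) + b * (\<Sum>j\<in>{1..N}. exp (w j) - 1)))"
proof -
  define \<mu> where "\<mu> = min a (a + b * real N)"
  define c where "c = a + \<bar>b\<bar> * real N"
  \<comment> \<open>The bound 1 admits the estimate for exp; the bound
    \<open>\<mu> / (2 * c)\<close> lets the remainder, at most \<open>\<eta> * c * Q\<close>, take
    up only half of \<open>\<mu> * Q\<close>.\<close>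
  define \<eta> where "\<eta> = min 1 (\<mu> / (2 * c))"
  have \<mu>: "\<mu> > 0" using a ab by (simp add: \<mu>_def)
  have c: "c > 0" using a by (simp add: c_def add_pos_nonneg)
  have \<eta>: "0 < \<eta>" "\<eta> \<le> 1" using \<mu> c by (auto simp: \<eta>_def)
  have \<eta>c: "\<eta> * c \<le> \<mu> / 2"
  proof -
    have "\<eta> * c \<le> \<mu> / (2 * c) * c" using c by (intro mult_right_mono) (auto simp: \<eta>_def)
    then show ?thesis using c by simp
  qed
  show thesis
  proof (rule that[OF \<eta>, of "\<mu> / 2"])
    fix w :: "nat \<Rightarrow> real" assume w: "\<And>i. i \<in> {1..N} \<Longrightarrow> \<bar>w i\<bar> \<le> \<eta>"
    define r where "r i = exp (w i) - 1 - w i" for i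
    define S where "S = (\<Sum>i\<in>{1..N}. w i)"
    define Q where "Q = (\<Sum>i\<in>{1..N}. (w i)^2)"
    have Q: "Q \<ge> 0" by (simp add: Q_def sum_nonneg)
    have r: "\<bar>r i\<bar> \<le> (w i)^2" if "i \<in> {1..N}" for i
      unfolding r_def using w[OF that] \<eta> by (intro abs_exp_minus_id_le) simp
    have e: "exp (w i) - 1 = w i + r i" for i by (simp add: r_def)
    have 1: "\<mu> * Q \<le> a * Q + b * S^2"
    proof (cases "b \<ge> 0")
      case True
      have "\<mu> * Q \<le> a * Q" using Q by (intro mult_right_mono) (auto simp: \<mu>_def)
      then show ?thesis using True by (simp add: add_increasing2)
    next
      case False
      have "S^2 \<le> Q * real N"
        using sum_squared_le_sum_of_squares[of w "{1..N}"] by (simp add: S_def Q_def)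
      then have "b * (Q * real N) \<le> b * S^2" using False by (intro mult_left_mono_neg) auto
      moreover have "\<mu> * Q \<le> (a + b * real N) * Q" using Q by (intro mult_right_mono) (auto simp: \<mu>_def)
      ultimately show ?thesis by (simp add: algebra_simps)
    qed
    have 2: "\<bar>\<Sum>i\<in>{1..N}. w i * r i\<bar> \<le> \<eta> * Q"
    proof -
      have "\<bar>\<Sum>i\<in>{1..N}. w i * r i\<bar> \<le> (\<Sum>i\<in>{1..N}. \<eta> * (w i)^2)"
        by (rule order_trans[OF sum_abs], rule sum_mono) (auto simp: abs_mult intro!: mult_mono w r less_imp_le[OF \<eta>(1)])
      then show ?thesis by (simp add: Q_def sum_distrib_left)
    qed
    have 3: "\<bar>S * (\<Sum>i\<in>{1..N}. r i)\<bar> \<le> (real N * \<eta>) * Q"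
    proof -
      have "\<bar>S\<bar> \<le> (\<Sum>i\<in>{1..N}. \<eta>)" unfolding S_def by (rule order_trans[OF sum_abs], rule sum_mono) (rule w)
      moreover have "\<bar>\<Sum>i\<in>{1..N}. r i\<bar> \<le> Q" unfolding Q_def by (rule order_trans[OF sum_abs], rule sum_mono) (rule r)
      ultimately show ?thesis unfolding abs_mult using \<eta>(1) by (intro mult_mono) auto
    qed
    have E0: "(\<Sum>i\<in>{1..N}. w i * (a * (exp (w i) - 1) + b * T))
        = a * (\<Sum>i\<in>{1..N}. w i * (exp (w i) - 1)) + b * (S * T)" for T
      by (simp add: distrib_left sum.distrib sum_distrib_left S_def sum_distrib_right mult_ac)
    have E1: "(\<Sum>i\<in>{1..N}. w i * (exp (w i) - 1)) = Q + (\<Sum>i\<in>{1..N}. w i * r i)"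
      by (simp only: e distrib_left sum.distrib Q_def power2_eq_square)
    have E2: "(\<Sum>j\<in>{1..N}. exp (w j) - 1) = S + (\<Sum>j\<in>{1..N}. r j)"
      by (simp only: e sum.distrib S_def)
    have eq: "(\<Sum>i\<in>{1..N}. w i * (a * (exp (w i) - 1) + b * (\<Sum>j\<in>{1..N}. exp (w j) - 1)))
      = (a * Q + b * S^2) + a * (\<Sum>i\<in>{1..N}. w i * r i) + b * (S * (\<Sum>j\<in>{1..N}. r j))"
      unfolding E0 E1 E2 by (simp add: algebra_simps power2_eq_square)
    have 4: "\<bar>a * (\<Sum>i\<in>{1..N}. w i * r i)\<bar> \<le> a * (\<eta> * Q)"
      unfolding abs_mult using 2 a by (simp add: mult_left_mono)
    have 5: "\<bar>b * (S * (\<Sum>j\<in>{1..N}. r j))\<bar> \<le> \<bar>b\<bar> * ((real N * \<eta>) * Q)"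
      unfolding abs_mult[of b] by (rule mult_left_mono[OF 3]) simp
    have 6: "a * (\<eta> * Q) + \<bar>b\<bar> * ((real N * \<eta>) * Q) \<le> \<mu> / 2 * Q"
      using mult_right_mono[OF \<eta>c Q] by (simp add: c_def algebra_simps)
    show "\<mu> / 2 * (\<Sum>i\<in>{1..N}. (w i)^2) \<le> (\<Sum>i\<in>{1..N}. w i * (a * (exp (w i) - 1) + b * (\<Sum>j\<in>{1..N}. exp (w j) - 1)))"
      unfolding eq Q_def[symmetric] using 1 4 5 6 unfolding abs_le_iff by linarith
  qed (use \<mu> in simp)
qed

text \<open>Comparison with the supersolution \<open>C / (1 + \<bar>x\<bar>\<^sup>2)\<^sup>4\<close> by the maximum principle.\<close>
lemma decay_of_subsolution:
  fixes H :: "real^2 \<Rightarrow> real"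
  assumes C2: "C2_on {x. norm x > R} H" and l: "l > 0"
    and lap: "\<And>x. norm x > R \<Longrightarrow> l * H x \<le> laplacian H x"
    and lim: "(H \<longlongrightarrow> 0) at_infinity"
  obtains C R' where "C \<ge> 0" "R' > R" "\<And>x. norm x \<ge> R' \<Longrightarrow> H x \<le> C / (1 + x \<bullet> x)^4"
proof -
  define K where "K x = inverse (1 + x \<bullet> x) ^ 4" for x :: "real^2"
  \<comment> \<open>The radial formula gives a Laplacian of \<open>K\<close> of at most 64
    \<open>K\<close> / (1 + |x|^2). This is at most \<open>l * K\<close> once |x|^2 \<ge> 64 / l,
    which holds for |x| > \<open>R1\<close> since \<open>R1\<close> is at least both 1 and 64 /
    l.\<close>
  define R1 where "R1 = \<bar>R\<bar> + 1 + 64 / l"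
  have R1: "R1 > R" "R1 > 0" "R1 \<ge> 1" "64 / l \<le> R1"
    unfolding R1_def using divide_pos_pos[OF _ l, of 64] abs_ge_self[of R] by (smt (verit))+
  have ip: "1 + x \<bullet> x > 0" for x :: "real^2" by (simp add: add_pos_nonneg)
  have D1: "((\<lambda>t. inverse (1 + t) ^ 4) has_real_derivative - 4 * inverse (1 + x \<bullet> x) ^ 5) (at (x \<bullet> x))"
    and D2: "((\<lambda>t. - 4 * inverse (1 + t) ^ 5) has_real_derivative 20 * inverse (1 + x \<bullet> x) ^ 6) (at (x \<bullet> x))" for x :: "real^2"
    using ip[of x] by (auto intro!: derivative_eq_intros simp: eval_nat_numeral)
  have c: "continuous_on ((\<lambda>x::real^2. x \<bullet> x) ` UNIV) (\<lambda>t. 20 * inverse (1 + t) ^ 6)"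
    using ip by (intro continuous_intros) (auto simp: less_imp_neq[THEN not_sym])
  have CK: "C2_on UNIV K" unfolding K_def by (rule C2_on_radial[OF open_UNIV D1 D2 c])
  have LK: "laplacian K x \<le> l * K x" if "norm x > R1" for x
  proof -
    define i where "i = inverse (1 + x \<bullet> x)"
    have i: "i > 0" "(x \<bullet> x) * i \<le> 1" using ip[of x] by (auto simp: i_def field_simps)
    have "laplacian K x = 4 * ((x \<bullet> x) * (20 * i ^ 6) + (- 4 * i ^ 5))"
      unfolding K_def i_def by (rule laplacian_radial[OF open_UNIV D1 D2 c UNIV_I])
    also have "\<dots> = 80 * (((x \<bullet> x) * i) * i ^ 5) - 16 * i ^ 5" by (simp add: eval_nat_numeral algebra_simps)
    also have "((x \<bullet> x) * i) * i ^ 5 \<le> 1 * i ^ 5" using i by (intro mult_right_mono) auto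
    finally have "laplacian K x \<le> (64 * i) * i ^ 4" by (simp add: eval_nat_numeral)
    also have "64 * i \<le> l"
    proof -
      have "64 / l \<le> R1 * 1" using R1 by simp
      also have "\<dots> \<le> R1 * R1" using R1 by (intro mult_left_mono) auto
      also have "\<dots> \<le> norm x * norm x" using that R1 by (intro mult_mono) auto
      finally have "64 / l \<le> 1 + x \<bullet> x" by (simp add: dot_square_norm power2_eq_square)
      then show ?thesis using l ip[of x] by (simp add: i_def field_simps)
    qed
    then have "(64 * i) * i ^ 4 \<le> l * i ^ 4" using i by (intro mult_right_mono) auto
    finally show ?thesis by (simp add: K_def i_def)
  qed
  have cH: "continuous_on {x. norm x > R} H" by (rule C2_on_continuous(1)[OF C2])
  have "compact (H ` sphere 0 R1)"
    by (intro compact_continuous_image continuous_on_subset[OF cH]) (use R1 in auto)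
  then obtain M where M: "\<And>x. norm x = R1 \<Longrightarrow> \<bar>H x\<bar> \<le> M"
    using compact_imp_bounded[of "H ` sphere 0 R1"] unfolding bounded_iff by force
  \<comment> \<open>Chosen so that \<open>C * K\<close> equals \<open>\<bar>M\<bar> + 1\<close> on
    the sphere of radius \<open>R1\<close> and strictly exceeds \<open>H\<close> there.\<close>
  define C where "C = (\<bar>M\<bar> + 1) * (1 + R1^2) ^ 4"
  have C: "C \<ge> 0" by (simp add: C_def)
  have bdry: "H x < C * K x" if "norm x = R1" for x
  proof -
    have "x \<bullet> x = R1^2" using that by (simp add: dot_square_norm)
    moreover have "1 + R1^2 > 0" by (simp add: add_pos_nonneg)
    ultimately have "C * K x = \<bar>M\<bar> + 1" by (simp add: C_def K_def power_inverse)
    then show ?thesis using M[OF that] by linarith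
  qed
  have main: "H x1 \<le> C * K x1" if x1: "norm x1 \<ge> R1" for x1
  proof (rule ccontr)
    define D where "D x = H x - C * K x" for x
    assume "\<not> ?thesis"
    then have pos: "D x1 > 0" by (simp add: D_def)
    have K0: "K x \<ge> 0" for x using ip[of x] by (simp add: K_def)
    obtain R2 where R2: "\<And>x. norm x \<ge> R2 \<Longrightarrow> H x < D x1"
      using order_tendstoD(2)[OF lim pos] unfolding eventually_at_infinity by blast
    \<comment> \<open>From here outwards \<open>D\<close> stays below \<open>D x1\<close>, and on
      the inner sphere it is negative. The maximum over the closed annulus is therefore attained in
      its interior.\<close>
    define R3 where "R3 = max R2 (norm x1)"
    have far: "D x < D x1" if "norm x \<ge> R3" for x
    proof -
      have "norm x \<ge> R2" using that by (simp add: R3_def)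
      then show ?thesis using R2[of x] mult_nonneg_nonneg[OF C K0[of x]] by (simp add: D_def)
    qed
    let ?A = "cball (0::real^2) R3 \<inter> {x. norm x \<ge> R1}"
    have "compact ?A"
      by (intro compact_Int_closed compact_cball closed_Collect_le continuous_intros)
    moreover have "x1 \<in> ?A" using x1 by (simp add: R3_def)
    moreover have "continuous_on ?A D"
      unfolding D_def by (intro continuous_intros continuous_on_subset[OF cH]
          continuous_on_subset[OF C2_on_continuous(1)[OF CK]]) (use R1 in auto)
    ultimately obtain x0 where x0: "x0 \<in> ?A" "\<And>y. y \<in> ?A \<Longrightarrow> D y \<le> D x0"
      using continuous_attains_sup[of ?A D] by blast
    have Dx0: "D x0 \<ge> D x1" using x0(2) \<open>x1 \<in> ?A\<close> by blast
    have n1: "norm x0 \<noteq> R1" using bdry[of x0] Dx0 pos by (auto simp: D_def)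
    have n2: "norm x0 < R3" using far[of x0] Dx0 by force
    have n3: "norm x0 > R1" using n1 x0(1) by auto
    let ?S = "{x. norm x > R1} \<inter> ball 0 R3"
    have S: "open ?S" by (intro open_Int open_Collect_less continuous_intros) auto
    have CH': "C2_on ?S H" by (rule C2_on_subset[OF C2]) (use R1 in auto)
    have CK': "C2_on ?S (\<lambda>x. C * K x)" by (rule C2_on_subset[OF C2_on_cmult[OF open_UNIV CK]]) auto
    have xS: "x0 \<in> ?S" using n2 n3 by simp
    have "laplacian D x0 \<le> 0"
    proof (rule laplacian_nonpos_at_local_max[OF _ S xS])
      show "C2_on ?S D" unfolding D_def by (rule C2_on_diff[OF S CH' CK'])
      show "D y \<le> D x0" if "y \<in> ?S" for y using that by (intro x0(2)) auto
    qed
    moreover have "laplacian D x0 = laplacian H x0 - C * laplacian K x0"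
      unfolding D_def laplacian_diff[OF S CH' CK' xS] by (simp add: laplacian_cmult[OF open_UNIV CK])
    moreover have "C * laplacian K x0 \<le> C * (l * K x0)" by (rule mult_left_mono[OF LK[OF n3] C])
    moreover have "l * H x0 \<le> laplacian H x0" using n3 R1 by (intro lap) simp
    ultimately have "l * D x0 \<le> 0" by (simp add: D_def algebra_simps)
    then show False using Dx0 pos l by (simp add: mult_le_0_iff)
  qed
  show thesis
    by (rule that[OF C R1(1)]) (use main in \<open>simp add: K_def divide_inverse power_inverse\<close>)
qed


lemma quartic_decay_global:
  fixes f :: "real^2 \<Rightarrow> real"
  assumes f: "continuous_on UNIV f" and bd: "\<And>x. norm x \<ge> R \<Longrightarrow> \<bar>f x\<bar> \<le> C / (1 + x \<bullet> x)^2"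
  obtains C' where "\<And>x. \<bar>f x\<bar> \<le> C' / (1 + x \<bullet> x)^2"
proof -
  have "compact ((\<lambda>x. f x * (1 + x \<bullet> x)^2) ` cball 0 R)"
    by (intro compact_continuous_image continuous_intros continuous_on_subset[OF f]) auto
  then obtain M where M: "\<And>x. x \<in> cball 0 R \<Longrightarrow> \<bar>f x * (1 + x \<bullet> x)^2\<bar> \<le> M"
    using compact_imp_bounded[of "(\<lambda>x. f x * (1 + x \<bullet> x)^2) ` cball 0 R"] unfolding bounded_iff by force
  have p: "(1 + x \<bullet> x)^2 > 0" for x :: "real^2"
    by (rule zero_less_power) (simp add: add_pos_nonneg)
  have "\<bar>f x\<bar> \<le> max M C / (1 + x \<bullet> x)^2" for x
  proof (cases "norm x \<ge> R")
    case True
    show ?thesis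
      by (rule order_trans[OF bd[OF True]]) (intro divide_right_mono, use p[of x] in auto)
  next
    case False
    then have "\<bar>f x\<bar> * (1 + x \<bullet> x)^2 \<le> M" using M[of x] by (simp add: abs_mult)
    then have "\<bar>f x\<bar> \<le> M / (1 + x \<bullet> x)^2" using p[of x] by (simp add: pos_le_divide_eq)
    also have "\<dots> \<le> max M C / (1 + x \<bullet> x)^2" by (intro divide_right_mono) (use p[of x] in auto)
    finally show ?thesis .
  qed
  then show thesis by (rule that)
qed

subsection \<open>Vortices on the plane\<close>

lemma field_strength_continuous:
  assumes "\<And>l. smooth (A l)"
  shows "continuous_on UNIV (field_strength A)"
  unfolding field_strength_def[abs_def]
  by (intro continuous_on_diff smooth_on_continuous smooth_on_partial assms)

text \<open>Since the Laplacian of w^2 is 2 |grad w|^2 + 2 w times that of w, dropping the gradient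
  terms and using coercivity gives a scalar inequality for the sum \<open>H\<close> of the squares,
  to which \<open>decay_of_subsolution\<close> applies.\<close>

lemma vortex_plane_decay:
  fixes N :: nat and e g v :: real
    and \<phi> :: "nat \<Rightarrow> real^2 \<Rightarrow> complex" and B :: "nat \<Rightarrow> 2 \<Rightarrow> real^2 \<Rightarrow> real"
  assumes pos: "N > 0" "e > 0" "g > 0" "v > 0"
    and phi: "\<And>i. i \<in> {1..N} \<Longrightarrow> smooth (\<phi> i)"
    and B: "\<And>i l. i \<in> {1..N} \<Longrightarrow> smooth (B i l)"
    and sol: "vortex_solution_on UNIV N e g v \<phi> B"
    and lim: "\<And>i. i \<in> {1..N} \<Longrightarrow> ((\<lambda>x. cmod (\<phi> i x)) \<longlongrightarrow> v) at_infinity"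
  obtains C R where "\<And>i x. i \<in> {1..N} \<Longrightarrow> norm x \<ge> R \<Longrightarrow> \<phi> i x \<noteq> 0"
    "\<And>i x. i \<in> {1..N} \<Longrightarrow> norm x \<ge> R \<Longrightarrow> \<bar>ln ((cmod (\<phi> i x))^2) - ln (v^2)\<bar> \<le> C / (1 + x \<bullet> x)^2"
    "\<And>i x. i \<in> {1..N} \<Longrightarrow> norm x \<ge> R \<Longrightarrow> \<bar>field_strength (B i) x\<bar> \<le> C / (1 + x \<bullet> x)^2"
proof -
  define a where "a = g^2 / real N"
  \<comment> \<open>With these \<open>a\<close> and \<open>b\<close> the first equation becomes
    \<open>4 * F i = - (v^2) * (a * E i + b * (sum of all E j))\<close>, and
    \<open>a + b * N\<close> is \<open>e^2\<close>, so both positivity conditions for coercivity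
    hold.\<close>
  define b where "b = (e^2 - a) / real N"
  have a: "a > 0" using pos by (simp add: a_def)
  have ab: "a + b * real N > 0" using pos by (simp add: b_def)
  define w where "w i x = ln ((cmod (\<phi> i x))^2) - ln (v^2)" for i x
  define E where "E i x = exp (w i x) - 1" for i x
  define F where "F i = field_strength (B i)" for i
  obtain \<eta> l where \<eta>: "0 < \<eta>" "\<eta> \<le> 1" and l: "0 < l" and coercive:
    "\<And>w :: nat \<Rightarrow> real. (\<And>i. i \<in> {1..N} \<Longrightarrow> \<bar>w i\<bar> \<le> \<eta>) \<Longrightarrow>
      l * (\<Sum>i\<in>{1..N}. (w i)^2) \<le> (\<Sum>i\<in>{1..N}. w i * (a * (exp (w i) - 1) + b * (\<Sum>j\<in>{1..N}. exp (w j) - 1)))"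
    using coupling_coercive[OF a ab] by blast
  have eqF: "4 * F i x = - (v^2) * (a * E i x + b * (\<Sum>j\<in>{1..N}. E j x))"
    if i: "i \<in> {1..N}" and nz: "\<And>j. j \<in> {1..N} \<Longrightarrow> \<phi> j x \<noteq> 0" for i x
  proof -
    have ex: "v^2 - (cmod (\<phi> j x))^2 = - (v^2) * E j x" if "j \<in> {1..N}" for j
    proof -
      have "exp (w j x) = (cmod (\<phi> j x))^2 / v^2"
        unfolding w_def exp_diff using nz[OF that] pos by (simp del: ln_realpow)
      then show ?thesis using pos by (simp add: E_def field_simps)
    qed
    have "v^2 - (1 / real N) * (\<Sum>j\<in>{1..N}. (cmod (\<phi> j x))^2) = (1 / real N) * (\<Sum>j\<in>{1..N}. v^2 - (cmod (\<phi> j x))^2)"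
      using pos by (simp add: sum_subtractf field_simps)
    also have "(\<Sum>j\<in>{1..N}. v^2 - (cmod (\<phi> j x))^2) = - (v^2) * (\<Sum>j\<in>{1..N}. E j x)"
      unfolding sum_distrib_left by (intro sum.cong refl ex)
    finally have s: "v^2 - (1 / real N) * (\<Sum>j\<in>{1..N}. (cmod (\<phi> j x))^2) = (1 / real N) * (- (v^2) * (\<Sum>j\<in>{1..N}. E j x))" .
    have "4 * F i x = g^2 / real N * (v^2 - (cmod (\<phi> i x))^2)
         + (e^2 - g^2 / real N) * (v^2 - (1 / real N) * (\<Sum>j\<in>{1..N}. (cmod (\<phi> j x))^2))"
      using sol i unfolding vortex_solution_on_def F_def by blast
    also have "\<dots> = a * (- (v^2) * E i x) + (e^2 - a) * ((1 / real N) * (- (v^2) * (\<Sum>j\<in>{1..N}. E j x)))"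
      unfolding s ex[OF i] a_def ..
    also have "\<dots> = - (v^2) * (a * E i x + b * (\<Sum>j\<in>{1..N}. E j x))"
    proof -
      have "(e^2 - a) * ((1 / real N) * X) = b * X" for X by (simp add: b_def)
      then show ?thesis by (simp only:) (simp add: algebra_simps)
    qed
    finally show ?thesis .
  qed
  have wlim: "(w i \<longlongrightarrow> 0) at_infinity" if "i \<in> {1..N}" for i
  proof -
    have "((\<lambda>x. ln ((cmod (\<phi> i x))^2) - ln (v^2)) \<longlongrightarrow> ln (v^2) - ln (v^2)) at_infinity"
      using pos by (intro tendsto_intros lim that) auto
    then show ?thesis by (simp add: w_def[abs_def])
  qed
  have "eventually (\<lambda>x. \<forall>i\<in>{1..N}. \<bar>w i x\<bar> < \<eta> \<and> cmod (\<phi> i x) > 0) at_infinity"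
  proof (intro eventually_ball_finite ballI eventually_conj)
    fix i assume i: "i \<in> {1..N}"
    show "eventually (\<lambda>x. \<bar>w i x\<bar> < \<eta>) at_infinity"
      using tendstoD[OF wlim[OF i] \<eta>(1)] by (simp add: dist_real_def)
    show "eventually (\<lambda>x. cmod (\<phi> i x) > 0) at_infinity"
      by (rule order_tendstoD(1)[OF lim[OF i] pos(4)])
  qed simp
  then obtain R0 where R0: "\<And>x i. norm x \<ge> R0 \<Longrightarrow> i \<in> {1..N} \<Longrightarrow> \<bar>w i x\<bar> < \<eta> \<and> cmod (\<phi> i x) > 0"
    unfolding eventually_at_infinity by blast
  have wsmall: "\<bar>w i x\<bar> \<le> \<eta>" and nz: "\<phi> i x \<noteq> 0" if "norm x \<ge> R0" "i \<in> {1..N}" for i x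
    using R0[OF that] by auto
  define S where "S = {x :: real^2. norm x > R0}"
  have S: "open S" unfolding S_def by (intro open_Collect_less continuous_intros)
  have Cln: "C2_on S (\<lambda>x. ln ((cmod (\<phi> i x))^2))" if "i \<in> {1..N}" for i
    by (rule C2_on_ln_cmod_sq[OF S]) (use phi[OF that] nz that in \<open>auto simp: smooth_on_def S_def\<close>)
  have Cw: "C2_on S (w i)" if "i \<in> {1..N}" for i
    unfolding w_def by (rule C2_on_diff[OF S Cln[OF that] C2_on_const])
  have Lw: "laplacian (w i) x = - 2 * F i x" if i: "i \<in> {1..N}" and x: "x \<in> S" for i x
  proof -
    have "laplacian (w i) x = laplacian (\<lambda>x. ln ((cmod (\<phi> i x))^2)) x"
      unfolding w_def laplacian_diff[OF S Cln[OF i] C2_on_const x] laplacian_const by simp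
    also have "\<dots> = - 2 * F i x"
      unfolding F_def
    proof (rule laplacian_ln_cmod_sq[OF phi[OF i] B[OF i]])
      show "\<phi> i x \<noteq> 0" using nz[of x i] i x by (simp add: S_def)
    qed (use sol i in \<open>auto simp: vortex_solution_on_def\<close>)
    finally show ?thesis .
  qed
  define H where "H x = (\<Sum>i\<in>{1..N}. (w i x)^2)" for x
  have Cw2: "C2_on S (\<lambda>x. (w i x)^2)" if "i \<in> {1..N}" for i by (rule C2_on_square[OF S Cw[OF that]])
  have CH: "C2_on {x. norm x > R0} H" unfolding H_def S_def[symmetric] by (rule C2_on_sum[OF S Cw2])
  have Lw2: "laplacian (\<lambda>x. (w i x)^2) x \<ge> 2 * w i x * laplacian (w i) x" if i: "i \<in> {1..N}" and x: "x \<in> S" for i x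
  proof -
    have "laplacian (\<lambda>x. (w i x)^2) x = 2 * (\<Sum>l\<in>UNIV. (partial_deriv l (w i) x)^2) + 2 * w i x * laplacian (w i) x"
      by (rule laplacian_compose[OF S Cw[OF i], of "\<lambda>t. t^2" "\<lambda>t. 2 * t" "\<lambda>_. 2"])
        (use x in \<open>auto intro!: derivative_eq_intros\<close>)
    then show ?thesis by (simp add: sum_nonneg)
  qed
  have LH: "(v^2 * l) * H x \<le> laplacian H x" if "norm x > R0" for x
  proof -
    have x: "x \<in> S" using that by (simp add: S_def)
    have nzx: "\<phi> j x \<noteq> 0" if "j \<in> {1..N}" for j using nz[of x j] that x by (simp add: S_def)
    have "v^2 * (l * H x) \<le> v^2 * (\<Sum>i\<in>{1..N}. w i x * (a * (exp (w i x) - 1) + b * (\<Sum>j\<in>{1..N}. exp (w j x) - 1)))"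
      unfolding H_def by (intro mult_left_mono coercive) (use wsmall x in \<open>auto simp: S_def\<close>)
    also have "\<dots> = (\<Sum>i\<in>{1..N}. 2 * w i x * laplacian (w i) x)"
      unfolding sum_distrib_left[where r = "v^2"]
    proof (rule sum.cong[OF refl])
      fix i assume i: "i \<in> {1..N}"
      have "2 * w i x * laplacian (w i) x = - w i x * (4 * F i x)" using Lw[OF i x] by simp
      also have "\<dots> = v^2 * (w i x * (a * E i x + b * (\<Sum>j\<in>{1..N}. E j x)))"
      proof -
        have "4 * F i x = - (v^2) * (a * E i x + b * (\<Sum>j\<in>{1..N}. E j x))" by (rule eqF[OF i nzx])
        then show ?thesis by (simp only:) simp
      qed
      finally show "v^2 * (w i x * (a * (exp (w i x) - 1) + b * (\<Sum>j\<in>{1..N}. exp (w j x) - 1))) = 2 * w i x * laplacian (w i) x"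
        unfolding E_def by (rule sym)
    qed
    also have "\<dots> \<le> (\<Sum>i\<in>{1..N}. laplacian (\<lambda>x. (w i x)^2) x)"
      by (intro sum_mono Lw2 x)
    also have "\<dots> = laplacian H x"
      unfolding H_def by (rule laplacian_sum[OF S Cw2 x, symmetric])
    finally show ?thesis by simp
  qed
  have Hlim: "(H \<longlongrightarrow> 0) at_infinity"
  proof -
    have "((\<lambda>x. \<Sum>i\<in>{1..N}. (w i x)^2) \<longlongrightarrow> (\<Sum>i\<in>{1..N}. 0^2)) at_infinity"
      by (intro tendsto_intros wlim)
    then show ?thesis by (simp add: H_def[abs_def])
  qed
  obtain C R where C: "C \<ge> 0" "R > R0" "\<And>x. norm x \<ge> R \<Longrightarrow> H x \<le> C / (1 + x \<bullet> x)^4"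
    using decay_of_subsolution[OF CH _ LH Hlim] l pos by (metis mult_pos_pos zero_less_power)
  \<comment> \<open>The fourth power in the barrier for \<open>H\<close> was chosen for this square:
    a root of the bound on \<open>H\<close> bounds each \<open>w i\<close>.\<close>
  define q where "q x = (1 + x \<bullet> x)^2" for x :: "real^2"
  have q: "q x > 0" for x unfolding q_def by (rule zero_less_power) (simp add: add_pos_nonneg)
  have wd: "\<bar>w i x\<bar> \<le> sqrt C / q x" if i: "i \<in> {1..N}" and x: "norm x \<ge> R" for i x
  proof -
    have "(w i x)^2 \<le> H x" unfolding H_def by (rule member_le_sum[OF i]) auto
    also have "\<dots> \<le> C / (1 + x \<bullet> x)^4" by (rule C(3)[OF x])
    also have "\<dots> = (sqrt C / q x)^2" using C(1) by (simp add: power_divide q_def flip: power_mult)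
    finally have "sqrt ((w i x)^2) \<le> sqrt ((sqrt C / q x)^2)" by (rule real_sqrt_le_mono)
    moreover have "sqrt C / q x \<ge> 0" using C(1) q[of x] by simp
    ultimately show ?thesis by simp
  qed
  \<comment> \<open>For |w| \<le> 1 the quadratic error is at most |w|, hence |exp w - 1| \<le> 2
    |w|.\<close>
  have Ed: "\<bar>E i x\<bar> \<le> 2 * (sqrt C / q x)" if i: "i \<in> {1..N}" and x: "norm x \<ge> R" for i x
  proof -
    have w1: "\<bar>w i x\<bar> \<le> 1" using wsmall[OF _ i, of x] x C(2) \<eta>(2) by linarith
    have "\<bar>E i x - w i x\<bar> \<le> (w i x)^2" unfolding E_def by (rule abs_exp_minus_id_le[OF w1])
    also have "\<dots> = \<bar>w i x\<bar> * \<bar>w i x\<bar>" by (simp add: power2_eq_square)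
    also have "\<dots> \<le> 1 * \<bar>w i x\<bar>" using w1 by (intro mult_right_mono) auto
    finally show ?thesis using wd[OF i x] by linarith
  qed
  define C' where "C' = sqrt C + v^2 * (a * (2 * sqrt C) + \<bar>b\<bar> * (real N * (2 * sqrt C)))"
  have C': "sqrt C \<le> C'" "v^2 * (a * (2 * sqrt C) + \<bar>b\<bar> * (real N * (2 * sqrt C))) \<le> C'"
    using a C(1) by (auto simp: C'_def)
  have Fd: "\<bar>F i x\<bar> \<le> C' / q x" if i: "i \<in> {1..N}" and x: "norm x \<ge> R" for i x
  proof -
    define t where "t = 2 * (sqrt C / q x)"
    have nzx: "\<phi> j x \<noteq> 0" if "j \<in> {1..N}" for j using nz[of x j] that x C(2) by simp
    have "\<bar>\<Sum>j\<in>{1..N}. E j x\<bar> \<le> (\<Sum>j\<in>{1..N}. t)"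
      unfolding t_def by (rule order_trans[OF sum_abs], rule sum_mono) (rule Ed[OF _ x])
    then have "\<bar>b * (\<Sum>j\<in>{1..N}. E j x)\<bar> \<le> \<bar>b\<bar> * (real N * t)"
      unfolding abs_mult by (intro mult_left_mono) auto
    moreover have "\<bar>a * E i x\<bar> \<le> a * t"
      unfolding abs_mult using Ed[OF i x, folded t_def] a by (simp add: mult_left_mono)
    ultimately have "\<bar>a * E i x + b * (\<Sum>j\<in>{1..N}. E j x)\<bar> \<le> a * t + \<bar>b\<bar> * (real N * t)" by linarith
    then have "v^2 * \<bar>a * E i x + b * (\<Sum>j\<in>{1..N}. E j x)\<bar> \<le> v^2 * (a * t + \<bar>b\<bar> * (real N * t))"
      by (intro mult_left_mono) auto
    moreover have "\<bar>4 * F i x\<bar> = v^2 * \<bar>a * E i x + b * (\<Sum>j\<in>{1..N}. E j x)\<bar>"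
    proof -
      have "4 * F i x = - (v^2) * (a * E i x + b * (\<Sum>j\<in>{1..N}. E j x))" by (rule eqF[OF i nzx])
      then show ?thesis by (simp only: abs_mult) simp
    qed
    ultimately have "\<bar>F i x\<bar> \<le> v^2 * (a * t + \<bar>b\<bar> * (real N * t))" by linarith
    also have "\<dots> = (v^2 * (a * (2 * sqrt C) + \<bar>b\<bar> * (real N * (2 * sqrt C)))) / q x"
      by (simp add: t_def add_divide_distrib algebra_simps)
    also have "\<dots> \<le> C' / q x" using C'(2) less_imp_le[OF q[of x]] by (rule divide_right_mono)
    finally show ?thesis .
  qed
  show thesis
  proof (rule that[of R C'])
    show "\<phi> i x \<noteq> 0" if "i \<in> {1..N}" "norm x \<ge> R" for i x using nz[of x i] that C(2) by simp
    show "\<bar>ln ((cmod (\<phi> i x))^2) - ln (v^2)\<bar> \<le> C' / (1 + x \<bullet> x)^2" if "i \<in> {1..N}" "norm x \<ge> R" for i x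
      using order_trans[OF wd[OF that] divide_right_mono[OF C'(1) less_imp_le[OF q]]] by (simp add: w_def q_def)
    show "\<bar>field_strength (B i) x\<bar> \<le> C' / (1 + x \<bullet> x)^2" if "i \<in> {1..N}" "norm x \<ge> R" for i x
      using Fd[OF that] by (simp add: F_def q_def)
  qed
qed

lemma has_bochner_integral_bump_shift:
  "has_bochner_integral lborel (\<lambda>x. bump (x - q)) (4 * pi)"
proof -
  have b: "bump \<in> borel_measurable borel"
    by (rule borel_measurable_continuous_onI) (intro continuous_intros)
  have "integrable lborel bump" "(LINT x|lborel. bump x) = 4 * pi"
    using has_bochner_integral_quadratic_bump unfolding bump_def[abs_def]
    by (auto simp: has_bochner_integral_iff)
  then show ?thesis
    using lborel_integral_shift[OF b, of "- q"] lborel_integrable_shift[OF b, of "- q"]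
    by (simp add: has_bochner_integral_iff)
qed

theorem vortex_plane_flux:
  fixes N :: nat and e g v :: real
    and \<phi> :: "nat \<Rightarrow> real^2 \<Rightarrow> complex" and B :: "nat \<Rightarrow> 2 \<Rightarrow> real^2 \<Rightarrow> real"
  assumes pos: "N > 0" "e > 0" "g > 0" "v > 0"
    and phi: "\<And>i. i \<in> {1..N} \<Longrightarrow> smooth (\<phi> i)"
    and B: "\<And>i l. i \<in> {1..N} \<Longrightarrow> smooth (B i l)"
    and sol: "vortex_solution_on UNIV N e g v \<phi> B"
    and lim: "\<And>i. i \<in> {1..N} \<Longrightarrow> ((\<lambda>x. cmod (\<phi> i x)) \<longlongrightarrow> v) at_infinity"
    and i: "i \<in> {1..N}" and zeros: "has_zeros_counted (\<phi> i) UNIV n"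
  shows "integrable lborel (field_strength (B i))"
    and "(LINT x|lborel. field_strength (B i) x) = 2 * pi * real n"
proof -
  define F where "F = field_strength (B i)"
  have cF: "continuous_on UNIV F" unfolding F_def by (rule field_strength_continuous[OF B[OF i]])
  define Z where "Z = {x. \<phi> i x = 0}"
  obtain m where Z: "finite Z" "\<And>p. p \<in> Z \<Longrightarrow> zero_of_multiplicity (\<phi> i) p (m p)" "(\<Sum>p\<in>Z. m p) = n"
    using zeros unfolding has_zeros_counted_def Z_def by auto
  obtain C R where nz: "\<And>x. norm x \<ge> R \<Longrightarrow> \<phi> i x \<noteq> 0"
    and wd: "\<And>x. norm x \<ge> R \<Longrightarrow> \<bar>ln ((cmod (\<phi> i x))^2) - ln (v^2)\<bar> \<le> C / (1 + x \<bullet> x)^2"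
    and Fd: "\<And>x. norm x \<ge> R \<Longrightarrow> \<bar>F x\<bar> \<le> C / (1 + x \<bullet> x)^2"
    using vortex_plane_decay[OF pos phi B sol lim] i unfolding F_def by metis
  obtain C1 where C1: "\<And>x. \<bar>F x\<bar> \<le> C1 / (1 + x \<bullet> x)^2" using quartic_decay_global[OF cF Fd] by blast
  have iF: "integrable lborel F" by (rule integrable_of_quartic_decay[OF cF C1])
  have lap: "laplacian (\<lambda>x. ln ((cmod (\<phi> i x))^2)) x = - 2 * F x" if "\<phi> i x \<noteq> 0" for x
    unfolding F_def by (rule laplacian_ln_cmod_sq[OF phi[OF i] B[OF i] _ that])
      (use sol i in \<open>auto simp: vortex_solution_on_def\<close>)
  obtain h where h: "C2_on UNIV h"
    and hout: "\<And>x. \<phi> i x \<noteq> 0 \<Longrightarrow> h x = ln ((cmod (\<phi> i x))^2) - (\<Sum>q\<in>Z \<inter> ball x 1. m q * trunc_log (x - q))"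
    and hlap: "\<And>x. laplacian h x = - 2 * F x + (\<Sum>q\<in>Z \<inter> ball x 1. m q * bump (x - q))"
    using regularized_log[OF phi[OF i] cF lap zero_of_multiplicity_log_singularity[OF Z(2)]] unfolding Z_def by blast
  have hlap': "laplacian h x = - 2 * F x + (\<Sum>q\<in>Z. m q * bump (x - q))" for x
    unfolding hlap by (simp, rule sum.mono_neutral_left[OF Z(1)]) (auto simp: bump_eq_0 dist_norm not_less)
  \<comment> \<open>The constant leaves the Laplacian alone and makes the function tend to zero at
    infinity.\<close>
  define k where "k x = h x - ln (v^2)" for x
  have Ck: "C2_on UNIV k" unfolding k_def by (rule C2_on_diff[OF open_UNIV h C2_on_const])
  have Lk: "laplacian k = (\<lambda>x. - 2 * F x + (\<Sum>q\<in>Z. m q * bump (x - q)))"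
    unfolding k_def laplacian_diff[OF open_UNIV h C2_on_const UNIV_I, THEN ext] laplacian_const hlap' by simp
  obtain RZ where RZ: "\<And>q. q \<in> Z \<Longrightarrow> norm q \<le> RZ"
    using finite_imp_bounded[OF Z(1)] unfolding bounded_iff by blast
  \<comment> \<open>Beyond \<open>RZ + 1\<close> every zero is at distance at least 1, so no
    truncated logarithm contributes and \<open>k\<close> is ln |phi|^2 - ln v^2 there.\<close>
  have kd: "\<bar>k x\<bar> \<le> C / (1 + x \<bullet> x)^2" if x: "norm x \<ge> max R (RZ + 1)" for x
  proof -
    have "norm (x - q) \<ge> 1" if "q \<in> Z" for q
      using RZ[OF that] x norm_triangle_ineq2[of x q] by simp
    then have "Z \<inter> ball x 1 = {}" by (force simp: dist_norm)
    then show ?thesis using hout[OF nz] wd[of x] x by (simp add: k_def)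
  qed
  obtain C2 where C2: "\<And>x. \<bar>k x\<bar> \<le> C2 / (1 + x \<bullet> x)^2"
    using quartic_decay_global[OF C2_on_continuous(1)[OF Ck] kd] by blast
  have hb: "has_bochner_integral lborel (\<lambda>x. \<Sum>q\<in>Z. m q * bump (x - q)) (\<Sum>q\<in>Z. m q * (4 * pi))"
    by (intro has_bochner_integral_sum has_bochner_integral_mult_right has_bochner_integral_bump_shift)
  have hk: "has_bochner_integral lborel (laplacian k) (- 2 * (LINT x|lborel. F x) + (\<Sum>q\<in>Z. m q * (4 * pi)))"
    unfolding Lk by (intro has_bochner_integral_add hb has_bochner_integral_mult_right has_bochner_integral_integrable iF)
  then have "integrable lborel (laplacian k)" by (simp add: has_bochner_integral_iff)
  from integral_laplacian_decay[OF Ck C2 this]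
  have "- 2 * (LINT x|lborel. F x) + (\<Sum>q\<in>Z. m q * (4 * pi)) = 0"
    using hk by (simp add: has_bochner_integral_iff)
  moreover have "(\<Sum>q\<in>Z. m q * (4 * pi)) = real n * (4 * pi)"
    unfolding Z(3)[symmetric] by (simp add: sum_distrib_right)
  ultimately show "(LINT x|lborel. field_strength (B i) x) = 2 * pi * real n"
    unfolding F_def by simp
  show "integrable lborel (field_strength (B i))" using iF by (simp add: F_def)
qed

subsection \<open>Vortices on the torus\<close>

lemma periodic_int_multiple:
  fixes f :: "real^2 \<Rightarrow> 'b"
  assumes "\<And>x. f (x + \<tau>) = f x"
  shows "f (x + of_int j *\<^sub>R \<tau>) = f x"
proof -
  have "f (x + real k *\<^sub>R \<tau>) = f x" for k :: nat and x
  proof (induction k arbitrary: x)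
    case (Suc k)
    have "f (x + real (Suc k) *\<^sub>R \<tau>) = f ((x + real k *\<^sub>R \<tau>) + \<tau>)" by (simp add: algebra_simps)
    then show ?case using assms Suc by simp
  qed simp
  note n = this
  show ?thesis
  proof (cases j)
    case (nonneg k) then show ?thesis using n[of x k] by simp
  next
    case (neg k)
    have "(of_int j :: real) = - real (Suc k)" using neg by simp
    then have e: "(x + of_int j *\<^sub>R \<tau>) + real (Suc k) *\<^sub>R \<tau> = x"
      by (simp only: add.assoc scaleR_add_left[symmetric]) simp
    show ?thesis using n[of "x + of_int j *\<^sub>R \<tau>" "Suc k"] unfolding e by (rule sym)
  qed
qed

locale period_lattice =
  fixes a \<tau>1 \<tau>2 :: "real^2"
  assumes distinct: "\<tau>1 \<noteq> \<tau>2" and indep: "independent {\<tau>1, \<tau>2}"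
begin

definition lat_det :: real
  where "lat_det = \<tau>1 $ 1 * \<tau>2 $ 2 - \<tau>1 $ 2 * \<tau>2 $ 1"

text \<open>Cramer's rule for the coefficient of \<open>\<tau>1\<close>; \<open>coord2\<close> is
  its counterpart for \<open>\<tau>2\<close>.\<close>

definition coord1 :: "real^2 \<Rightarrow> real"
  where "coord1 x = (x $ 1 * \<tau>2 $ 2 - x $ 2 * \<tau>2 $ 1) / lat_det"

definition coord2 :: "real^2 \<Rightarrow> real"
  where "coord2 x = (\<tau>1 $ 1 * x $ 2 - \<tau>1 $ 2 * x $ 1) / lat_det"

definition lat :: "int \<times> int \<Rightarrow> real^2"
  where "lat jk = of_int (fst jk) *\<^sub>R \<tau>1 + of_int (snd jk) *\<^sub>R \<tau>2"

text \<open>The lattice translate of the cell in which \<open>x\<close> lies. Floors match the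
  half-open cell, so boundary points are assigned uniquely.\<close>

definition cell_index :: "real^2 \<Rightarrow> int \<times> int"
  where "cell_index x = (\<lfloor>coord1 (x - a)\<rfloor>, \<lfloor>coord2 (x - a)\<rfloor>)"

abbreviation cell :: "(real^2) set"
  where "cell \<equiv> period_cell a \<tau>1 \<tau>2"

lemma lat_det_nonzero: "lat_det \<noteq> 0"
proof
  assume d: "lat_det = 0"
  have dep: "s = 0 \<and> t = 0" if "s *\<^sub>R \<tau>1 + t *\<^sub>R \<tau>2 = 0" for s t
  proof -
    have "\<not> dependent {\<tau>1, \<tau>2}" using indep by simp
    then have "\<forall>u. (\<Sum>x\<in>{\<tau>1, \<tau>2}. u x *\<^sub>R x) = 0 \<longrightarrow> (\<forall>x\<in>{\<tau>1, \<tau>2}. u x = 0)"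
      using dependent_finite[of "{\<tau>1, \<tau>2}"] by auto
    from this[rule_format, of "\<lambda>x. if x = \<tau>1 then s else t" \<tau>1]
      this[rule_format, of "\<lambda>x. if x = \<tau>1 then s else t" \<tau>2]
    show ?thesis using that distinct by auto
  qed
  \<comment> \<open>With vanishing determinant these are linear relations, so independence forces
    every component of both vectors to be zero.\<close>
  have "(\<tau>2 $ 2) *\<^sub>R \<tau>1 + (- \<tau>1 $ 2) *\<^sub>R \<tau>2 = 0" "(\<tau>2 $ 1) *\<^sub>R \<tau>1 + (- \<tau>1 $ 1) *\<^sub>R \<tau>2 = 0"
    using d by (auto simp: vec_eq_iff forall_2 lat_det_def algebra_simps)
  from dep[OF this(1)] dep[OF this(2)] have "\<tau>1 = 0" "\<tau>2 = 0" by (simp_all add: vec_eq_iff forall_2)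
  with distinct show False by simp
qed

lemma coord_decomp: "x = coord1 x *\<^sub>R \<tau>1 + coord2 x *\<^sub>R \<tau>2"
proof -
  have "lat_det * (x $ k) = (x $ 1 * \<tau>2 $ 2 - x $ 2 * \<tau>2 $ 1) * \<tau>1 $ k + (\<tau>1 $ 1 * x $ 2 - \<tau>1 $ 2 * x $ 1) * \<tau>2 $ k" for k
    using exhaust_2[of k] by (auto simp: lat_det_def algebra_simps)
  then have "x $ k = coord1 x * \<tau>1 $ k + coord2 x * \<tau>2 $ k" for k
    unfolding coord1_def coord2_def times_divide_eq_left add_divide_distrib[symmetric]
    using lat_det_nonzero by (metis nonzero_mult_div_cancel_left)
  then show ?thesis by (simp add: vec_eq_iff)
qed

lemma coord_comb:
  "coord1 (s *\<^sub>R \<tau>1 + t *\<^sub>R \<tau>2) = s" "coord2 (s *\<^sub>R \<tau>1 + t *\<^sub>R \<tau>2) = t"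
proof -
  have "(s * \<tau>1 $ 1 + t * \<tau>2 $ 1) * \<tau>2 $ 2 - (s * \<tau>1 $ 2 + t * \<tau>2 $ 2) * \<tau>2 $ 1 = s * lat_det"
    "\<tau>1 $ 1 * (s * \<tau>1 $ 2 + t * \<tau>2 $ 2) - \<tau>1 $ 2 * (s * \<tau>1 $ 1 + t * \<tau>2 $ 1) = t * lat_det"
    by (simp_all add: lat_det_def algebra_simps)
  then show "coord1 (s *\<^sub>R \<tau>1 + t *\<^sub>R \<tau>2) = s" "coord2 (s *\<^sub>R \<tau>1 + t *\<^sub>R \<tau>2) = t"
    using lat_det_nonzero by (simp_all add: coord1_def coord2_def)
qed

lemma coord_diff: "coord1 (x - y) = coord1 x - coord1 y" "coord2 (x - y) = coord2 x - coord2 y"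
  by (simp_all add: coord1_def coord2_def diff_divide_distrib[symmetric] algebra_simps)

lemma cell_iff: "x \<in> cell \<longleftrightarrow> 0 \<le> coord1 (x - a) \<and> coord1 (x - a) < 1 \<and> 0 \<le> coord2 (x - a) \<and> coord2 (x - a) < 1"
proof
  assume "x \<in> cell"
  then obtain s t where "x = a + s *\<^sub>R \<tau>1 + t *\<^sub>R \<tau>2" "0 \<le> s" "s < 1" "0 \<le> t" "t < 1"
    unfolding period_cell_def by blast
  moreover from this have "x - a = s *\<^sub>R \<tau>1 + t *\<^sub>R \<tau>2" by simp
  ultimately show "0 \<le> coord1 (x - a) \<and> coord1 (x - a) < 1 \<and> 0 \<le> coord2 (x - a) \<and> coord2 (x - a) < 1"
    using coord_comb[of s t] by simp
next
  assume c: "0 \<le> coord1 (x - a) \<and> coord1 (x - a) < 1 \<and> 0 \<le> coord2 (x - a) \<and> coord2 (x - a) < 1"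
  have "x = a + coord1 (x - a) *\<^sub>R \<tau>1 + coord2 (x - a) *\<^sub>R \<tau>2"
    using coord_decomp[of "x - a"] by (simp add: algebra_simps)
  with c show "x \<in> cell" unfolding period_cell_def by blast
qed

text \<open>The tiling property: exactly one lattice translate brings a given point into the
  cell.\<close>

lemma diff_lat_in_cell_iff: "x - lat jk \<in> cell \<longleftrightarrow> cell_index x = jk"
proof -
  have "coord1 (x - lat jk - a) = coord1 (x - a) - of_int (fst jk)"
    "coord2 (x - lat jk - a) = coord2 (x - a) - of_int (snd jk)"
    by (simp_all add: coord_diff lat_def coord_comb)
  then show ?thesis
    unfolding cell_iff cell_index_def prod_eq_iff fst_conv snd_conv floor_eq_iff by auto
qed

lemma lat_uminus: "lat (- jk) = - lat jk"
  by (simp add: lat_def)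

lemma lat_zero: "lat 0 = 0"
  by (simp add: lat_def)

lemma add_lat_in_cell_iff: "x + lat jk \<in> cell \<longleftrightarrow> cell_index x = - jk"
  using diff_lat_in_cell_iff[of x "- jk"] by (simp add: lat_uminus)

lemma cell_index_add_lat: "x \<in> cell \<Longrightarrow> cell_index (x + lat jk) = jk"
  by (simp add: diff_lat_in_cell_iff[symmetric])

lemma cell_representative: "x - lat (cell_index x) \<in> cell"
  by (simp add: diff_lat_in_cell_iff)

lemma continuous_on_coord [continuous_intros]:
  assumes "continuous_on S f"
  shows "continuous_on S (\<lambda>x. coord1 (f x))" "continuous_on S (\<lambda>x. coord2 (f x))"
  unfolding coord1_def coord2_def using lat_det_nonzero by (auto intro!: continuous_intros assms)

lemma cell_borel: "cell \<in> sets borel"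
proof -
  have "cell = {x. 0 \<le> coord1 (x - a)} \<inter> {x. coord1 (x - a) < 1} \<inter> {x. 0 \<le> coord2 (x - a)} \<inter> {x. coord2 (x - a) < 1}"
    using cell_iff by auto
  also have "\<dots> \<in> sets borel"
    by (intro sets.Int borel_closed[OF closed_Collect_le] borel_open[OF open_Collect_less] continuous_intros)
  finally show ?thesis .
qed

definition cell_radius :: real
  where "cell_radius = norm \<tau>1 + norm \<tau>2"

lemma cell_subset: "cell \<subseteq> cball a cell_radius"
proof
  fix x assume "x \<in> cell"
  then obtain s t where x: "x = a + s *\<^sub>R \<tau>1 + t *\<^sub>R \<tau>2" "0 \<le> s" "s < 1" "0 \<le> t" "t < 1"
    unfolding period_cell_def by blast
  have "norm (s *\<^sub>R \<tau>1 + t *\<^sub>R \<tau>2) \<le> norm (s *\<^sub>R \<tau>1) + norm (t *\<^sub>R \<tau>2)" by (rule norm_triangle_ineq)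
  also have "\<dots> \<le> norm \<tau>1 + norm \<tau>2"
    using x by (intro add_mono) (auto intro: mult_left_le_one_le)
  finally have "norm (x - a) \<le> cell_radius" by (simp add: x(1) cell_radius_def)
  then show "x \<in> cball a cell_radius" by (simp add: dist_norm norm_minus_commute)
qed

lemma emeasure_cell: "emeasure lborel cell < \<infinity>"
  using emeasure_mono[OF cell_subset, of lborel] emeasure_lborel_cball_finite[of a cell_radius]
  by (simp add: order.strict_trans1)

lemma set_integrable_cell:
  fixes f :: "real^2 \<Rightarrow> real"
  assumes "continuous_on UNIV f"
  shows "set_integrable lborel cell f"
proof (rule set_integrable_subset)
  show "set_integrable lborel (cball a cell_radius) f"
    unfolding set_integrable_def
    by (intro borel_integrable_compact continuous_on_subset[OF assms]) auto
qed (use cell_borel cell_subset in auto)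

lemma finite_cell_index: "finite (cell_index ` cball c R)"
proof -
  have "compact ((\<lambda>x. coord1 (x - a)) ` cball c R)" "compact ((\<lambda>x. coord2 (x - a)) ` cball c R)"
    by (intro compact_continuous_image continuous_intros compact_cball)+
  from this[THEN compact_imp_bounded] obtain M1 M2
    where M: "\<And>x. x \<in> cball c R \<Longrightarrow> \<bar>coord1 (x - a)\<bar> \<le> M1" "\<And>x. x \<in> cball c R \<Longrightarrow> \<bar>coord2 (x - a)\<bar> \<le> M2"
    unfolding bounded_iff by fastforce
  have "cell_index x \<in> {\<lfloor>- M1\<rfloor>..\<lfloor>M1\<rfloor>} \<times> {\<lfloor>- M2\<rfloor>..\<lfloor>M2\<rfloor>}" if "x \<in> cball c R" for x
  proof -
    have "- M1 \<le> coord1 (x - a)" "coord1 (x - a) \<le> M1" "- M2 \<le> coord2 (x - a)" "coord2 (x - a) \<le> M2"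
      using M[OF that] by linarith+
    then show ?thesis unfolding cell_index_def by (auto intro: floor_mono)
  qed
  then have "cell_index ` cball c R \<subseteq> {\<lfloor>- M1\<rfloor>..\<lfloor>M1\<rfloor>} \<times> {\<lfloor>- M2\<rfloor>..\<lfloor>M2\<rfloor>}" by blast
  then show ?thesis by (rule finite_subset) simp
qed

lemma periodic_lat:
  fixes f :: "real^2 \<Rightarrow> 'b"
  assumes "\<And>x. f (x + \<tau>1) = f x" "\<And>x. f (x + \<tau>2) = f x"
  shows "f (x + lat jk) = f x"
  unfolding lat_def add.assoc[symmetric]
  using periodic_int_multiple[of f \<tau>1, OF assms(1)] periodic_int_multiple[of f \<tau>2, OF assms(2)] by simp

text \<open>\<open>f\<close> is cut along the translates of the cell and each piece is moved back by
  translation invariance. \<open>J\<close> lists the finitely many cells that may meet the support,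
  so no infinite sum occurs.\<close>

lemma integral_unfold_cells:
  fixes f :: "real^2 \<Rightarrow> real"
  assumes f: "integrable lborel f" and J: "finite J" "\<And>x. f x \<noteq> 0 \<Longrightarrow> cell_index x \<in> J"
  shows "(LINT x|lborel. f x) = (LINT x:cell|lborel. (\<Sum>jk\<in>J. f (x + lat jk)))"
proof -
  have fm: "f \<in> borel_measurable borel" using borel_measurable_integrable[OF f] by simp
  have eq: "f x = (\<Sum>jk\<in>J. indicator cell (x - lat jk) * f x)" for x
  proof -
    have "(\<Sum>jk\<in>J. indicator cell (x - lat jk) * f x) = (\<Sum>jk\<in>J. if cell_index x = jk then f x else 0)"
      by (intro sum.cong refl) (auto simp: indicator_def diff_lat_in_cell_iff)
    also have "\<dots> = f x" using J by (auto simp: sum.delta)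
    finally show ?thesis by simp
  qed
  define g where "g jk x = indicator cell (x - lat jk) * f x" for jk x
  have im: "(\<lambda>x. indicator cell (x - lat jk) :: real) \<in> borel_measurable borel" for jk
    using cell_borel by measurable
  have g: "integrable lborel (g jk)" for jk
    unfolding g_def
  proof (rule Bochner_Integration.integrable_bound[OF f])
    show "(\<lambda>x. indicator cell (x - lat jk) * f x) \<in> borel_measurable lborel"
      using im[of jk] fm by simp
  qed (auto simp: indicator_def)
  have gm: "g jk \<in> borel_measurable borel" for jk using borel_measurable_integrable[OF g] by simp
  have gs: "g jk (x + lat jk) = indicator cell x * f (x + lat jk)" for jk x by (simp add: g_def)
  have "(LINT x|lborel. f x) = (LINT x|lborel. (\<Sum>jk\<in>J. g jk x))"
    unfolding g_def by (subst eq) simp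
  also have "\<dots> = (\<Sum>jk\<in>J. LINT x|lborel. g jk x)" by (rule Bochner_Integration.integral_sum[OF g])
  also have "\<dots> = (\<Sum>jk\<in>J. LINT x|lborel. g jk (x + lat jk))"
    by (simp only: lborel_integral_shift[OF gm])
  also have "\<dots> = (LINT x|lborel. (\<Sum>jk\<in>J. g jk (x + lat jk)))"
    by (rule Bochner_Integration.integral_sum[symmetric]) (simp add: lborel_integrable_shift[OF gm] g)
  also have "\<dots> = (LINT x:cell|lborel. (\<Sum>jk\<in>J. f (x + lat jk)))"
    unfolding set_lebesgue_integral_def gs by (simp add: sum_distrib_left)
  finally show ?thesis .
qed

text \<open>The shifted cell is another fundamental domain. Unfolding \<open>F\<close> restricted to
  it over the original cell meets each orbit exactly once.\<close>

lemma cell_integral_shift: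
  fixes F :: "real^2 \<Rightarrow> real"
  assumes F: "continuous_on UNIV F" and per: "\<And>x jk. F (x + lat jk) = F x"
  shows "(LINT x:cell|lborel. F (x + y)) = (LINT x:cell|lborel. F x)"
proof -
  define f where "f x = indicator cell (x - y) * F x" for x
  define J where "J = cell_index ` cball (a + y) cell_radius"
  have fs: "f (x + y) = indicator cell x *\<^sub>R F (x + y)" for x by (simp add: f_def)
  have fm: "f \<in> borel_measurable borel"
    unfolding f_def using cell_borel borel_measurable_continuous_onI[OF F] by measurable
  have "continuous_on UNIV (\<lambda>x. F (x + y))"
    by (rule continuous_on_compose2[OF F]) (auto intro!: continuous_intros)
  from set_integrable_cell[OF this] have "integrable lborel f"
    unfolding set_integrable_def fs[symmetric] lborel_integrable_shift[OF fm] .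
  moreover have inJ: "cell_index x \<in> J" if "x - y \<in> cell" for x
    using that cell_subset by (force simp: J_def dist_norm algebra_simps)
  then have "\<And>x. f x \<noteq> 0 \<Longrightarrow> cell_index x \<in> J" by (auto simp: f_def indicator_def split: if_splits)
  moreover have "finite J" unfolding J_def by (rule finite_cell_index)
  ultimately have "(LINT x|lborel. f x) = (LINT x:cell|lborel. (\<Sum>jk\<in>J. f (x + lat jk)))"
    by (intro integral_unfold_cells)
  also have "\<dots> = (LINT x:cell|lborel. F x)"
  proof (rule set_lebesgue_integral_cong)
    show "\<forall>x. x \<in> cell \<longrightarrow> (\<Sum>jk\<in>J. f (x + lat jk)) = F x"
    proof (intro allI impI)
      fix x assume x: "x \<in> cell"
      \<comment> \<open>Only one translate of \<open>x\<close> lies in the shifted cell, so a single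
        term survives, and periodicity turns it into \<open>F x\<close>.\<close>
      have "(\<Sum>jk\<in>J. f (x + lat jk)) = (\<Sum>jk\<in>J. if jk = - cell_index (x - y) then F x else 0)"
      proof (intro sum.cong refl)
        fix jk
        have "x + lat jk - y \<in> cell \<longleftrightarrow> jk = - cell_index (x - y)"
          using add_lat_in_cell_iff[of "x - y" jk] by (auto simp: algebra_simps)
        then show "f (x + lat jk) = (if jk = - cell_index (x - y) then F x else 0)"
          by (simp add: f_def per indicator_def)
      qed
      also have "\<dots> = F x"
      proof -
        let ?jk = "- cell_index (x - y)"
        have "x + lat ?jk - y \<in> cell"
          using cell_representative[of "x - y"] by (simp add: lat_uminus algebra_simps)
        from inJ[OF this] have "?jk \<in> J" using cell_index_add_lat[OF x] by simp
        then show ?thesis using \<open>finite J\<close> by (simp add: sum.delta)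
      qed
      finally show "(\<Sum>jk\<in>J. f (x + lat jk)) = F x" .
    qed
  qed (use cell_borel in simp)
  also have "(LINT x|lborel. f x) = (LINT x|lborel. f (x + y))"
    by (rule lborel_integral_shift[OF fm, symmetric])
  also have "\<dots> = (LINT x:cell|lborel. F (x + y))"
    unfolding set_lebesgue_integral_def fs ..
  finally show ?thesis .
qed

lemma periodic_bounded:
  fixes F :: "real^2 \<Rightarrow> real"
  assumes F: "continuous_on UNIV F" and per: "\<And>x jk. F (x + lat jk) = F x"
  obtains M where "M \<ge> 0" "\<And>x. \<bar>F x\<bar> \<le> M"
proof -
  have "compact (F ` cball a cell_radius)"
    by (intro compact_continuous_image continuous_on_subset[OF F]) auto
  then obtain M where M: "\<And>x. x \<in> cball a cell_radius \<Longrightarrow> \<bar>F x\<bar> \<le> M"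
    using compact_imp_bounded[of "F ` cball a cell_radius"] unfolding bounded_iff by force
  have "\<bar>F x\<bar> \<le> \<bar>M\<bar>" for x
  proof -
    have "F x = F (x - lat (cell_index x))"
      using per[of "x - lat (cell_index x)" "cell_index x"] by simp
    moreover have "x - lat (cell_index x) \<in> cball a cell_radius"
      using cell_representative cell_subset by blast
    ultimately show ?thesis using M by fastforce
  qed
  then show thesis using that[of "\<bar>M\<bar>"] by simp
qed

lemma partial_deriv_periodic:
  assumes "\<And>x jk. F (x + lat jk) = F x"
  shows "partial_deriv l F (x + lat jk) = partial_deriv l F x"
proof -
  have "(\<lambda>y. F (y - lat (- jk))) = F" using assms[of _ jk] by (simp add: lat_uminus)
  then show ?thesis using fun_cong[OF partial_deriv_shift[of l F "lat (- jk)"], of x] by (simp add: lat_uminus)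
qed

lemma cell_integral_partial_deriv:
  fixes F :: "real^2 \<Rightarrow> real"
  assumes F: "\<And>x. F differentiable at x" "continuous_on UNIV (partial_deriv l F)"
    and per: "\<And>x jk. F (x + lat jk) = F x"
  shows "(LINT x:cell|lborel. partial_deriv l F x) = 0"
proof -
  have cF: "continuous_on UNIV F"
    using F(1) by (simp add: continuous_at_imp_continuous_on differentiable_imp_continuous_within)
  obtain M1 where M1: "M1 \<ge> 0" "\<And>x. \<bar>F x\<bar> \<le> M1" using periodic_bounded[OF cF per] by blast
  obtain M2 where M2: "M2 \<ge> 0" "\<And>x. \<bar>partial_deriv l F x\<bar> \<le> M2"
    using periodic_bounded[OF F(2) partial_deriv_periodic[OF per]] by blast
  show ?thesis
  proof (rule integral_partial_deriv_translation_invariant[OF _ emeasure_cell F])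
    show "\<bar>F x\<bar> \<le> M1 + M2" "\<bar>partial_deriv l F x\<bar> \<le> M1 + M2" for x
      using M1(1) M2(1) M1(2)[of x] M2(2)[of x] by linarith+
    show "(LINT x:cell|lborel. F (x + t *\<^sub>R axis l 1)) = (LINT x:cell|lborel. F x)" for t
      by (rule cell_integral_shift[OF cF per])
  qed (use cell_borel in simp)
qed

lemma cell_integral_laplacian:
  assumes h: "C2_on UNIV h" and per: "\<And>x jk. h (x + lat jk) = h x"
  shows "(LINT x:cell|lborel. laplacian h x) = 0"
proof -
  note c = C2_on_continuous[OF h]
  have z: "(LINT x:cell|lborel. partial_deriv l (partial_deriv l h) x) = 0" for l
    by (rule cell_integral_partial_deriv[OF _ c(3) partial_deriv_periodic[OF per]])
      (use C2_onD[OF h] in blast)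
  have "(LINT x:cell|lborel. laplacian h x) =
    (LINT x:cell|lborel. partial_deriv 1 (partial_deriv 1 h) x + partial_deriv 2 (partial_deriv 2 h) x)"
    by (simp add: laplacian_def sum_2)
  also have "\<dots> = 0" using z set_integrable_cell[OF c(3)] by (simp add: set_integral_add)
  finally show ?thesis .
qed

text \<open>Each point \<open>q\<close> of \<open>Z\<close> is uniquely \<open>p - lat jk\<close> with \<open>p\<close> in the cell.\<close>
lemma cell_integral_sum_bumps:
  fixes m :: "real^2 \<Rightarrow> nat"
  assumes Z: "\<And>x jk. x + lat jk \<in> Z \<longleftrightarrow> x \<in> Z" and fin: "finite (Z \<inter> cell)"
    and m: "\<And>x jk. m (x + lat jk) = m x"
  shows "(LINT x:cell|lborel. (\<Sum>q\<in>Z \<inter> ball x 1. m q * bump (x - q))) = 4 * pi * (\<Sum>p\<in>Z \<inter> cell. m p)"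
proof -
  \<comment> \<open>The additional 1 is the reach of a bump centred in the cell.\<close>
  define J where "J = cell_index ` cball a (cell_radius + 1)"
  have J: "finite J" unfolding J_def by (rule finite_cell_index)
  have nb: "norm y < 1" if "bump y \<noteq> 0" for y using that bump_eq_0[of y] by force
  have near: "cell_index x \<in> J" if "p \<in> cell" "norm (x - p) < 1" for x p
  proof -
    have "dist a p \<le> cell_radius" using that(1) cell_subset by auto
    moreover have "dist a x \<le> dist a p + dist p x" by (rule dist_triangle)
    ultimately show ?thesis using that(2) by (auto simp: J_def dist_norm norm_minus_commute)
  qed
  have Z': "x - lat jk \<in> Z \<longleftrightarrow> x \<in> Z" and m': "m (x - lat jk) = m x" for x jk
    using Z[of x "- jk"] m[of x "- jk"] by (simp_all add: lat_uminus)
  have bc: "continuous_on UNIV (\<lambda>x. bump (x + lat jk - p))" for jk p by (intro continuous_intros)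
  have b1: "4 * pi = (LINT x:cell|lborel. (\<Sum>jk\<in>J. bump (x + lat jk - p)))" if p: "p \<in> cell" for p
  proof -
    have "(LINT x|lborel. bump (x - p)) = (LINT x:cell|lborel. (\<Sum>jk\<in>J. bump (x + lat jk - p)))"
    proof (rule integral_unfold_cells[OF _ J])
      show "integrable lborel (\<lambda>x. bump (x - p))"
        using has_bochner_integral_bump_shift by (auto simp: has_bochner_integral_iff)
      show "cell_index x \<in> J" if "bump (x - p) \<noteq> 0" for x
        using that bump_eq_0[of "x - p"] near[OF p] by force
    qed
    then show ?thesis using has_bochner_integral_bump_shift[of p] by (simp add: has_bochner_integral_iff)
  qed
  have pw: "(\<Sum>q\<in>Z \<inter> ball x 1. m q * bump (x - q)) = (\<Sum>p\<in>Z \<inter> cell. m p * (\<Sum>jk\<in>J. bump (x + lat jk - p)))"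
    if x: "x \<in> cell" for x
  proof -
    \<comment> \<open>The pairs for which the shifted bump is seen at \<open>x\<close>. They
      correspond to the zeros \<open>p - lat jk\<close> in \<open>ball x 1\<close>;
      \<open>cell_index\<close> recovers the pair from the zero.\<close>
    define T where "T = {(p, jk). p \<in> Z \<inter> cell \<and> jk \<in> J \<and> norm (x + lat jk - p) < 1}"
    have "(\<Sum>p\<in>Z \<inter> cell. m p * (\<Sum>jk\<in>J. bump (x + lat jk - p)))
      = (\<Sum>(p, jk)\<in>(Z \<inter> cell) \<times> J. m p * bump (x + lat jk - p))"
      by (simp add: sum_distrib_left sum.cartesian_product)
    also have "\<dots> = (\<Sum>(p, jk)\<in>T. m p * bump (x + lat jk - p))"
      by (rule sum.mono_neutral_right) (use fin J in \<open>auto simp: T_def dest: nb\<close>)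
    also have "\<dots> = (\<Sum>q\<in>Z \<inter> ball x 1. m q * bump (x - q))"
    proof (rule sum.reindex_bij_witness[of _ "\<lambda>q. (q - lat (cell_index q), - cell_index q)" "\<lambda>(p, jk). p - lat jk"])
      fix t assume t: "t \<in> T"
      obtain p jk where tp: "t = (p, jk)" by (cases t)
      have p: "p \<in> Z" "p \<in> cell" "norm (x + lat jk - p) < 1" using t by (auto simp: T_def tp)
      have "cell_index (p - lat jk) = - jk"
        using cell_index_add_lat[OF p(2), of "- jk"] by (simp add: lat_uminus)
      then show "(case case t of (p, jk) \<Rightarrow> p - lat jk of q \<Rightarrow> (q - lat (cell_index q), - cell_index q)) = t"
        by (simp add: tp lat_uminus)
      show "(case t of (p, jk) \<Rightarrow> p - lat jk) \<in> Z \<inter> ball x 1"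
        using p Z' by (simp add: tp dist_norm algebra_simps)
      show "real (m (case t of (p, jk) \<Rightarrow> p - lat jk)) * bump (x - (case t of (p, jk) \<Rightarrow> p - lat jk))
        = (case t of (p, jk) \<Rightarrow> real (m p) * bump (x + lat jk - p))"
        by (simp add: tp m' algebra_simps)
    next
      fix q assume q: "q \<in> Z \<inter> ball x 1"
      show "(case (q - lat (cell_index q), - cell_index q) of (p, jk) \<Rightarrow> p - lat jk) = q"
        by (simp add: lat_uminus)
      have "norm (x + lat (- cell_index q) - (q - lat (cell_index q))) < 1"
        using q by (simp add: lat_uminus dist_norm)
      moreover from near[OF cell_representative this] have "- cell_index q \<in> J"
        using cell_index_add_lat[OF x] by simp
      ultimately show "(q - lat (cell_index q), - cell_index q) \<in> T"
        using q Z' cell_representative by (simp add: T_def)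
    qed
    finally show ?thesis by simp
  qed
  have "(LINT x:cell|lborel. (\<Sum>q\<in>Z \<inter> ball x 1. m q * bump (x - q)))
    = (LINT x:cell|lborel. (\<Sum>p\<in>Z \<inter> cell. m p * (\<Sum>jk\<in>J. bump (x + lat jk - p))))"
    by (rule set_lebesgue_integral_cong) (use cell_borel pw in auto)
  also have "\<dots> = (\<Sum>p\<in>Z \<inter> cell. LINT x:cell|lborel. m p * (\<Sum>jk\<in>J. bump (x + lat jk - p)))"
    unfolding set_lebesgue_integral_def scaleR_sum_right
  proof (rule Bochner_Integration.integral_sum)
    fix p
    have "continuous_on UNIV (\<lambda>x. m p * (\<Sum>jk\<in>J. bump (x + lat jk - p)))" by (intro continuous_intros)
    from set_integrable_cell[OF this]
    show "integrable lborel (\<lambda>x. indicator cell x *\<^sub>R (m p * (\<Sum>jk\<in>J. bump (x + lat jk - p))))"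
      by (simp add: set_integrable_def)
  qed
  also have "\<dots> = (\<Sum>p\<in>Z \<inter> cell. m p * (4 * pi))"
  proof (intro sum.cong refl)
    fix p assume "p \<in> Z \<inter> cell"
    then show "(LINT x:cell|lborel. m p * (\<Sum>jk\<in>J. bump (x + lat jk - p))) = m p * (4 * pi)"
      unfolding set_integral_mult_right by (subst b1[of p]) simp_all
  qed
  finally show ?thesis by (simp add: sum_distrib_left mult.commute)
qed

end

section \<open>Gauge periodicity and the flux through a cell\<close>

lemma log_singularity_shift:
  assumes f: "\<And>x. cmod (f (x + c)) = cmod (f x)" and s: "log_singularity f p m"
  shows "log_singularity f (p + c) m"
proof -
  obtain r k where r: "r > 0" "C2_on (ball p r) k"
    and k: "\<And>x. x \<in> ball p r - {p} \<Longrightarrow> f x \<noteq> 0 \<and> ln ((cmod (f x))^2) = real m * ln ((x - p) \<bullet> (x - p)) + k x"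
    using s unfolding log_singularity_def by blast
  have im: "(\<lambda>y. y - c) ` ball (p + c) r = ball p r"
  proof
    show "ball p r \<subseteq> (\<lambda>y. y - c) ` ball (p + c) r"
    proof
      fix x assume "x \<in> ball p r"
      then show "x \<in> (\<lambda>y. y - c) ` ball (p + c) r" by (intro image_eqI[of _ _ "x + c"]) (auto simp: dist_norm)
    qed
  qed (auto simp: dist_norm algebra_simps)
  have "C2_on (ball (p + c) r) (\<lambda>y. k (y - c))"
    using r(2) unfolding C2_on_shift[symmetric] im .
  moreover have "f x \<noteq> 0 \<and> ln ((cmod (f x))^2) = real m * ln ((x - (p + c)) \<bullet> (x - (p + c))) + k (x - c)"
    if x: "x \<in> ball (p + c) r - {p + c}" for x
  proof -
    have e: "x - c - p = x - (p + c)" by simp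
    have "x - c \<in> ball p r - {p}" using x im by auto
    from k[OF this] have "f (x - c) \<noteq> 0" "ln ((cmod (f (x - c)))^2) = real m * ln ((x - (p + c)) \<bullet> (x - (p + c))) + k (x - c)"
      unfolding e by auto
    moreover have "cmod (f x) = cmod (f (x - c))" using f[of "x - c"] by simp
    ultimately show ?thesis by (metis norm_eq_zero)
  qed
  ultimately show ?thesis unfolding log_singularity_def using r(1) by blast
qed

lemma gauge_periodic_cmod:
  assumes "gauge_periodic \<tau> f A"
  shows "cmod (f (x + \<tau>)) = cmod (f x)"
  using assms unfolding gauge_periodic_def by (auto simp: norm_mult)

text \<open>As a truth-valued function of the point the equation can itself be periodic, which lets
  \<open>periodic_lat\<close> extend it from the cell to the plane.\<close>

definition gauge_covariant_eq :: "(real^2 \<Rightarrow> complex) \<Rightarrow> (2 \<Rightarrow> real^2 \<Rightarrow> real) \<Rightarrow> real^2 \<Rightarrow> bool"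
  where "gauge_covariant_eq f A x \<longleftrightarrow>
    partial_deriv 1 f x + \<i> * partial_deriv 2 f x = \<i> * (of_real (A 1 x) + \<i> * of_real (A 2 x)) * f x"

text \<open>The derivative of the phase adds i (d_1 xi + i d_2 xi) f on the left, which is what the
  shift of \<open>A\<close> adds on the right. What remains is the equation at \<open>x\<close>
  times a phase.\<close>

lemma gauge_covariant_eq_shift:
  assumes gp: "gauge_periodic \<tau> f A" and f: "smooth f"
  shows "gauge_covariant_eq f A (x + \<tau>) = gauge_covariant_eq f A x"
proof -
  obtain \<xi> :: "real^2 \<Rightarrow> real" where \<xi>: "smooth \<xi>" and fx: "\<And>x. f (x + \<tau>) = exp (\<i> * of_real (\<xi> x)) * f x"
    and Ax: "\<And>l x. A l (x + \<tau>) = A l x + partial_deriv l \<xi> x"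
    using gp unfolding gauge_periodic_def by blast
  define u where "u x = exp (\<i> * of_real (\<xi> x))" for x
  have fd: "f differentiable at x" using f smooth_on_differentiable by blast
  have D\<xi>: "(\<xi> has_derivative frechet_derivative \<xi> (at x)) (at x)"
    using \<xi> smooth_on_differentiable by (blast intro: has_derivative_frechet)
  have Di: "((\<lambda>x. \<i> * of_real (\<xi> x)) has_derivative (\<lambda>h. \<i> * of_real (frechet_derivative \<xi> (at x) h))) (at x)"
    by (intro has_derivative_mult_right has_derivative_of_real D\<xi>)
  have De: "(exp has_derivative (*) (exp (\<i> * of_real (\<xi> x)))) (at (\<i> * of_real (\<xi> x)))"
    using DERIV_exp unfolding has_field_derivative_def by blast
  have Du: "(u has_derivative (\<lambda>h. u x * (\<i> * of_real (frechet_derivative \<xi> (at x) h)))) (at x)"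
    unfolding u_def by (rule has_derivative_compose[OF Di De])
  have ud: "u differentiable at x" using Du by (auto simp: differentiable_def)
  have pu: "partial_deriv l u x = u x * (\<i> * of_real (partial_deriv l \<xi> x))" for l
    unfolding partial_deriv_eq[OF Du] by (simp add: partial_deriv_def)
  have pf: "partial_deriv l f (x + \<tau>) = u x * (partial_deriv l f x + \<i> * of_real (partial_deriv l \<xi> x) * f x)" for l
  proof -
    have "partial_deriv l f (x + \<tau>) = partial_deriv l (\<lambda>y. f (y + \<tau>)) x"
      using fun_cong[OF partial_deriv_shift[of l f "- \<tau>"], of x] by simp
    also have "\<dots> = partial_deriv l (\<lambda>y. u y * f y) x" by (simp only: fx u_def)
    also have "\<dots> = u x * (partial_deriv l f x + \<i> * of_real (partial_deriv l \<xi> x) * f x)"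
      unfolding partial_deriv_mult[OF ud fd] pu by (simp add: algebra_simps)
    finally show ?thesis .
  qed
  have u0: "u x \<noteq> 0" by (simp add: u_def)
  have "gauge_covariant_eq f A (x + \<tau>) \<longleftrightarrow>
    u x * (partial_deriv 1 f x + \<i> * partial_deriv 2 f x) = u x * (\<i> * (of_real (A 1 x) + \<i> * of_real (A 2 x)) * f x)"
    unfolding gauge_covariant_eq_def pf Ax fx u_def[symmetric] by (auto simp: algebra_simps)
  then show ?thesis using u0 by (simp add: gauge_covariant_eq_def)
qed

text \<open>Equation and zeros are given in one cell only, whereas \<open>regularized_log\<close>
  works on the whole plane. Gauge covariance extends the former, and periodicity of the modulus the
  latter together with the multiplicities.\<close>

theorem (in period_lattice) vortex_cell_flux:
  fixes f :: "real^2 \<Rightarrow> complex" and A :: "2 \<Rightarrow> real^2 \<Rightarrow> real"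
  assumes f: "smooth f" and A: "\<And>l. smooth (A l)"
    and gp: "gauge_periodic \<tau>1 f A" "gauge_periodic \<tau>2 f A"
    and eq: "\<And>x. x \<in> cell \<Longrightarrow> gauge_covariant_eq f A x"
    and zeros: "has_zeros_counted f cell n"
  shows "set_integrable lborel cell (field_strength A)"
    and "(LINT x:cell|lborel. field_strength A x) = 2 * pi * real n"
proof -
  define F where "F = field_strength A"
  have cF: "continuous_on UNIV F" unfolding F_def by (rule field_strength_continuous[OF A])
  have nper: "cmod (f (x + lat jk)) = cmod (f x)" for x jk
    by (rule periodic_lat[of "\<lambda>x. cmod (f x)"]) (rule gauge_periodic_cmod[OF gp(1)], rule gauge_periodic_cmod[OF gp(2)])
  have eqper: "gauge_covariant_eq f A (x + lat jk) = gauge_covariant_eq f A x" for x jk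
    by (rule periodic_lat[of "gauge_covariant_eq f A"]) (rule gauge_covariant_eq_shift[OF gp(1) f], rule gauge_covariant_eq_shift[OF gp(2) f])
  have eqall: "gauge_covariant_eq f A x" for x
  proof -
    have "gauge_covariant_eq f A (x - lat (cell_index x) + lat (cell_index x))"
      unfolding eqper by (rule eq[OF cell_representative])
    then show ?thesis by simp
  qed
  define Z where "Z = {x. f x = 0}"
  have Zper: "x + lat jk \<in> Z \<longleftrightarrow> x \<in> Z" for x jk
    using nper[of x jk] norm_eq_zero[of "f x"] norm_eq_zero[of "f (x + lat jk)"] unfolding Z_def by simp
  have Zc: "{p \<in> cell. f p = 0} = Z \<inter> cell" by (auto simp: Z_def)
  obtain m0 where Z: "finite (Z \<inter> cell)" "\<And>p. p \<in> Z \<inter> cell \<Longrightarrow> zero_of_multiplicity f p (m0 p)"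
    "(\<Sum>p\<in>Z \<inter> cell. m0 p) = n"
    using zeros unfolding has_zeros_counted_def Zc by auto
  \<comment> \<open>The multiplicity of a zero is read off at its representative in the cell, which
    makes it periodic by construction.\<close>
  define m where "m q = m0 (q - lat (cell_index q))" for q
  have mper: "m (x + lat jk) = m x" for x jk
  proof -
    have "x + lat jk - lat (jk + cell_index x) \<in> cell"
      using cell_representative[of x] by (simp add: lat_def algebra_simps)
    then have "cell_index (x + lat jk) = jk + cell_index x" by (simp only: diff_lat_in_cell_iff)
    then show ?thesis by (simp add: m_def lat_def algebra_simps)
  qed
  have mcell: "m p = m0 p" if "p \<in> cell" for p
    using diff_lat_in_cell_iff[of p 0] that by (simp add: m_def lat_zero)
  have sing: "log_singularity f q (m q)" if "q \<in> Z" for q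
  proof -
    let ?p = "q - lat (cell_index q)"
    have "?p \<in> Z \<inter> cell" using that cell_representative[of q] Zper[of ?p "cell_index q"] by simp
    from log_singularity_shift[OF nper zero_of_multiplicity_log_singularity[OF Z(2)[OF this]], of "cell_index q"]
    show ?thesis by (simp add: m_def)
  qed
  have lap: "laplacian (\<lambda>x. ln ((cmod (f x))^2)) x = - 2 * F x" if "f x \<noteq> 0" for x
    unfolding F_def by (rule laplacian_ln_cmod_sq[OF f A eqall[unfolded gauge_covariant_eq_def] that])
  obtain h where h: "C2_on UNIV h"
    and hout: "\<And>x. f x \<noteq> 0 \<Longrightarrow> h x = ln ((cmod (f x))^2) - (\<Sum>q\<in>Z \<inter> ball x 1. m q * trunc_log (x - q))"
    and hlap: "\<And>x. laplacian h x = - 2 * F x + (\<Sum>q\<in>Z \<inter> ball x 1. m q * bump (x - q))"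
    using regularized_log[OF f cF lap sing[unfolded Z_def]] unfolding Z_def by blast
  have hper0: "h (x + lat jk) = h x" if x: "f x \<noteq> 0" for x jk
  proof -
    have x': "f (x + lat jk) \<noteq> 0" using x Zper[of x jk] by (simp add: Z_def)
    have "(\<Sum>q\<in>Z \<inter> ball (x + lat jk) 1. m q * trunc_log (x + lat jk - q)) = (\<Sum>q\<in>Z \<inter> ball x 1. m q * trunc_log (x - q))"
    proof (rule sum.reindex_bij_witness[of _ "\<lambda>q. q + lat jk" "\<lambda>q. q - lat jk"])
      fix q assume q: "q \<in> Z \<inter> ball (x + lat jk) 1"
      show "q - lat jk \<in> Z \<inter> ball x 1"
        using q Zper[of "q - lat jk" jk] by (auto simp: dist_norm algebra_simps)
      show "real (m (q - lat jk)) * trunc_log (x - (q - lat jk)) = real (m q) * trunc_log (x + lat jk - q)"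
        using mper[of "q - lat jk" jk] by (simp add: algebra_simps)
    next
      fix q assume q: "q \<in> Z \<inter> ball x 1"
      then show "q + lat jk \<in> Z \<inter> ball (x + lat jk) 1"
        using Zper by (auto simp: dist_norm)
    qed auto
    then show ?thesis unfolding hout[OF x] hout[OF x'] nper by simp
  qed
  have hper: "h (x + lat jk) = h x" for x jk
  proof (cases "f x = 0")
    case True
    then obtain r where r: "r > 0" "\<And>y. y \<in> ball x r - {x} \<Longrightarrow> f y \<noteq> 0"
      using sing[of x] unfolding log_singularity_def Z_def by blast
    show ?thesis
    proof (rule continuous_eq_at_puncture[of "ball x r" x "\<lambda>x. h (x + lat jk)" h])
      show "continuous_on (ball x r) (\<lambda>x. h (x + lat jk))"
        by (rule continuous_on_compose2[OF C2_on_continuous(1)[OF h]]) (auto intro!: continuous_intros)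
      show "continuous_on (ball x r) h" by (rule continuous_on_subset[OF C2_on_continuous(1)[OF h]]) simp
    qed (use r hper0 in auto)
  qed (rule hper0)
  have iF: "set_integrable lborel cell F" by (rule set_integrable_cell[OF cF])
  have ih: "set_integrable lborel cell (laplacian h)" by (rule set_integrable_cell[OF C2_on_continuous(4)[OF h]])
  have "(LINT x:cell|lborel. laplacian h x) = 0" by (rule cell_integral_laplacian[OF h hper])
  moreover have "(LINT x:cell|lborel. (\<Sum>q\<in>Z \<inter> ball x 1. m q * bump (x - q))) = 4 * pi * (\<Sum>p\<in>Z \<inter> cell. m p)"
    by (rule cell_integral_sum_bumps[OF Zper Z(1) mper])
  moreover have "(LINT x:cell|lborel. (\<Sum>q\<in>Z \<inter> ball x 1. m q * bump (x - q)))
    = (LINT x:cell|lborel. laplacian h x + 2 * F x)"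
    by (simp add: hlap)
  moreover have "\<dots> = (LINT x:cell|lborel. laplacian h x) + 2 * (LINT x:cell|lborel. F x)"
    using ih iF by (simp add: set_integral_add)
  moreover have "(\<Sum>p\<in>Z \<inter> cell. m p) = n" using mcell Z(3) by simp
  ultimately have "2 * (LINT x:cell|lborel. F x) = 4 * pi * real n" by simp
  then show "(LINT x:cell|lborel. field_strength A x) = 2 * pi * real n" by (simp add: F_def)
  show "set_integrable lborel cell (field_strength A)" using iF by (simp add: F_def)
qed

theorem theorem2p3:
  fixes N :: nat and e g v :: real and n :: "nat \<Rightarrow> nat"
    and \<phi> :: "nat \<Rightarrow> real^2 \<Rightarrow> complex"
    and B :: "nat \<Rightarrow> 2 \<Rightarrow> real^2 \<Rightarrow> real"
  assumes "N > 0" and "e > 0" and "g > 0" and "v > 0"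
    and "\<And>i. i \<in> {1..N} \<Longrightarrow> smooth (\<phi> i)"
    and "\<And>i l. i \<in> {1..N} \<Longrightarrow> smooth (B i l)"
  shows "(\<forall>a \<tau>1 \<tau>2.
            \<tau>1 \<noteq> \<tau>2 \<and> independent {\<tau>1, \<tau>2}
          \<and> (\<forall>i\<in>{1..N}. gauge_periodic \<tau>1 (\<phi> i) (B i) \<and> gauge_periodic \<tau>2 (\<phi> i) (B i))
          \<and> vortex_solution_on (period_cell a \<tau>1 \<tau>2) N e g v \<phi> B
          \<and> (\<forall>i\<in>{1..N}. has_zeros_counted (\<phi> i) (period_cell a \<tau>1 \<tau>2) (n i))
          \<longrightarrow> (\<forall>i\<in>{1..N}.
                set_integrable lborel (period_cell a \<tau>1 \<tau>2) (field_strength (B i))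
              \<and> (LINT x:period_cell a \<tau>1 \<tau>2|lborel. field_strength (B i) x) = 2 * pi * real (n i)))
       \<and> (vortex_solution_on UNIV N e g v \<phi> B
          \<and> (\<forall>i\<in>{1..N}. has_zeros_counted (\<phi> i) UNIV (n i))
          \<and> (\<forall>i\<in>{1..N}. ((\<lambda>x. cmod (\<phi> i x)) \<longlongrightarrow> v) at_infinity)
          \<longrightarrow> (\<forall>i\<in>{1..N}.
                integrable lborel (field_strength (B i))
              \<and> (LINT x|lborel. field_strength (B i) x) = 2 * pi * real (n i)))"
proof (intro conjI impI allI ballI; (elim conjE)?)
  fix a \<tau>1 \<tau>2 i
  assume \<tau>: "\<tau>1 \<noteq> \<tau>2" "independent {\<tau>1, \<tau>2}"
    and gp: "\<forall>i\<in>{1..N}. gauge_periodic \<tau>1 (\<phi> i) (B i) \<and> gauge_periodic \<tau>2 (\<phi> i) (B i)"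
    and sol: "vortex_solution_on (period_cell a \<tau>1 \<tau>2) N e g v \<phi> B"
    and zeros: "\<forall>i\<in>{1..N}. has_zeros_counted (\<phi> i) (period_cell a \<tau>1 \<tau>2) (n i)"
    and i: "i \<in> {1..N}"
  interpret period_lattice a \<tau>1 \<tau>2 by unfold_locales (rule \<tau>)+
  have eq: "gauge_covariant_eq (\<phi> i) (B i) x" if "x \<in> period_cell a \<tau>1 \<tau>2" for x
    using sol i that unfolding vortex_solution_on_def gauge_covariant_eq_def by blast
  have "gauge_periodic \<tau>1 (\<phi> i) (B i)" "gauge_periodic \<tau>2 (\<phi> i) (B i)"
    "has_zeros_counted (\<phi> i) (period_cell a \<tau>1 \<tau>2) (n i)" using gp zeros i by auto
  note * = vortex_cell_flux[OF assms(5)[OF i] assms(6)[OF i] this(1,2) eq this(3)]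
  show "set_integrable lborel (period_cell a \<tau>1 \<tau>2) (field_strength (B i))" by (rule *(1))
  show "(LINT x:period_cell a \<tau>1 \<tau>2|lborel. field_strength (B i) x) = 2 * pi * real (n i)" by (rule *(2))
next
  fix i
  assume sol: "vortex_solution_on UNIV N e g v \<phi> B"
    and zeros: "\<forall>i\<in>{1..N}. has_zeros_counted (\<phi> i) UNIV (n i)"
    and lim: "\<forall>i\<in>{1..N}. ((\<lambda>x. cmod (\<phi> i x)) \<longlongrightarrow> v) at_infinity"
    and i: "i \<in> {1..N}"
  note * = vortex_plane_flux[OF assms sol bspec[OF lim] i bspec[OF zeros i]]
  show "integrable lborel (field_strength (B i))" by (rule *(1))
  show "(LINT x|lborel. field_strength (B i) x) = 2 * pi * real (n i)" by (rule *(2))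
qed

end
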